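(* Let $q=p^e$ be a fixed prime power and $k>0$ a fixed integer. There is a constant $C>0$ depending only on $q$ and $k$ such that the following holds. Let $(m_j,n_j,f_j)_{j\ge1}$ be a sequence where $m_j,n_j$ are positive integers with $n_j\ge q$, $m_j\to\infty$ and $m_j\ge C\,\log_q n_j\,\log_q\log_q n_j$ for all $j$, and where $f_j\in\mathbb{F}_q[t,x]$ is a square-free polynomial with $\deg_x f_j\le k$ and $\deg_t f_j\le n_j$. Then, as $j\to\infty$, $$\#\{a\in\mathbb{F}_q[t] : \deg a<m_j,\ f_j(a)\text{ is square-free}\} = c_{f_j}\,q^{m_j}\,(1+o(1)),$$ i.e. the difference between the left side and $c_{f_j}q^{m_j}$ is $o(c_{f_j}q^{m_j})$.
   Context: $\mathbb{F}_q[t]$ is the polynomial ring over the finite field with $q$ elements; $\deg 0<m$ for every $m$. A polynomial in $\mathbb{F}_q[t]$ (resp. $\mathbb{F}_q[t,x]$) is square-free if it is nonzero and not divisible by the square of any non-constant polynomial. For $f\in\mathbb{F}_q[t,x]$ and $a\in\mathbb{F}_q[t]$, $f(a)$ denotes $f(t,a(t))$. $\mathcal{P}$ denotes the set of monic irreducible polynomials in $\mathbb{F}_q[t]$. For nonzero $D\in\mathbb{F}_q[t]$, $\|D\|=q^{\deg D}$ and $\rho_f(D)=\#\{a \bmod D : f(a)\equiv 0 \pmod D\}$. The constant $c_f$ is $c_f=\prod_{P\in\mathcal{P}}\left(1-\frac{\rho_f(P^2)}{\|P\|^2}\right)$. *)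

theory Defs
  imports
    "HOL-Analysis.Analysis"
    "HOL-Library.Landau_Symbols"
    "HOL-Computational_Algebra.Computational_Algebra"
    "HOL-Number_Theory.Cong"
begin

text \<open>
  The field with \<open>q\<close> elements is a type \<open>'a :: {field, finite}\<close> with \<open>CARD('a) = q\<close>.
  \<open>F_q[t]\<close> is \<open>'a poly\<close>, and \<open>F_q[t,x]\<close> is \<open>'a poly poly\<close>: the outer variable is \<open>x\<close>, the
  inner one \<open>t\<close>. So \<open>f(a)\<close> is \<open>poly f a\<close> and the degree of \<open>f\<close> in \<open>x\<close> is \<open>degree f\<close>.
  Square-free is the library's \<open>squarefree\<close>; the next two lemmas spell it out.
\<close>

lemma squarefree_poly_iff:
  fixes g :: "'a::field poly"
  shows "squarefree g \<longleftrightarrow> g \<noteq> 0 \<and> (\<forall>h. degree h > 0 \<longrightarrow> \<not> h\<^sup>2 dvd g)"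
proof
  assume sf: "squarefree g"
  have "g \<noteq> 0" using sf not_squarefree_0 by blast
  moreover have "\<not> h\<^sup>2 dvd g" if "degree h > 0" for h
    using sf that by (auto simp: squarefree_def dest!: is_unit_iff_degree[THEN iffD1, rotated])
  ultimately show "g \<noteq> 0 \<and> (\<forall>h. degree h > 0 \<longrightarrow> \<not> h\<^sup>2 dvd g)" by blast
next
  assume *: "g \<noteq> 0 \<and> (\<forall>h. degree h > 0 \<longrightarrow> \<not> h\<^sup>2 dvd g)"
  show "squarefree g"
    unfolding squarefree_def
  proof (intro allI impI)
    fix h assume h: "h\<^sup>2 dvd g"
    then have "h \<noteq> 0" "degree h = 0" using * by auto
    then show "h dvd 1" by (simp add: is_unit_iff_degree)
  qed
qed

text \<open>The constants of \<open>F_q[t,x]\<close> are the polynomials \<open>[:[:c:]:]\<close>.\<close>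

lemma squarefree_poly_poly_iff:
  fixes f :: "'a::field poly poly"
  shows "squarefree f \<longleftrightarrow> f \<noteq> 0 \<and> (\<forall>h. (\<nexists>c. h = [:[:c:]:]) \<longrightarrow> \<not> h\<^sup>2 dvd f)"
proof -
  have unit: "h dvd 1 \<longleftrightarrow> h \<noteq> 0 \<and> (\<exists>c. h = [:[:c:]:])" for h :: "'a poly poly"
  proof
    assume "h dvd 1"
    then obtain d where "h = [:d:]" "d dvd 1" by (auto simp: is_unit_poly_iff)
    then show "h \<noteq> 0 \<and> (\<exists>c. h = [:[:c:]:])" by (auto simp: is_unit_poly_iff)
  next
    assume "h \<noteq> 0 \<and> (\<exists>c. h = [:[:c:]:])"
    then show "h dvd 1" by (auto simp: is_unit_poly_iff dvd_field_iff)
  qed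
  show ?thesis
  proof
    assume sf: "squarefree f"
    have "f \<noteq> 0" using sf not_squarefree_0 by blast
    then show "f \<noteq> 0 \<and> (\<forall>h. (\<nexists>c. h = [:[:c:]:]) \<longrightarrow> \<not> h\<^sup>2 dvd f)"
      using sf unfolding squarefree_def unit by blast
  next
    assume *: "f \<noteq> 0 \<and> (\<forall>h. (\<nexists>c. h = [:[:c:]:]) \<longrightarrow> \<not> h\<^sup>2 dvd f)"
    then have "h \<noteq> 0" if "h\<^sup>2 dvd f" for h using that by auto
    then show "squarefree f" using * unfolding squarefree_def unit by blast
  qed
qed

definition deg_t :: "'a::zero poly poly \<Rightarrow> nat" where
  "deg_t f = Max ((\<lambda>i. degree (coeff f i)) ` {..degree f})"

definition monic_irreducibles :: "'a::field poly set" where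
  "monic_irreducibles = {P. lead_coeff P = 1 \<and> irreducible P}"

definition pnorm :: "'a::{field,finite} poly \<Rightarrow> real" where
  "pnorm D = real CARD('a) ^ degree D"

text \<open>Residue classes modulo \<open>D\<close> are represented by their remainders \<open>a mod D\<close>.\<close>

definition rho :: "'a::{field,finite} poly poly \<Rightarrow> 'a poly \<Rightarrow> nat" where
  "rho f D = card {a mod D | a. [poly f a = 0] (mod D)}"

text \<open>
  Unordered infinite product, the analogue of \<open>infsum\<close>: the limit of the finite
  subproducts. It exists when all factors lie in \<open>[0,1]\<close>, as is the case for \<open>c_const\<close>.
\<close>

definition uprod :: "('b \<Rightarrow> real) \<Rightarrow> 'b set \<Rightarrow> real" where
  "uprod g A = Lim (finite_subsets_at_top A) (prod g)"

definition c_const :: "'a::{field,finite} poly poly \<Rightarrow> real" where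
  "c_const f = uprod (\<lambda>P. 1 - real (rho f (P\<^sup>2)) / (pnorm P)\<^sup>2) monic_irreducibles"

lemma uprod_tendsto:
  assumes "\<And>x. x \<in> A \<Longrightarrow> 0 \<le> g x \<and> g x \<le> 1"
  shows "(prod g \<longlongrightarrow> uprod g A) (finite_subsets_at_top A)"
proof -
  define I where "I = {F. finite F \<and> F \<subseteq> A}"
  define L where "L = (INF F\<in>I. prod g F)"
  have nonneg: "0 \<le> prod g F" if "F \<in> I" for F
    using that assms by (intro prod_nonneg) (auto simp: I_def)
  have bdd: "bdd_below (prod g ` I)" using nonneg by (intro bdd_belowI[of _ 0]) auto
  have ne: "I \<noteq> {}" by (auto simp: I_def)
  have lower: "L \<le> prod g F" if "F \<in> I" for F
    unfolding L_def using that by (rule cINF_lower[OF bdd])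
  have mono: "prod g G \<le> prod g F" if "F \<subseteq> G" "G \<in> I" for F G
  proof -
    have F: "finite F" "F \<in> I" using that by (auto simp: I_def intro: finite_subset)
    have "prod g G = prod g (G - F) * prod g F"
      using that by (intro prod.subset_diff) (auto simp: I_def)
    also have "prod g (G - F) \<le> 1" using that assms by (intro prod_le_1) (auto simp: I_def)
    then have "prod g (G - F) * prod g F \<le> 1 * prod g F"
      using nonneg[OF F(2)] by (rule mult_right_mono)
    finally show ?thesis by simp
  qed
  have "(prod g \<longlongrightarrow> L) (finite_subsets_at_top A)"
  proof (rule decreasing_tendsto)
    show "\<forall>\<^sub>F F in finite_subsets_at_top A. L \<le> prod g F"
      unfolding eventually_finite_subsets_at_top
      by (intro exI[of _ "{}"]) (use lower in \<open>auto simp: I_def\<close>)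
  next
    fix x assume "L < x"
    then obtain F where F: "F \<in> I" "prod g F < x"
      unfolding L_def using cINF_less_iff[OF ne bdd] by blast
    show "\<forall>\<^sub>F G in finite_subsets_at_top A. prod g G < x"
      unfolding eventually_finite_subsets_at_top
    proof (intro exI[of _ F] conjI allI impI)
      show "finite F" "F \<subseteq> A" using F by (auto simp: I_def)
    next
      fix G assume "finite G \<and> F \<subseteq> G \<and> G \<subseteq> A"
      then show "prod g G < x" using mono[of F G] F(2) by (auto simp: I_def)
    qed
  qed
  then show ?thesis
    unfolding uprod_def using tendsto_Lim[OF finite_subsets_at_top_neq_bot] by metis
qed

lemma rho_le:
  fixes f :: "'a::{field,finite} poly poly" and D :: "'a poly"
  assumes "D \<noteq> 0"
  shows "real (rho f D) \<le> pnorm D"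
proof -
  define d where "d = degree D"
  define R where "R = {a mod D | a. [poly f a = 0] (mod D)}"
  have coeff0: "coeff r i = 0" if "r \<in> R" "i \<ge> d" for r i
  proof -
    obtain a where r: "r = a mod D" using \<open>r \<in> R\<close> by (auto simp: R_def)
    have "r = 0 \<or> degree r < d"
      using degree_mod_less[OF assms, of a] unfolding r d_def by blast
    then show ?thesis using that by (auto intro: coeff_eq_0)
  qed
  let ?h = "\<lambda>r. restrict (coeff r) {..<d}"
  have "inj_on ?h R"
  proof (rule inj_onI)
    fix r s assume rs: "r \<in> R" "s \<in> R" "?h r = ?h s"
    show "r = s"
    proof (rule poly_eqI)
      fix i show "coeff r i = coeff s i"
      proof (cases "i < d")
        case True then show ?thesis using fun_cong[OF rs(3), of i] by simp
      next
        case False then show ?thesis using coeff0 rs by simp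
      qed
    qed
  qed
  moreover have "?h ` R \<subseteq> {..<d} \<rightarrow>\<^sub>E (UNIV :: 'a set)"
    by (intro image_subsetI restrict_PiE_iff[THEN iffD2]) auto
  moreover have "finite ({..<d} \<rightarrow>\<^sub>E (UNIV :: 'a set))" by (intro finite_PiE) auto
  ultimately have "card R \<le> card ({..<d} \<rightarrow>\<^sub>E (UNIV :: 'a set))"
    by (rule card_inj_on_le)
  also have "\<dots> = CARD('a) ^ d" by (simp add: card_PiE)
  finally have "real (card R) \<le> real (CARD('a) ^ d)" by (rule of_nat_mono)
  then show ?thesis by (simp add: rho_def pnorm_def R_def d_def)
qed

lemma c_const_tendsto:
  fixes f :: "'a::{field,finite} poly poly"
  shows "((\<lambda>F. \<Prod>P\<in>F. 1 - real (rho f (P\<^sup>2)) / (pnorm P)\<^sup>2) \<longlongrightarrow> c_const f)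
           (finite_subsets_at_top monic_irreducibles)"
  unfolding c_const_def
proof (rule uprod_tendsto)
  fix P :: "'a poly" assume "P \<in> monic_irreducibles"
  then have P: "P\<^sup>2 \<noteq> 0" by (auto simp: monic_irreducibles_def)
  have "pnorm (P\<^sup>2) = (pnorm P)\<^sup>2"
    using P by (simp add: pnorm_def degree_power_eq power_mult[symmetric] mult.commute)
  moreover have "pnorm P > 0" by (simp add: pnorm_def)
  ultimately show "0 \<le> 1 - real (rho f (P\<^sup>2)) / (pnorm P)\<^sup>2 \<and>
      1 - real (rho f (P\<^sup>2)) / (pnorm P)\<^sup>2 \<le> 1"
    using rho_le[OF P, of f] by (simp add: divide_le_eq)
qed

end

theory Submission
  imports Defs "HOL-Real_Asymp.Real_Asymp"
begin

text \<open>
  Split the monic irreducibles \<open>P\<close> with \<open>P\<^sup>2\<close> dividing \<open>f(a)\<close> by degree, with \<open>y\<close> as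
  large as \<open>m\<close> permits; in particular \<open>y\<close> is at least twice \<open>log n\<close> to base \<open>q\<close>.

  For \<open>deg P \<le> y\<close>, Brun's pure sieve truncated at \<open>r\<close> of size \<open>log y\<close> gives the product
  \<open>V\<close> of the local densities: the conditions modulo at most \<open>r\<close> of the \<open>P\<^sup>2\<close> are
  exactly independent because \<open>2 y r \<le> m\<close>. This is what requires
  \<open>m \<ge> C log n log log n\<close>, and it uses \<open>\<Sum> 1/|P| = O(log y)\<close> over \<open>deg P \<le> y\<close>,
  which also bounds a nonzero \<open>V\<close> below by a negative power of \<open>y\<close>.

  For \<open>y < deg P < m/2\<close> a union bound suffices, since \<open>\<rho>(P\<^sup>2) \<le> k\<close> unless \<open>P\<close> divides
  an eliminant of degree \<open>O(n)\<close>.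

  For \<open>deg P \<ge> m/2\<close>, group the \<open>a\<close> by their derivative \<open>u\<close>. If \<open>P\<^sup>2\<close> divides \<open>f(a)\<close>,
  then \<open>P\<close> divides \<open>f(a)\<close> and \<open>f\<^sub>t(a) + u f\<^sub>x(a)\<close>, hence the eliminant of \<open>x\<close> from
  \<open>f\<close> and \<open>f\<^sub>t + u f\<^sub>x\<close>, which is nonzero for all but \<open>k\<close> values of \<open>u\<close>.
  So for each good \<open>u\<close> there are \<open>O(n + m)\<close> possible \<open>P\<close>, each with at most \<open>k\<close> choices
  of \<open>a\<close>, while a fibre of the derivative has about \<open>q\<close> to the power \<open>m/p\<close> elements.
\<close>

section \<open>Elimination in two variables\<close>

text \<open>The error must be small relative to \<open>c_const f\<close>, which has no positive
  lower bound uniform in \<open>f\<close> and can even be zero. A vanishing local factor makes both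
  sides vanish exactly. Otherwise dividing by \<open>V\<close> costs at most a constant times
  \<open>exp (2 * S)\<close>, where \<open>S\<close> is the sum of the local densities up to
  \<open>y\<close>; the truncation \<open>r\<close> is a multiple of \<open>log y\<close> large
  enough to pay for this loss as well as for the tail of the sieve.

  Freezing the derivative \<open>u\<close> is where characteristic \<open>p\<close> helps:
  \<open>P dvd pderiv (poly f a)\<close> becomes a polynomial condition on \<open>a\<close> whose
  coefficients depend only on \<open>u\<close> and \<open>f\<close>, so one eliminant serves a whole
  fibre. The number of \<open>u\<close> is \<open>q ^ m\<close> divided by the size of a fibre, so
  the union bound gains that size, far more than the factor \<open>n + m\<close> it loses. The gain
  exists because the kernel of the derivative contains all \<open>p\<close>-th powers.

  All parameters hang on one level \<open>i\<close>, with \<open>y = 2 ^ (i + 1)\<close> and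
  \<open>n\<close> at most \<open>q ^ (2 ^ i)\<close>; the estimate at level \<open>i\<close> is
  uniform in \<open>f\<close>, and sequences enter only at the end.\<close>

definition tdeg_le :: "'a::zero poly poly \<Rightarrow> nat \<Rightarrow> bool" where
  "tdeg_le f n \<longleftrightarrow> (\<forall>i. degree (coeff f i) \<le> n)"

text \<open>Unit content as in Gauss's lemma, phrased through divisors so that no content has to be
  computed; \<open>0\<close> is not primitive.\<close>

definition primitive :: "'a::field poly poly \<Rightarrow> bool" where
  "primitive d \<longleftrightarrow> (\<forall>c. [:c:] dvd d \<longrightarrow> c dvd 1)"

text \<open>These are the factors that remain non-constant over the fraction field of
  \<open>F_q[t]\<close>. Factors in \<open>t\<close> alone are left out, since they do not obstruct
  the elimination of \<open>x\<close>.\<close>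

definition nontrivial_factor :: "'a::field poly poly \<Rightarrow> 'a poly poly \<Rightarrow> bool" where
  "nontrivial_factor d f \<longleftrightarrow> degree d > 0 \<and> primitive d \<and> d dvd f"

lemma tdeg_le_deg_t: "deg_t f \<le> n \<Longrightarrow> tdeg_le f n"
proof -
  assume *: "deg_t f \<le> n"
  have "degree (coeff f i) \<le> n" for i
  proof (cases "i \<le> degree f")
    case True
    then have "degree (coeff f i) \<le> deg_t f"
      unfolding deg_t_def by (intro Max_ge) auto
    with * show ?thesis by simp
  next
    case False
    then show ?thesis by (simp add: coeff_eq_0)
  qed
  then show ?thesis by (simp add: tdeg_le_def)
qed

lemma exists_irreducible_factor:
  fixes D :: "'a::field poly"
  assumes "degree D > 0"
  shows "\<exists>P. irreducible P \<and> P dvd D"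
  using assms
proof (induction "degree D" arbitrary: D rule: less_induct)
  case less
  show ?case
  proof (cases "irreducible D")
    case False
    moreover have "D \<noteq> 0" "\<not> D dvd 1" using less.prems by (auto simp: is_unit_poly_iff)
    ultimately obtain a b where ab: "D = a * b" "\<not> a dvd 1" "\<not> b dvd 1"
      by (auto simp: irreducible_def)
    have "a \<noteq> 0" "b \<noteq> 0" using ab \<open>D \<noteq> 0\<close> by auto
    then have "degree a > 0" "degree b > 0" using ab by (auto simp: is_unit_iff_degree)
    then have "degree a < degree D" using ab \<open>a \<noteq> 0\<close> \<open>b \<noteq> 0\<close> by (simp add: degree_mult_eq)
    then obtain P where "irreducible P" "P dvd a" using less.hyps \<open>degree a > 0\<close> by blast
    then show ?thesis using ab by auto
  qed auto
qed

lemma primitive_dvd: "primitive d \<Longrightarrow> e dvd d \<Longrightarrow> primitive e"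
  unfolding primitive_def by (meson dvd_trans)

text \<open>A form of Gauss's lemma: an irreducible of \<open>F[t]\<close> stays prime as a constant
  polynomial in \<open>x\<close> and cannot divide the primitive \<open>d\<close>, so each prime
  factor of \<open>D\<close> is absorbed by the cofactor of \<open>d\<close>.\<close>

lemma primitive_dvd_cancel_const:
  fixes d f :: "'a::field poly poly"
  assumes "primitive d" "D \<noteq> 0" "d dvd [:D:] * f"
  shows "d dvd f"
  using assms(2,3)
proof (induction "degree D" arbitrary: D f rule: less_induct)
  case less
  show ?case
  proof (cases "degree D = 0")
    case True
    then have "D dvd 1" using less.prems by (simp add: is_unit_iff_degree)
    then obtain E where E: "1 = D * E" by (auto elim: dvdE)
    have "[:E:] * ([:D:] * f) = [:D * E:] * f"
      by (simp add: mult.commute[of E D])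
    also have "\<dots> = f" unfolding E[symmetric] by simp
    finally have "f = [:E:] * ([:D:] * f)" ..
    then show ?thesis using less.prems by (metis dvd_mult)
  next
    case False
    then obtain P E where P: "irreducible P" "D = P * E"
      using exists_irreducible_factor[of D] unfolding dvd_def by auto
    have "prime_elem [:P:]"
      using P(1) by (intro lift_prime_elem_poly field_poly_irreducible_imp_prime)
    have nz: "P \<noteq> 0" "E \<noteq> 0" using less.prems P by auto
    have notdvd: "\<not> [:P:] dvd d" using assms(1) P(1) unfolding primitive_def irreducible_def by blast
    obtain v where v: "[:D:] * f = d * v" using less.prems by (auto elim: dvdE)
    have eq: "[:P:] * ([:E:] * f) = d * v" using v P by (simp add: mult.commute)
    then have "[:P:] dvd d * v" by (metis dvd_triv_left)
    then have "[:P:] dvd v" using \<open>prime_elem [:P:]\<close> notdvd by (auto dest: prime_elem_dvd_multD)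
    then obtain w where w: "v = [:P:] * w" by (auto elim: dvdE)
    have "[:P:] * ([:E:] * f) = [:P:] * (d * w)" using eq w by (simp add: mult_ac)
    then have "[:E:] * f = d * w" using nz by (subst (asm) mult_left_cancel) auto
    then have "d dvd [:E:] * f" by simp
    moreover have "degree E < degree D"
    proof -
      have "degree P > 0" using P(1) nz by (auto simp: irreducible_def is_unit_iff_degree)
      then show ?thesis using P nz by (simp add: degree_mult_eq)
    qed
    ultimately show ?thesis using less.hyps nz by blast
  qed
qed

text \<open>Each non-unit constant divided out lowers the \<open>t\<close>-degree of the leading
  coefficient, so the process stops.\<close>

lemma exists_primitive_part:
  fixes h :: "'a::field poly poly"
  assumes "h \<noteq> 0"
  shows "\<exists>D d. D \<noteq> 0 \<and> primitive d \<and> h = [:D:] * d"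
  using assms
proof (induction "degree (lead_coeff h)" arbitrary: h rule: less_induct)
  case less
  show ?case
  proof (cases "primitive h")
    case True
    then show ?thesis by (intro exI[of _ 1] exI[of _ h]) auto
  next
    case False
    then obtain c where c: "[:c:] dvd h" "\<not> c dvd 1" by (auto simp: primitive_def)
    then obtain g where g: "h = [:c:] * g" by (auto elim: dvdE)
    then have nz: "c \<noteq> 0" "g \<noteq> 0" using less.prems by auto
    then have "degree c > 0" using c by (simp add: is_unit_iff_degree)
    have "lead_coeff h = c * lead_coeff g" using g by (simp add: lead_coeff_mult)
    then have "degree (lead_coeff g) < degree (lead_coeff h)"
      using nz \<open>degree c > 0\<close> by (simp add: degree_mult_eq)
    then obtain D d where "D \<noteq> 0" "primitive d" "g = [:D:] * d" using less.hyps nz by blast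
    then show ?thesis using g nz
      by (intro exI[of _ "c * D"] exI[of _ d]) (auto simp: mult.commute)
  qed
qed

lemma nontrivial_factor_exists:
  fixes f :: "'a::field poly poly"
  assumes "degree f > 0"
  shows "\<exists>d. nontrivial_factor d f"
proof -
  have "f \<noteq> 0" using assms by auto
  then obtain D d where d: "D \<noteq> 0" "primitive d" "f = [:D:] * d"
    using exists_primitive_part by blast
  then have "degree d = degree f" by (simp add: degree_mult_eq)
  then have "nontrivial_factor d f" using assms d by (auto simp: nontrivial_factor_def smult_dvd_iff dvd_smult)
  then show ?thesis ..
qed

text \<open>Elimination of \<open>x\<close> by pseudo-division; the degree bound is far from that of the resultant,
  but it suffices that it is linear in \<open>n\<close> for bounded degree in \<open>x\<close>.\<close>

lemma elimination_or_common_factor: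
  fixes f g :: "'a::field poly poly"
  assumes "tdeg_le f n" "tdeg_le g n" "f \<noteq> 0 \<or> g \<noteq> 0"
  shows "(\<exists>R A B. R \<noteq> 0 \<and> [:R:] = A * f + B * g \<and> degree R \<le> n * 2 ^ (degree f + degree g)) \<or>
         (\<exists>d. nontrivial_factor d f \<and> nontrivial_factor d g)"
  using assms
proof (induction "degree f + degree g" arbitrary: f g n rule: less_induct)
  case less
  note IH = less.hyps
  have const: ?case if "degree f = 0" "f \<noteq> 0"
  proof -
    have f: "f = [:coeff f 0:]" using that by (auto elim: degree_eq_zeroE)
    then have "coeff f 0 \<noteq> 0" using that by auto
    moreover have "degree (coeff f 0) \<le> n * 2 ^ (degree f + degree g)"
    proof -
      have "degree (coeff f 0) \<le> n" using less.prems by (auto simp: tdeg_le_def)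
      also have "\<dots> \<le> n * 2 ^ (degree f + degree g)" by simp
      finally show ?thesis .
    qed
    ultimately show ?thesis using f
      by (intro disjI1 exI[of _ "coeff f 0"] exI[of _ 1] exI[of _ 0]) auto
  qed
  have const': ?case if "degree g = 0" "g \<noteq> 0"
  proof -
    have g: "g = [:coeff g 0:]" using that by (auto elim: degree_eq_zeroE)
    then have "coeff g 0 \<noteq> 0" using that by auto
    moreover have "degree (coeff g 0) \<le> n * 2 ^ (degree f + degree g)"
    proof -
      have "degree (coeff g 0) \<le> n" using less.prems by (auto simp: tdeg_le_def)
      also have "\<dots> \<le> n * 2 ^ (degree f + degree g)" by simp
      finally show ?thesis .
    qed
    ultimately show ?thesis using g
      by (intro disjI1 exI[of _ "coeff g 0"] exI[of _ 0] exI[of _ 1]) auto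
  qed
  \<comment> \<open>Stated for arbitrary \<open>f\<close> and \<open>g\<close>, with the induction
    hypothesis as a premise, so that it applies to the two polynomials in either order.\<close>
  have step: "(\<exists>R A B. R \<noteq> 0 \<and> [:R:] = A * f + B * g \<and> degree R \<le> n * 2 ^ (degree f + degree g)) \<or>
         (\<exists>d. nontrivial_factor d f \<and> nontrivial_factor d g)"
    if H: "degree f > 0" "degree g > 0" "degree g \<le> degree f" "tdeg_le f n" "tdeg_le g n"
      and IH': "\<And>f' n'. degree f' < degree f \<Longrightarrow> tdeg_le f' n' \<Longrightarrow> tdeg_le g n' \<Longrightarrow>
        (\<exists>R A B. R \<noteq> 0 \<and> [:R:] = A * f' + B * g \<and> degree R \<le> n' * 2 ^ (degree f' + degree g)) \<or>
         (\<exists>d. nontrivial_factor d f' \<and> nontrivial_factor d g)"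
    for f g :: "'a poly poly"
  proof -
    define M where "M = monom (lead_coeff f) (degree f - degree g)"
    \<comment> \<open>One step of pseudo-division: cross-multiplying by the leading coefficients
      cancels the top term without fractions, and \<open>t\<close>-degrees at most double.\<close>
    define f1 where "f1 = [:lead_coeff g:] * f - M * g"
    have nz: "f \<noteq> 0" "g \<noteq> 0" using H by auto
    have "degree ([:lead_coeff g:] * f) = degree f" using nz by simp
    moreover have "degree (M * g) = degree f"
      using nz H by (simp add: M_def degree_mult_eq degree_monom_eq)
    moreover have "coeff f1 (degree f) = 0"
    proof -
      have "coeff (M * g) (degree f) = lead_coeff (M * g)" using \<open>degree (M * g) = degree f\<close> by simp
      also have "\<dots> = lead_coeff f * lead_coeff g"
        by (simp add: lead_coeff_mult M_def degree_monom_eq nz lead_coeff_monom)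
      finally show ?thesis by (simp add: f1_def)
    qed
    ultimately have deg: "degree f1 < degree f"
      using H by (metis degree_diff_le dual_order.refl eq_zero_or_degree_less f1_def degree_0)
    have tdeg: "tdeg_le f1 (2 * n)"
      unfolding tdeg_le_def
    proof
      fix i
      have a: "degree (lead_coeff g * coeff f i) \<le> 2 * n"
      proof -
        have "degree (lead_coeff g) \<le> n" "degree (coeff f i) \<le> n"
          using H by (auto simp: tdeg_le_def)
        then show ?thesis using degree_mult_le[of "lead_coeff g" "coeff f i"] by linarith
      qed
      have b: "degree (coeff (M * g) i) \<le> 2 * n"
      proof (cases "degree f - degree g \<le> i")
        case True
        have "degree (lead_coeff f) \<le> n" "degree (coeff g (i - (degree f - degree g))) \<le> n"
          using H by (auto simp: tdeg_le_def)
        then have "degree (lead_coeff f * coeff g (i - (degree f - degree g))) \<le> 2 * n"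
          using degree_mult_le[of "lead_coeff f" "coeff g (i - (degree f - degree g))"] by linarith
        then show ?thesis using True by (simp add: M_def coeff_monom_mult)
      qed (simp add: M_def coeff_monom_mult)
      show "degree (coeff f1 i) \<le> 2 * n"
        unfolding f1_def using a b by (auto intro: degree_diff_le)
    qed
    have "tdeg_le g (2 * n)"
    proof -
      have "n \<le> 2 * n" by simp
      then show ?thesis using H(5) le_trans unfolding tdeg_le_def by blast
    qed
    from IH'[OF deg tdeg this] show ?thesis
    proof (elim disjE exE conjE)
      fix R A B
      assume R: "R \<noteq> 0" "[:R:] = A * f1 + B * g" "degree R \<le> 2 * n * 2 ^ (degree f1 + degree g)"
      \<comment> \<open>The doubling of \<open>n\<close> is paid for by the drop of
        \<open>degree f\<close> in the exponent; this is the origin of the power of two in the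
        bound.\<close>
      have "2 * n * 2 ^ (degree f1 + degree g) = n * 2 ^ (Suc (degree f1) + degree g)" by simp
      also have "\<dots> \<le> n * 2 ^ (degree f + degree g)"
        using deg by (intro mult_left_mono power_increasing) auto
      finally have "degree R \<le> n * 2 ^ (degree f + degree g)" using R by linarith
      moreover have "[:R:] = (A * [:lead_coeff g:]) * f + (B - A * M) * g"
        unfolding R(2) f1_def by (simp add: algebra_simps)
      ultimately show ?thesis using R(1) by blast
    next
      fix d assume d: "nontrivial_factor d f1" "nontrivial_factor d g"
      then have "d dvd f1 + M * g" by (auto simp: nontrivial_factor_def)
      then have "d dvd [:lead_coeff g:] * f" by (simp add: f1_def)
      then have "d dvd f"
        using d nz by (intro primitive_dvd_cancel_const[of d "lead_coeff g" f]) (auto simp: nontrivial_factor_def)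
      then show ?thesis using d by (auto simp: nontrivial_factor_def)
    qed
  qed
  show ?case
  proof (cases "degree f = 0 \<or> degree g = 0")
    case True
    consider "degree f = 0" "f \<noteq> 0" | "degree g = 0" "g \<noteq> 0" | "f = 0" "degree g > 0" | "g = 0" "degree f > 0"
      using True less.prems by fastforce
    then show ?thesis
    proof cases
      case 3
      then show ?thesis using nontrivial_factor_exists[of g] by (auto simp: nontrivial_factor_def)
    next
      case 4
      then show ?thesis using nontrivial_factor_exists[of f] by (auto simp: nontrivial_factor_def)
    qed (use const const' in auto)
  next
    case False
    show ?thesis
    proof (cases "degree g \<le> degree f")
      case True
      show ?thesis
      proof (rule step)
        fix f' :: "'a poly poly" and n'
        assume *: "degree f' < degree f" "tdeg_le f' n'" "tdeg_le g n'"
        have "g \<noteq> 0" using False by auto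
        then show "(\<exists>R A B. R \<noteq> 0 \<and> [:R:] = A * f' + B * g \<and> degree R \<le> n' * 2 ^ (degree f' + degree g)) \<or>
         (\<exists>d. nontrivial_factor d f' \<and> nontrivial_factor d g)"
          using IH[of f' g n'] * by auto
      qed (use False True less.prems in auto)
    next
      case F: False
      have "(\<exists>R A B. R \<noteq> 0 \<and> [:R:] = A * g + B * f \<and> degree R \<le> n * 2 ^ (degree g + degree f)) \<or>
         (\<exists>d. nontrivial_factor d g \<and> nontrivial_factor d f)"
      proof (rule step)
        fix f' :: "'a poly poly" and n'
        assume *: "degree f' < degree g" "tdeg_le f' n'" "tdeg_le f n'"
        have "f \<noteq> 0" using False by auto
        then show "(\<exists>R A B. R \<noteq> 0 \<and> [:R:] = A * f' + B * f \<and> degree R \<le> n' * 2 ^ (degree f' + degree f)) \<or>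
         (\<exists>d. nontrivial_factor d f' \<and> nontrivial_factor d f)"
          using IH[of f' f n'] * by auto
      qed (use False F less.prems in auto)
      then show ?thesis by (metis add.commute)
    qed
  qed
qed

text \<open>If \<open>h\<close> does not divide \<open>a\<close>, elimination yields a
  nonzero constant in the ideal generated by \<open>h\<close> and \<open>a\<close>, which can be cancelled by primitivity.\<close>

lemma primitive_irreducible_imp_prime_elem:
  fixes h :: "'a::field poly poly"
  assumes "irreducible h" "degree h > 0" "primitive h"
  shows "prime_elem h"
proof (rule prime_elemI)
  show "h \<noteq> 0" "\<not> h dvd 1" using assms by (auto simp: irreducible_def)
next
  fix a b assume ab: "h dvd a * b"
  have "h dvd b" if na: "\<not> h dvd a"
  proof -
    define n where "n = max (deg_t h) (deg_t a)"
    have "tdeg_le h n" "tdeg_le a n" by (auto simp: n_def intro!: tdeg_le_deg_t)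
    moreover have "h \<noteq> 0 \<or> a \<noteq> 0" using assms by auto
    moreover have "\<not> (\<exists>d. nontrivial_factor d h \<and> nontrivial_factor d a)"
    proof
      assume "\<exists>d. nontrivial_factor d h \<and> nontrivial_factor d a"
      then obtain d e where d: "h = d * e" "d dvd a" "degree d > 0"
        by (auto simp: nontrivial_factor_def elim: dvdE)
      then have "\<not> d dvd 1" by (auto simp: is_unit_poly_iff)
      then have "e dvd 1" using assms(1) d by (auto dest: irreducibleD)
      then have "h dvd d" using d by (simp add: mult_unit_dvd_iff)
      then show False using na d dvd_trans by blast
    qed
    ultimately obtain R A B where R: "R \<noteq> 0" "[:R:] = A * h + B * a"
      using elimination_or_common_factor by blast
    have "[:R:] * b = h * (A * b) + B * (a * b)" unfolding R by (simp add: algebra_simps)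
    then have "h dvd [:R:] * b" using ab by simp
    then show ?thesis using primitive_dvd_cancel_const assms R by blast
  qed
  then show "h dvd a \<or> h dvd b" by blast
qed

text \<open>Factors of a primitive polynomial are primitive, and a primitive non-unit has positive
  degree in \<open>x\<close>. Hence every proper splitting lowers the degree in \<open>x\<close>,
  and descent ends at an irreducible.\<close>

lemma nontrivial_factor_prime:
  fixes f :: "'a::field poly poly"
  assumes "nontrivial_factor d f"
  shows "\<exists>h. prime_elem h \<and> nontrivial_factor h f \<and> h dvd d"
  using assms
proof (induction "degree d" arbitrary: d rule: less_induct)
  case less
  show ?case
  proof (cases "irreducible d")
    case True
    then have "prime_elem d"
      using less.prems primitive_irreducible_imp_prime_elem by (auto simp: nontrivial_factor_def)
    then show ?thesis using less.prems by (intro exI[of _ d]) simp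
  next
    case False
    have nz: "d \<noteq> 0" using less.prems by (auto simp: nontrivial_factor_def)
    moreover have "\<not> d dvd 1" using less.prems by (auto simp: nontrivial_factor_def is_unit_poly_iff)
    ultimately obtain a b where ab: "d = a * b" "\<not> a dvd 1" "\<not> b dvd 1"
      using False by (auto simp: irreducible_def)
    have prim: "primitive a" "primitive b" using ab less.prems primitive_dvd[of d a] primitive_dvd[of d b]
      by (auto simp: nontrivial_factor_def)
    have pos: "degree e > 0" if "primitive e" "\<not> e dvd 1" for e :: "'a poly poly"
    proof (rule ccontr)
      assume "\<not> degree e > 0"
      then obtain c where "e = [:c:]" by (auto elim: degree_eq_zeroE)
      then show False using that by (auto simp: primitive_def is_unit_poly_iff)
    qed
    have "degree a > 0" "degree b > 0" using pos prim ab by auto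
    then have "degree a < degree d" using ab nz by (simp add: degree_mult_eq)
    moreover have "nontrivial_factor a f"
      using prim \<open>degree a > 0\<close> ab less.prems by (auto simp: nontrivial_factor_def dest: dvd_mult_left)
    ultimately obtain h where "prime_elem h" "nontrivial_factor h f" "h dvd a"
      using less.hyps by blast
    then show ?thesis using ab by auto
  qed
qed

lemma prime_elem_dvd_prod:
  fixes h :: "'c \<Rightarrow> 'b::comm_semiring_1"
  assumes "finite T" "prime_elem Q" "Q dvd (\<Prod>P\<in>T. h P)"
  shows "\<exists>P\<in>T. Q dvd h P"
  using assms(1,3)
proof (induction T rule: finite_induct)
  case empty
  then show ?case using assms(2) by (auto simp: prime_elem_def)
next
  case (insert x F)
  then show ?case using assms(2) by (auto dest: prime_elem_dvd_multD)
qed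

lemma prod_prime_elem_dvd:
  fixes f :: "'b::comm_ring_1"
  assumes "finite U" "\<And>u. u \<in> U \<Longrightarrow> prime_elem (h u) \<and> h u dvd f"
    and "\<And>u v. u \<in> U \<Longrightarrow> v \<in> U \<Longrightarrow> h u dvd h v \<Longrightarrow> u = v"
  shows "(\<Prod>u\<in>U. h u) dvd f"
  using assms
proof (induction U rule: finite_induct)
  case (insert w U)
  then have "(\<Prod>u\<in>U. h u) dvd f" by auto
  then obtain v where v: "f = (\<Prod>u\<in>U. h u) * v" by (auto elim: dvdE)
  have w: "prime_elem (h w)" using insert.prems by auto
  have not_dvd: "\<not> h w dvd (\<Prod>u\<in>U. h u)"
  proof
    assume "h w dvd (\<Prod>u\<in>U. h u)"
    then obtain u where "u \<in> U" "h w dvd h u"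
      using prime_elem_dvd_prod[OF insert.hyps(1) w] by blast
    then have "w = u" using insert.prems(2)[of w u] by auto
    then show False using insert.hyps \<open>u \<in> U\<close> by auto
  qed
  have "h w dvd (\<Prod>u\<in>U. h u) * v" using insert.prems v by auto
  then have "h w dvd v" using w not_dvd by (auto dest: prime_elem_dvd_multD)
  then have "(\<Prod>u\<in>U. h u) * h w dvd f" unfolding v by (rule mult_dvd_mono[OF dvd_refl])
  then show ?case using insert.hyps by (simp add: mult.commute)
qed simp

section \<open>Derivatives and the eliminant\<close>

abbreviation dt :: "'a::field poly poly \<Rightarrow> 'a poly poly" where
  "dt \<equiv> map_poly pderiv"

lemma degree_dt_le: "degree (dt f) \<le> degree f"
  by (rule degree_le) (simp add: coeff_map_poly coeff_eq_0)

lemma coeff_dt: "coeff (dt f) i = pderiv (coeff f i)"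
  by (simp add: coeff_map_poly)

text \<open>The chain rule for \<open>f(t, a(t))\<close>: the derivative of \<open>a\<close> enters
  only as a linear coefficient, which can be held fixed independently of \<open>a\<close>.\<close>

lemma pderiv_poly:
  fixes f :: "'a::field poly poly"
  shows "pderiv (poly f a) = poly (dt f) a + pderiv a * poly (pderiv f) a"
proof (induction f)
  case (pCons c f)
  have "dt (pCons c f) = pCons (pderiv c) (dt f)" by (intro poly_eqI) (simp add: coeff_map_poly coeff_pCons split: nat.splits)
  then show ?case using pCons.IH by (simp add: pderiv_add pderiv_mult pderiv_pCons algebra_simps)
qed simp

lemma dt_mult:
  fixes f g :: "'a::field poly poly"
  shows "dt (f * g) = dt f * g + f * dt g"
proof (induction f)
  case (pCons c f)
  have a: "dt (pCons c f) = pCons (pderiv c) (dt f)" for c f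
    by (intro poly_eqI) (simp add: coeff_map_poly coeff_pCons split: nat.splits)
  have b: "dt (f + g) = dt f + dt g" for f g :: "'a poly poly"
    by (intro poly_eqI) (simp add: coeff_map_poly pderiv_add)
  have c: "dt (smult c g) = smult (pderiv c) g + smult c (dt g)" for c
    by (intro poly_eqI) (simp add: coeff_map_poly pderiv_mult mult.commute)
  show ?case using pCons.IH by (simp add: a b c algebra_simps)
qed simp

lemma degree_pderiv_le:
  fixes p :: "'b::{comm_semiring_1,semiring_no_zero_divisors} poly"
  shows "degree (pderiv p) \<le> degree p - 1"
  by (rule degree_le) (auto simp: coeff_pderiv coeff_eq_0)

text \<open>Since \<open>dt\<close> does not raise the degree in \<open>x\<close>, the quotient
  would be a constant \<open>r\<close> in \<open>x\<close>. Comparing leading coefficients gives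
  \<open>pderiv l = r * l\<close>, impossible for nonzero \<open>r\<close> and \<open>l\<close>
  because differentiation lowers the \<open>t\<close>-degree or gives zero.\<close>

lemma dvd_dt_imp_dt_eq_0:
  fixes h :: "'a::field poly poly"
  assumes "h dvd dt h"
  shows "dt h = 0"
proof (rule ccontr)
  assume nz: "dt h \<noteq> 0"
  then have "h \<noteq> 0" by auto
  obtain s where s: "dt h = h * s" using assms by (auto elim: dvdE)
  then have "s \<noteq> 0" using nz by auto
  have "degree (dt h) \<le> degree h" by (rule degree_dt_le)
  then have "degree s = 0" using s \<open>h \<noteq> 0\<close> \<open>s \<noteq> 0\<close> by (simp add: degree_mult_eq)
  then obtain r where r: "s = [:r:]" by (auto elim: degree_eq_zeroE)
  then have "r \<noteq> 0" using \<open>s \<noteq> 0\<close> by auto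
  define l where "l = lead_coeff h"
  have "l \<noteq> 0" using \<open>h \<noteq> 0\<close> by (simp add: l_def)
  have "pderiv l = r * l" using arg_cong[OF s, of "\<lambda>p. coeff p (degree h)"] r
    by (simp add: coeff_dt l_def)
  then have "degree (pderiv l) \<ge> degree l" "pderiv l \<noteq> 0"
    using \<open>r \<noteq> 0\<close> \<open>l \<noteq> 0\<close> by (auto simp: degree_mult_eq)
  moreover have "degree (pderiv l) \<le> degree l - 1" by (rule degree_pderiv_le)
  ultimately have "degree l = 0" by simp
  then have "pderiv l = 0" by (auto elim: degree_eq_zeroE)
  then show False using \<open>pderiv l \<noteq> 0\<close> by simp
qed

lemma dvd_pderiv_imp_pderiv_eq_0:
  fixes h :: "'b::idom poly"
  assumes "h dvd pderiv h"
  shows "pderiv h = 0"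
proof (rule ccontr)
  assume nz: "pderiv h \<noteq> 0"
  then have "degree h \<le> degree (pderiv h)" using assms dvd_imp_degree_le by blast
  moreover have "degree (pderiv h) \<le> degree h - 1" by (rule degree_pderiv_le)
  ultimately have "degree h = 0" by simp
  then have "pderiv h = 0" by (auto elim: degree_eq_zeroE)
  then show False using nz by simp
qed

text \<open>Only exponents divisible by \<open>p\<close> survive, and Frobenius is additive, so
  roots of the coefficients assemble to a root of \<open>h\<close>. Coefficients in a domain are
  allowed because the lemma is used over \<open>'a\<close> and then again over
  \<open>'a poly\<close>.\<close>

lemma pderiv_eq_0_imp_power_CHAR:
  fixes h :: "'b::idom poly"
  assumes p: "CHAR('b) > 0" and h: "pderiv h = 0" and root: "\<And>i. \<exists>d. coeff h i = d ^ CHAR('b)"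
  shows "\<exists>w. h = w ^ CHAR('b)"
proof -
  define p where "p = CHAR('b)"
  have prime: "prime p" unfolding p_def using p by (rule prime_CHAR_semidom)
  then have "p > 0" by (simp add: prime_gt_0_nat)
  obtain d where d: "\<And>i. coeff h i = d i ^ p" using root unfolding p_def by metis
  \<comment> \<open>The index runs further than \<open>degree h div p\<close>; the excess terms
    vanish because their coefficients are roots of zero.\<close>
  define w where "w = (\<Sum>j\<le>degree h. monom (d (p * j)) j)"
  have "w ^ p = (\<Sum>j\<le>degree h. monom (d (p * j)) j ^ p)"
    unfolding w_def using prime by (intro freshmans_dream_sum) (auto simp: p_def)
  also have "\<dots> = (\<Sum>j\<le>degree h. monom (coeff h (p * j)) (p * j))"
    by (simp add: monom_power d mult.commute)
  also have "\<dots> = h"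
  proof (rule poly_eqI)
    fix n
    have *: "coeff (\<Sum>j\<le>degree h. monom (coeff h (p * j)) (p * j)) n =
        (\<Sum>j\<le>degree h. if p * j = n then coeff h n else 0)"
      by (simp add: coeff_sum) (intro sum.cong, auto)
    show "coeff (\<Sum>j\<le>degree h. monom (coeff h (p * j)) (p * j)) n = coeff h n"
    proof (cases "p dvd n")
      case True
      then obtain j where j: "n = p * j" by (auto elim: dvdE)
      have "(\<Sum>i\<le>degree h. if p * i = n then coeff h n else 0) =
          (\<Sum>i\<le>degree h. if i = j then coeff h n else 0)"
        using j \<open>p > 0\<close> by (intro sum.cong) auto
      also have "\<dots> = (if j \<le> degree h then coeff h n else 0)" by simp
      also have "\<dots> = coeff h n"
      proof (cases "j \<le> degree h")
        case False
        have "j \<le> n" using j \<open>p > 0\<close> by simp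
        then have "coeff h n = 0" using False by (intro coeff_eq_0) simp
        then show ?thesis by simp
      qed simp
      finally show ?thesis using * by simp
    next
      case False
      then have "n \<noteq> 0" by (metis dvd_0_right)
      then obtain k where k: "n = Suc k" by (cases n) auto
      have "of_nat n * coeff h n = 0" using h coeff_pderiv[of h k] k by simp
      moreover have "of_nat n \<noteq> (0 :: 'b)" using False by (simp add: of_nat_eq_0_iff_char_dvd p_def)
      ultimately have "coeff h n = 0" by simp
      then show ?thesis using * by (simp cong: if_cong)
    qed
  qed
  finally show ?thesis unfolding p_def by metis
qed

lemma CHAR_finite_field_prime: "prime CHAR('a::{field,finite})"
  by (intro prime_CHAR_semidom finite_imp_CHAR_pos) simp

lemma finite_field_root:
  fixes c :: "'a::{field,finite}"
  shows "\<exists>d. c = d ^ CHAR('a)"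
proof -
  define p where "p = CHAR('a)"
  have pr: "prime CHAR('a)" by (rule CHAR_finite_field_prime)
  have "inj (\<lambda>x::'a. x ^ p)"
  proof (rule injI)
    fix x y :: 'a assume "x ^ p = y ^ p"
    moreover have "((x - y) + y) ^ p = (x - y) ^ p + y ^ p"
      using pr by (intro freshmans_dream) (auto simp: p_def)
    ultimately have "(x - y) ^ p = 0" by simp
    then show "x = y" by simp
  qed
  then have "surj (\<lambda>x::'a. x ^ p)" by (simp add: finite_UNIV_inj_surj)
  then show ?thesis unfolding p_def by (metis surjD)
qed

lemma pderiv_eq_0_imp_power:
  fixes a :: "'a::{field,finite} poly"
  assumes "pderiv a = 0"
  shows "\<exists>b. a = b ^ CHAR('a)"
  using CHAR_finite_field_prime[where 'a='a] assms finite_field_root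
  by (intro pderiv_eq_0_imp_power_CHAR) (auto simp: prime_gt_0_nat)

lemma pderivs_eq_0_imp_power:
  fixes h :: "'a::{field,finite} poly poly"
  assumes "pderiv h = 0" "dt h = 0"
  shows "\<exists>w. h = w ^ CHAR('a)"
proof -
  have "pderiv (coeff h i) = 0" for i using assms(2) coeff_dt[of h i] by simp
  then have "\<exists>d. coeff h i = d ^ CHAR('a poly)" for i
    using pderiv_eq_0_imp_power[of "coeff h i"] by simp
  moreover have "CHAR('a poly) > 0"
    using CHAR_finite_field_prime[where 'a='a] by (simp add: prime_gt_0_nat)
  ultimately have "\<exists>w. h = w ^ CHAR('a poly)" using assms(1) by (intro pderiv_eq_0_imp_power_CHAR)
  then show ?thesis by simp
qed

lemma irreducible_not_power:
  fixes w :: "'b::comm_ring_1"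
  assumes "irreducible (w ^ n)" "n \<ge> 2"
  shows False
proof -
  have eq: "w ^ n = w * w ^ (n - 1)" using assms(2) by (cases n) auto
  have "w dvd w ^ (n - 1)" using assms(2) by (intro dvd_power) auto
  moreover have "w dvd 1 \<or> w ^ (n - 1) dvd 1" using irreducibleD[OF assms(1) eq] .
  ultimately have "w dvd 1" using dvd_trans by blast
  then have "w ^ n dvd 1" by (metis dvd_power_same power_one)
  then show False using assms(1) by (simp add: irreducible_def)
qed

lemma irreducible_pderiv_neq_0:
  fixes P :: "'a::{field,finite} poly"
  assumes "irreducible P"
  shows "pderiv P \<noteq> 0"
  using assms irreducible_not_power pderiv_eq_0_imp_power
    CHAR_finite_field_prime[where 'a='a] prime_ge_2_nat by metis

text \<open>With \<open>b = P * c\<close>, the product rule gives \<open>P dvd c * pderiv P\<close>,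
  and \<open>P\<close> is separable because finite fields are perfect. Inside a fibre of the
  derivative this upgrades congruence modulo \<open>P\<close> to congruence modulo its
  square.\<close>

lemma square_dvd_if_pderiv_eq_0:
  fixes P b :: "'a::{field,finite} poly"
  assumes "irreducible P" "pderiv b = 0" "P dvd b"
  shows "P\<^sup>2 dvd b"
proof -
  obtain c where c: "b = P * c" using assms by (auto elim: dvdE)
  then have "P * pderiv c + c * pderiv P = 0" using assms by (simp add: pderiv_mult)
  then have "c * pderiv P = P * (- pderiv c)" by (simp add: add_eq_0_iff2)
  then have "P dvd c * pderiv P" by simp
  moreover have "\<not> P dvd pderiv P"
    using irreducible_pderiv_neq_0[OF assms(1)] dvd_pderiv_imp_pderiv_eq_0 by blast
  ultimately have "P dvd c"
    using field_poly_irreducible_imp_prime[OF assms(1)] by (auto dest: prime_elem_dvd_multD)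
  then show ?thesis unfolding c by (simp add: power2_eq_square mult_dvd_mono)
qed

text \<open>A common prime factor \<open>h\<close> of \<open>f\<close> and of \<open>f\<^sub>t + u f\<^sub>x\<close> for two values of \<open>u\<close>
  divides \<open>f\<^sub>x\<close> and \<open>f\<^sub>t\<close>; as \<open>f\<close> is square-free, both derivatives of \<open>h\<close> vanish and \<open>h\<close> is a
  \<open>p\<close>-th power. So every bad \<open>u\<close> uses up a prime factor of \<open>f\<close> of its own.\<close>

lemma card_bad_derivatives:
  fixes f :: "'a::{field,finite} poly poly"
  assumes sf: "squarefree f"
  defines "U \<equiv> {u. \<exists>d. nontrivial_factor d f \<and> nontrivial_factor d (dt f + [:u:] * pderiv f)}"
  shows "finite U \<and> card U \<le> degree f"
proof -
  have nz: "f \<noteq> 0" using sf not_squarefree_0 by blast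
  have "\<exists>h. prime_elem h \<and> nontrivial_factor h f \<and> h dvd dt f + [:u:] * pderiv f" if "u \<in> U" for u
  proof -
    obtain d where d: "nontrivial_factor d f" "d dvd dt f + [:u:] * pderiv f"
      using \<open>u \<in> U\<close> unfolding U_def nontrivial_factor_def by blast
    then show ?thesis using nontrivial_factor_prime[of d f] dvd_trans by blast
  qed
  then obtain h where h: "\<And>u. u \<in> U \<Longrightarrow> prime_elem (h u)" "\<And>u. u \<in> U \<Longrightarrow> nontrivial_factor (h u) f"
      "\<And>u. u \<in> U \<Longrightarrow> h u dvd dt f + [:u:] * pderiv f" by metis
  have inj: "u = v" if uv: "u \<in> U" "v \<in> U" "h u dvd h v" for u v
  proof (rule ccontr)
    assume "u \<noteq> v"
    define g where "g = h u"
    have g: "prime_elem g" "primitive g" "degree g > 0" "g dvd f"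
      using h uv by (auto simp: g_def nontrivial_factor_def)
    have gu: "g dvd dt f + [:u:] * pderiv f" "g dvd dt f + [:v:] * pderiv f"
      using h uv dvd_trans unfolding g_def by blast+
    then have "g dvd (dt f + [:u:] * pderiv f) - (dt f + [:v:] * pderiv f)" by (rule dvd_diff)
    also have "\<dots> = [:u - v:] * pderiv f" by (simp add: smult_diff_left)
    finally have gx: "g dvd pderiv f"
      by (rule primitive_dvd_cancel_const[OF g(2), rotated]) (use \<open>u \<noteq> v\<close> in auto)
    then have "g dvd (dt f + [:u:] * pderiv f) - [:u:] * pderiv f"
      using gu by (intro dvd_diff) (auto intro: dvd_smult)
    then have gt: "g dvd dt f" by simp
    \<comment> \<open>The prime \<open>g\<close> occurs exactly once in \<open>f\<close>. In the
      product rule for \<open>g * s\<close> one term is a multiple of \<open>g\<close>, so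
      \<open>g\<close> must divide its own derivative, once in \<open>x\<close> and once in
      \<open>t\<close>.\<close>
    obtain s where s: "f = g * s" using g by (auto elim: dvdE)
    have ns: "\<not> g dvd s"
    proof
      assume "g dvd s"
      then have "g\<^sup>2 dvd f" unfolding s power2_eq_square by (intro mult_dvd_mono) auto
      then have "g dvd 1" using sf by (auto simp: squarefree_def)
      then show False using g by (auto simp: is_unit_poly_iff)
    qed
    have "g dvd g * pderiv s + s * pderiv g" using gx by (simp add: s pderiv_mult)
    then have "g dvd s * pderiv g" by (simp add: dvd_add_right_iff)
    then have "g dvd pderiv g" using g ns by (auto dest: prime_elem_dvd_multD)
    then have "pderiv g = 0" by (rule dvd_pderiv_imp_pderiv_eq_0)
    have "g dvd dt g * s + g * dt s" using gt by (simp add: s dt_mult)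
    then have "g dvd dt g * s" by (simp add: dvd_add_left_iff)
    then have "g dvd dt g" using g ns by (auto dest: prime_elem_dvd_multD)
    then have "dt g = 0" by (rule dvd_dt_imp_dt_eq_0)
    then obtain w where "g = w ^ CHAR('a)" using \<open>pderiv g = 0\<close> pderivs_eq_0_imp_power by blast
    moreover have "irreducible g" using g prime_elem_imp_irreducible by blast
    ultimately show False
      using irreducible_not_power CHAR_finite_field_prime[where 'a='a] prime_ge_2_nat by metis
  qed
  \<comment> \<open>\<open>U\<close> is not yet known to be finite, so finite subsets are bounded
    first: their primes are pairwise non-associated, and each uses at least one unit of
    \<open>degree f\<close>.\<close>
  have "card W \<le> degree f" if W: "W \<subseteq> U" "finite W" for W
  proof -
    have hW: "prime_elem (h u)" "h u dvd f" "degree (h u) \<ge> 1" if "u \<in> W" for u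
      using that W h by (auto simp: nontrivial_factor_def Suc_le_eq subset_iff)
    have "(\<Prod>u\<in>W. h u) dvd f"
    proof (rule prod_prime_elem_dvd)
      show "u = v" if "u \<in> W" "v \<in> W" "h u dvd h v" for u v
        using that W by (intro inj) blast+
    qed (use W hW in auto)
    then have "degree (\<Prod>u\<in>W. h u) \<le> degree f" using nz by (rule dvd_imp_degree_le)
    moreover have "degree (\<Prod>u\<in>W. h u) = (\<Sum>u\<in>W. degree (h u))"
      using hW by (intro degree_prod_eq_sum_degree) (auto simp: prime_elem_def)
    moreover have "(\<Sum>u\<in>W. degree (h u)) \<ge> (\<Sum>u\<in>W. 1)" using hW by (intro sum_mono) auto
    ultimately show ?thesis by simp
  qed
  then show ?thesis using finite_if_finite_subsets_card_bdd[of U "degree f"] by auto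
qed

text \<open>\<open>R\<close> lies in the ideal generated by \<open>f\<close> and
  \<open>dt f + [:u:] * pderiv f\<close>, so the divisibility survives any substitution for
  \<open>x\<close>. The factor \<open>4 ^ k\<close> is the power of two from elimination when both
  polynomials have degree at most \<open>k\<close> in \<open>x\<close>.\<close>

lemma exists_eliminant:
  fixes f :: "'a::{field,finite} poly poly"
  assumes "squarefree f" "degree f \<le> k" "tdeg_le f n"
  obtains U where "finite U" "card U \<le> k"
    "\<And>u. u \<notin> U \<Longrightarrow> \<exists>R. R \<noteq> 0 \<and> degree R \<le> (n + degree u) * 4 ^ k \<and>
      (\<forall>P a. P dvd poly f a \<longrightarrow> P dvd poly (dt f) a + u * poly (pderiv f) a \<longrightarrow> P dvd R)"
proof
  define U where "U = {u. \<exists>d. nontrivial_factor d f \<and> nontrivial_factor d (dt f + [:u:] * pderiv f)}"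
  show "finite U" "card U \<le> k"
    using card_bad_derivatives[OF assms(1)] assms(2) by (auto simp: U_def)
  fix u assume u: "u \<notin> U"
  define g where "g = dt f + [:u:] * pderiv f"
  have nz: "f \<noteq> 0" using assms not_squarefree_0 by blast
  have 1: "tdeg_le f (n + degree u)"
    using assms(3) by (auto simp: tdeg_le_def intro: trans_le_add1)
  have 2: "tdeg_le g (n + degree u)"
    unfolding tdeg_le_def
  proof
    fix i
    have a: "degree (pderiv (coeff f i)) \<le> n + degree u"
      using assms(3) degree_pderiv_le[of "coeff f i"] unfolding tdeg_le_def
      by (meson diff_le_self le_trans trans_le_add1)
    have "degree (u * coeff (pderiv f) i) \<le> degree u + degree (coeff (pderiv f) i)"
      by (rule degree_mult_le)
    moreover have "degree (coeff (pderiv f) i) \<le> n"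
    proof -
      have "degree (coeff (pderiv f) i) \<le> degree (of_nat (Suc i) :: 'a poly) + degree (coeff f (Suc i))"
        unfolding coeff_pderiv by (rule degree_mult_le)
      also have "\<dots> = degree (coeff f (Suc i))" by (simp only: degree_of_nat)
      also have "\<dots> \<le> n" using assms(3) by (auto simp: tdeg_le_def)
      finally show ?thesis .
    qed
    ultimately have b: "degree (u * coeff (pderiv f) i) \<le> n + degree u" by linarith
    have "coeff g i = pderiv (coeff f i) + u * coeff (pderiv f) i" by (simp add: g_def coeff_dt)
    then show "degree (coeff g i) \<le> n + degree u" using a b by (simp add: degree_add_le)
  qed
  have "degree g \<le> degree f"
    unfolding g_def
  proof (rule degree_add_le)
    show "degree (dt f) \<le> degree f" by (rule degree_dt_le)
    show "degree ([:u:] * pderiv f) \<le> degree f"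
      using degree_pderiv_le[of f] degree_smult_le[of u "pderiv f"] by simp
  qed
  obtain R A B where R: "R \<noteq> 0" "[:R:] = A * f + B * g"
      "degree R \<le> (n + degree u) * 2 ^ (degree f + degree g)"
    using elimination_or_common_factor[OF 1 2] nz u by (auto simp: U_def g_def)
  have "degree R \<le> (n + degree u) * 2 ^ (2 * k)"
    using R(3)
  proof (rule le_trans)
    show "(n + degree u) * 2 ^ (degree f + degree g) \<le> (n + degree u) * 2 ^ (2 * k)"
      using \<open>degree g \<le> degree f\<close> assms(2) by (intro mult_left_mono power_increasing) auto
  qed
  also have "(2::nat) ^ (2 * k) = 4 ^ k" by (simp add: power_mult)
  finally have deg: "degree R \<le> (n + degree u) * 4 ^ k" .
  have "P dvd R" if "P dvd poly f a" "P dvd poly (dt f) a + u * poly (pderiv f) a" for P a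
  proof -
    have "R = poly [:R:] a" by simp
    also have "\<dots> = poly A a * poly f a + poly B a * (poly (dt f) a + u * poly (pderiv f) a)"
      unfolding R by (simp add: g_def)
    finally show ?thesis using that by auto
  qed
  then show "\<exists>R. R \<noteq> 0 \<and> degree R \<le> (n + degree u) * 4 ^ k \<and>
      (\<forall>P a. P dvd poly f a \<longrightarrow> P dvd poly (dt f) a + u * poly (pderiv f) a \<longrightarrow> P dvd R)"
    using R(1) deg by blast
qed

section \<open>Zeros modulo squares of irreducibles\<close>

text \<open>The coefficient form follows the convention that \<open>0\<close> has degree below every
  \<open>m\<close>: \<open>polys_lt 0\<close> is \<open>{0}\<close>, whereas
  \<open>degree a < 0\<close> never holds.\<close>

definition polys_lt :: "nat \<Rightarrow> 'a::zero poly set" where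
  "polys_lt m = {a. \<forall>i\<ge>m. coeff a i = 0}"

lemma polys_lt_iff: "a \<in> polys_lt m \<longleftrightarrow> a = 0 \<or> degree a < m"
proof
  assume a: "a \<in> polys_lt m"
  show "a = 0 \<or> degree a < m"
  proof (rule ccontr)
    assume "\<not> (a = 0 \<or> degree a < m)"
    then have "a \<noteq> 0" "lead_coeff a = 0" using a by (auto simp: polys_lt_def)
    then show False by simp
  qed
next
  assume "a = 0 \<or> degree a < m"
  then show "a \<in> polys_lt m" by (auto simp: polys_lt_def intro: coeff_eq_0)
qed

lemma polys_lt_eq: "m > 0 \<Longrightarrow> polys_lt m = {a. degree a < m}"
  by (auto simp: polys_lt_iff)

lemma card_polys_lt: "finite (polys_lt m :: 'a::{zero,finite} poly set)"
    "card (polys_lt m :: 'a::{zero,finite} poly set) = CARD('a) ^ m"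
proof (induction m)
  case 0
  have "polys_lt 0 = {0 :: 'a poly}" by (auto simp: polys_lt_def intro: poly_eqI)
  then show "finite (polys_lt 0 :: 'a poly set)" "card (polys_lt 0 :: 'a poly set) = CARD('a) ^ 0" by simp_all
next
  case (Suc m)
  have eq: "polys_lt (Suc m) = (\<lambda>(c, a). pCons c a) ` ((UNIV :: 'a set) \<times> polys_lt m)"
  proof (intro set_eqI iffI)
    fix a :: "'a poly" assume a: "a \<in> polys_lt (Suc m)"
    obtain c b where "a = pCons c b" by (cases a)
    moreover have "b \<in> polys_lt m"
      unfolding polys_lt_def
    proof clarify
      fix i assume "m \<le> i"
      then have "coeff a (Suc i) = 0" using a by (auto simp: polys_lt_def)
      then show "coeff b i = 0" using \<open>a = pCons c b\<close> by simp
    qed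
    ultimately show "a \<in> (\<lambda>(c, a). pCons c a) ` (UNIV \<times> polys_lt m)" by auto
  next
    fix a :: "'a poly" assume "a \<in> (\<lambda>(c, a). pCons c a) ` (UNIV \<times> polys_lt m)"
    then show "a \<in> polys_lt (Suc m)"
      by (auto simp: polys_lt_def coeff_pCons split: nat.splits)
  qed
  have inj: "inj_on (\<lambda>(c, a). pCons c a) ((UNIV :: 'a set) \<times> polys_lt m)"
    by (auto simp: inj_on_def)
  show "finite (polys_lt (Suc m) :: 'a poly set)" unfolding eq using Suc by auto
  show "card (polys_lt (Suc m) :: 'a poly set) = CARD('a) ^ Suc m"
    unfolding eq using Suc by (simp add: card_image[OF inj] card_cartesian_product)
qed

lemma polys_lt_add: "a \<in> polys_lt m \<Longrightarrow> b \<in> polys_lt m \<Longrightarrow> a + b \<in> polys_lt m"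
  for a b :: "'a::ab_group_add poly"
  by (auto simp: polys_lt_def)

lemma polys_lt_diff: "a \<in> polys_lt m \<Longrightarrow> b \<in> polys_lt m \<Longrightarrow> a - b \<in> polys_lt m"
  for a b :: "'a::ab_group_add poly"
  by (auto simp: polys_lt_def)

lemma polys_lt_mono: "m \<le> n \<Longrightarrow> polys_lt m \<subseteq> polys_lt n"
  by (auto simp: polys_lt_def)

lemma mod_in_polys_lt: "M \<noteq> 0 \<Longrightarrow> a mod M \<in> polys_lt (degree M)"
  for M :: "'a::field poly"
  using degree_mod_less[of M a] by (auto simp: polys_lt_iff)

lemma polys_lt_mod: "r \<in> polys_lt (degree M) \<Longrightarrow> r mod M = r"
  for M :: "'a::field poly"
  by (auto simp: polys_lt_iff mod_poly_less)

lemma dvd_polys_lt_imp_0: "M dvd a \<Longrightarrow> a \<in> polys_lt (degree M) \<Longrightarrow> a = 0"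
  for M :: "'a::field poly"
  using dvd_imp_degree_le[of M a] by (force simp: polys_lt_iff)

text \<open>Division with remainder pairs an arbitrary remainder with an arbitrary quotient of
  degree below \<open>m - degree M\<close>. Residue classes are therefore hit equally often, with no
  boundary term; all exactness in the sieve comes from here.\<close>

lemma card_mod_in:
  fixes M :: "'a::{field,finite} poly"
  assumes M: "M \<noteq> 0" "degree M \<le> m" and R: "R \<subseteq> polys_lt (degree M)"
  shows "card {a \<in> polys_lt m. a mod M \<in> R} = card R * CARD('a) ^ (m - degree M)"
proof -
  let ?S = "{a \<in> polys_lt m. a mod M \<in> R}"
  have "bij_betw (\<lambda>(r, b). r + M * b) (R \<times> polys_lt (m - degree M)) ?S"
  proof (rule bij_betwI[where g = "\<lambda>a. (a mod M, a div M)"])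
    show "(\<lambda>(r, b). r + M * b) \<in> R \<times> polys_lt (m - degree M) \<rightarrow> ?S"
    proof clarify
      fix r b :: "'a poly" assume *: "r \<in> R" "b \<in> polys_lt (m - degree M)"
      then have r: "r \<in> polys_lt (degree M)" using R by auto
      have "M * b \<in> polys_lt m"
        using * M by (cases "b = 0") (auto simp: polys_lt_iff degree_mult_eq)
      moreover have "r \<in> polys_lt m" using r M polys_lt_mono by blast
      ultimately show "r + M * b \<in> polys_lt m \<and> (r + M * b) mod M \<in> R"
        using polys_lt_add * polys_lt_mod[OF r] by auto
    qed
    show "(\<lambda>a. (a mod M, a div M)) \<in> ?S \<rightarrow> R \<times> polys_lt (m - degree M)"
    proof (rule Pi_I)
      fix a assume "a \<in> ?S"
      then have a: "a \<in> polys_lt m" "a mod M \<in> R" by auto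
      have "a div M \<in> polys_lt (m - degree M)"
      proof (cases "a div M = 0")
        case False
        have "a mod M \<in> polys_lt m" using a(2) R M(2) polys_lt_mono by blast
        then have "a - a mod M \<in> polys_lt m" using a(1) by (intro polys_lt_diff)
        then have "M * (a div M) \<in> polys_lt m" by (simp add: minus_mod_eq_mult_div)
        then have "degree (M * (a div M)) < m" using False M by (auto simp: polys_lt_iff)
        then show ?thesis using False M by (simp add: polys_lt_iff degree_mult_eq)
      qed (simp add: polys_lt_iff)
      then show "(a mod M, a div M) \<in> R \<times> polys_lt (m - degree M)" using a by simp
    qed
    show "(\<lambda>a. (a mod M, a div M)) ((\<lambda>(r, b). r + M * b) x) = x"
      if RB: "x \<in> R \<times> polys_lt (m - degree M)" for x
    proof -
      obtain r b where x: "x = (r, b)" "r \<in> R" using RB by auto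
      then have r: "r \<in> polys_lt (degree M)" using R by auto
      then have "r div M = 0" by (auto simp: polys_lt_iff div_poly_less)
      then show ?thesis using x M polys_lt_mod[OF r] by simp
    qed
  qed (simp add: mult.commute)
  then have "card ?S = card (R \<times> (polys_lt (m - degree M) :: 'a poly set))" by (rule bij_betw_same_card[symmetric])
  then show ?thesis by (simp add: card_cartesian_product card_polys_lt)
qed

lemma dvd_poly_diff:
  fixes f :: "'b::comm_ring_1 poly"
  shows "a - b dvd poly f a - poly f b"
proof (induction f)
  case (pCons c f)
  have "poly (pCons c f) a - poly (pCons c f) b = (a - b) * poly f a + b * (poly f a - poly f b)"
    by (simp add: algebra_simps)
  then show ?case using pCons.IH by (metis dvd_add dvd_mult dvd_triv_left)
qed simp

lemma dvd_poly_mod_iff: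
  fixes D :: "'a::field poly"
  shows "D dvd poly f (a mod D) \<longleftrightarrow> D dvd poly f a"
proof -
  have "D dvd a - a mod D" by (rule dvd_minus_mod)
  then have "D dvd poly f a - poly f (a mod D)" using dvd_poly_diff dvd_trans by blast
  then show ?thesis using dvd_diff_commute dvd_diff_right_iff
    by (metis diff_add_cancel dvd_add_right_iff)
qed

definition zeros_mod :: "'a::field poly poly \<Rightarrow> 'a poly \<Rightarrow> 'a poly set" where
  "zeros_mod f D = {r \<in> polys_lt (degree D). D dvd poly f r}"

lemma finite_zeros_mod: "finite (zeros_mod f (D :: 'a::{field,finite} poly))"
  unfolding zeros_mod_def using card_polys_lt(1) by (rule finite_subset[rotated]) auto

lemma mod_in_zeros_mod_iff: "D \<noteq> 0 \<Longrightarrow> a mod D \<in> zeros_mod f D \<longleftrightarrow> D dvd poly f a"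
  by (simp add: zeros_mod_def mod_in_polys_lt dvd_poly_mod_iff)

lemma rho_eq_card_zeros_mod:
  fixes D :: "'a::{field,finite} poly"
  assumes "D \<noteq> 0"
  shows "rho f D = card (zeros_mod f D)"
proof -
  have "{a mod D | a. [poly f a = 0] (mod D)} = zeros_mod f D"
  proof (intro set_eqI iffI)
    fix r assume "r \<in> {a mod D | a. [poly f a = 0] (mod D)}"
    then show "r \<in> zeros_mod f D" using mod_in_zeros_mod_iff[OF assms] by (auto simp: cong_0_iff)
  next
    fix r assume "r \<in> zeros_mod f D"
    then have "r = r mod D" "[poly f r = 0] (mod D)"
      using polys_lt_mod[of r D] by (auto simp: zeros_mod_def cong_0_iff)
    then show "r \<in> {a mod D | a. [poly f a = 0] (mod D)}" by blast
  qed
  then show ?thesis by (simp add: rho_def)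
qed

text \<open>The bound on the number of roots over the domain of residues modulo \<open>P\<close>,
  read backwards and proved by splitting off one root at a time, without passing to the quotient
  ring.\<close>

lemma const_dvd_if_many_roots:
  fixes g :: "'b::idom poly"
  assumes P: "prime_elem P"
  shows "finite S \<Longrightarrow> card S > degree g \<Longrightarrow> (\<And>s. s \<in> S \<Longrightarrow> P dvd poly g s) \<Longrightarrow>
    (\<And>s s'. s \<in> S \<Longrightarrow> s' \<in> S \<Longrightarrow> P dvd s - s' \<Longrightarrow> s = s') \<Longrightarrow> [:P:] dvd g"
proof (induction "degree g" arbitrary: g S)
  case 0
  then obtain s c where s: "s \<in> S" and c: "g = [:c:]" by (metis card.empty degree_eq_zeroE ex_in_conv less_irrefl_nat)
  then have "P dvd c" using 0 by fastforce
  then show ?case using c by simp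
next
  case (Suc n)
  then obtain r where r: "r \<in> S" by (metis card.empty ex_in_conv less_zeroE)
  define h where "h = synthetic_div g r"
  have g: "g = [:- r, 1:] * h + [:poly g r:]" using synthetic_div_correct'[of r g] by (simp add: h_def)
  have deg: "degree h = n" using Suc.hyps(2) by (simp add: h_def degree_synthetic_div)
  have "[:P:] dvd h"
  proof (rule Suc.hyps(1)[of h "S - {r}"])
    show "card (S - {r}) > degree h" using Suc.prems Suc.hyps(2) r deg by simp
    fix s assume s: "s \<in> S - {r}"
    have "poly g s = (s - r) * poly h s + poly g r" by (subst g) (simp add: algebra_simps)
    moreover have "P dvd poly g s" "P dvd poly g r" using Suc.prems s r by auto
    ultimately have "P dvd (s - r) * poly h s" by (simp add: dvd_add_left_iff)
    moreover have "\<not> P dvd s - r" using Suc.prems(4)[of s r] s r by auto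
    ultimately show "P dvd poly h s" using P by (auto dest: prime_elem_dvd_multD)
  qed (use Suc.prems deg in auto)
  moreover have "[:P:] dvd [:poly g r:]" using Suc.prems r by simp
  ultimately show ?case by (subst g) (intro dvd_add dvd_mult)
qed

text \<open>\<open>P\<close> may divide every coefficient of \<open>f\<close>, so counting roots
  modulo \<open>P\<close> is not enough. Too many incongruent roots force \<open>P\<close> to divide
  \<open>f\<close>; as the values are divisible by the square, the same points are roots modulo
  \<open>P\<close> of the quotient, and a second division contradicts square-freeness.\<close>

lemma card_roots_mod_square_le:
  fixes f :: "'a::field poly poly"
  assumes sf: "squarefree f" and P: "irreducible P" and fin: "finite S"
    and root: "\<And>s. s \<in> S \<Longrightarrow> P\<^sup>2 dvd poly f s"
    and incong: "\<And>s s'. s \<in> S \<Longrightarrow> s' \<in> S \<Longrightarrow> P dvd s - s' \<Longrightarrow> s = s'"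
  shows "card S \<le> degree f"
proof (rule ccontr)
  assume big: "\<not> card S \<le> degree f"
  have pr: "prime_elem P" using P by (rule field_poly_irreducible_imp_prime)
  then have "P \<noteq> 0" by auto
  have "P dvd poly f s" if "s \<in> S" for s
    using root[OF that] by (simp add: power2_eq_square dvd_mult_left)
  then have "[:P:] dvd f" using const_dvd_if_many_roots[OF pr fin _ _ incong] big by auto
  then obtain g where g: "f = [:P:] * g" by (auto elim: dvdE)
  have "P dvd poly g s" if "s \<in> S" for s
  proof -
    have "P * P dvd P * poly g s" using root[OF that] g by (simp add: power2_eq_square)
    then show ?thesis using \<open>P \<noteq> 0\<close> by simp
  qed
  moreover have "degree g = degree f" using g \<open>P \<noteq> 0\<close> by simp
  ultimately have "[:P:] dvd g" using const_dvd_if_many_roots[OF pr fin _ _ incong] big by auto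
  then have "[:P:]\<^sup>2 dvd f" unfolding g power2_eq_square by (rule mult_dvd_mono[OF dvd_refl])
  then have "[:P:] dvd 1" using sf by (auto simp: squarefree_def)
  then have "P dvd 1" by (simp only: is_unit_const_poly_iff)
  then show False using P by (auto simp: irreducible_def)
qed

text \<open>One representative for each class modulo \<open>P\<close> shows that the zeros modulo
  the square occupy at most \<open>degree f\<close> such classes, and every class has
  \<open>q ^ degree P\<close> lifts.\<close>

lemma rho_square_le:
  fixes f :: "'a::{field,finite} poly poly"
  assumes sf: "squarefree f" and P: "irreducible P"
  shows "rho f (P\<^sup>2) \<le> degree f * CARD('a) ^ degree P"
proof -
  have nz: "P \<noteq> 0" "P\<^sup>2 \<noteq> 0" using P by auto
  define Z where "Z = zeros_mod f (P\<^sup>2)"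
  have fin: "finite Z" unfolding Z_def by (rule finite_zeros_mod)
  define Y where "Y = (\<lambda>r. r mod P) ` Z"
  have "\<forall>y\<in>Y. \<exists>r\<in>Z. r mod P = y" by (auto simp: Y_def)
  then obtain r where r: "\<And>y. y \<in> Y \<Longrightarrow> r y \<in> Z" "\<And>y. y \<in> Y \<Longrightarrow> r y mod P = y" by metis
  have "card (r ` Y) \<le> degree f"
  proof (rule card_roots_mod_square_le[OF sf P])
    show "finite (r ` Y)" using fin by (simp add: Y_def)
    show "P\<^sup>2 dvd poly f s" if "s \<in> r ` Y" for s using that r by (auto simp: Z_def zeros_mod_def)
    show "s = s'" if "s \<in> r ` Y" "s' \<in> r ` Y" "P dvd s - s'" for s s'
      using that r by (auto simp: mod_eq_dvd_iff[symmetric])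
  qed
  moreover have "inj_on r Y" using r(2) by (metis inj_onI)
  ultimately have Y: "card Y \<le> degree f" by (simp add: card_image)
  have Ysub: "Y \<subseteq> polys_lt (degree P)" using nz by (auto simp: Y_def mod_in_polys_lt)
  have dP: "degree (P\<^sup>2) = 2 * degree P" using nz by (simp add: degree_power_eq)
  have "Z \<subseteq> {a \<in> polys_lt (2 * degree P). a mod P \<in> Y}" by (auto simp: Z_def zeros_mod_def Y_def dP)
  then have "card Z \<le> card {a \<in> polys_lt (2 * degree P). a mod P \<in> Y}"
    by (intro card_mono finite_Collect_conjI disjI1) (simp add: card_polys_lt(1))
  also have "\<dots> = card Y * CARD('a) ^ (2 * degree P - degree P)"
    using nz Ysub by (intro card_mod_in) auto
  also have "\<dots> \<le> degree f * CARD('a) ^ degree P" using Y by simp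
  finally show ?thesis using nz by (simp add: rho_eq_card_zeros_mod Z_def)
qed

lemma dvd_pderiv_if_square_dvd:
  fixes P :: "'a::field poly"
  assumes "P\<^sup>2 dvd g"
  shows "P dvd pderiv g"
proof -
  obtain c where "g = P\<^sup>2 * c" using assms by (rule dvdE)
  then have "g = P * (P * c)" by (simp add: power2_eq_square mult.assoc)
  then show ?thesis by (simp add: pderiv_mult)
qed

text \<open>Away from the eliminant, a zero of \<open>f\<close> modulo \<open>P\<^sup>2\<close> is a simple zero modulo \<open>P\<close>: otherwise
  \<open>P\<close> would divide \<open>f(a)\<close>, \<open>f\<^sub>x(a)\<close> and the \<open>t\<close>-derivative of \<open>f(a)\<close>, hence also \<open>f\<^sub>t(a)\<close>.\<close>

lemma rho_square_le_good:
  fixes f :: "'a::{field,finite} poly poly"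
  assumes sf: "squarefree f" and P: "irreducible P" and nR: "\<not> P dvd R"
    and R: "\<And>a. P dvd poly f a \<Longrightarrow> P dvd poly (dt f) a + u * poly (pderiv f) a \<Longrightarrow> P dvd R"
  shows "rho f (P\<^sup>2) \<le> degree f"
proof -
  have nz: "P \<noteq> 0" "P\<^sup>2 \<noteq> 0" using P by auto
  have pr: "prime_elem P" using P by (rule field_poly_irreducible_imp_prime)
  have simple: "\<not> P dvd poly (pderiv f) a" if "P\<^sup>2 dvd poly f a" for a
  proof
    assume x: "P dvd poly (pderiv f) a"
    have "P dvd poly f a" using that by (simp add: power2_eq_square dvd_mult_left)
    moreover have "P dvd poly (dt f) a + pderiv a * poly (pderiv f) a"
      using dvd_pderiv_if_square_dvd[OF that] by (simp add: pderiv_poly)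
    then have "P dvd poly (dt f) a" using x by (simp add: dvd_add_left_iff)
    then have "P dvd poly (dt f) a + u * poly (pderiv f) a" using x by simp
    ultimately show False using R nR by blast
  qed
  have "card (zeros_mod f (P\<^sup>2)) \<le> degree f"
  proof (rule card_roots_mod_square_le[OF sf P finite_zeros_mod])
    fix s s' assume s: "s \<in> zeros_mod f (P\<^sup>2)" "s' \<in> zeros_mod f (P\<^sup>2)" "P dvd s - s'"
    obtain b where b: "s = s' + P * b"
      using s(3) by (metis add.commute diff_eq_eq dvdE)
    \<comment> \<open>The first-order Taylor expansion at \<open>s'\<close>: a simple zero modulo
      \<open>P\<close> lifts in at most one way, as in Hensel's lemma.\<close>
    have taylor: "\<exists>w. poly f (s' + P * b) = poly f s' + P * b * poly (pderiv f) s' + P\<^sup>2 * w"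
      for f :: "'a poly poly"
    proof (induction f)
      case (pCons c f)
      then obtain w where w: "poly f (s' + P * b) = poly f s' + P * b * poly (pderiv f) s' + P\<^sup>2 * w" by blast
      have "poly (pCons c f) (s' + P * b) = poly (pCons c f) s' + P * b * poly (pderiv (pCons c f)) s' +
         P\<^sup>2 * (b * b * poly (pderiv f) s' + w * (s' + P * b))"
        by (simp add: w pderiv_pCons algebra_simps power2_eq_square)
      then show ?case by blast
    qed auto
    obtain w where w: "poly f s = poly f s' + P * b * poly (pderiv f) s' + P\<^sup>2 * w"
      using taylor[of f] b by auto
    have d: "P\<^sup>2 dvd poly f s" "P\<^sup>2 dvd poly f s'" using s by (auto simp: zeros_mod_def)
    have "P * b * poly (pderiv f) s' = poly f s - poly f s' - P\<^sup>2 * w" using w by simp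
    then have "P\<^sup>2 dvd P * b * poly (pderiv f) s'" using d by (metis dvd_diff dvd_triv_left)
    then have "P dvd b * poly (pderiv f) s'" using nz by (simp add: power2_eq_square mult.assoc)
    then have "P dvd b" using pr simple[OF d(2)] by (auto dest: prime_elem_dvd_multD)
    then have "P\<^sup>2 dvd s - s'" using b by (simp add: power2_eq_square mult_dvd_mono)
    moreover have "s - s' \<in> polys_lt (degree (P\<^sup>2))"
      using s by (intro polys_lt_diff) (auto simp: zeros_mod_def)
    ultimately show "s = s'" using dvd_polys_lt_imp_0 by fastforce
  qed (auto simp: zeros_mod_def)
  then show ?thesis using nz by (simp add: rho_eq_card_zeros_mod)
qed

section \<open>Square divisors of large degree\<close>

lemma monic_irreducible_dvd_imp_eq:
  assumes "P \<in> monic_irreducibles" "Q \<in> monic_irreducibles" "P dvd Q"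
  shows "P = Q"
proof -
  obtain c where c: "Q = P * c" using assms(3) by (rule dvdE)
  have "\<not> P dvd 1" "irreducible Q" using assms by (auto simp: monic_irreducibles_def irreducible_def)
  then have "c dvd 1" using irreducibleD[OF _ c] by blast
  then obtain e where e: "c = [:e:]" by (auto simp: is_unit_poly_iff)
  have "lead_coeff Q = lead_coeff P * lead_coeff c" by (simp add: c lead_coeff_mult)
  then have "e = 1" using assms e by (simp add: monic_irreducibles_def)
  then show ?thesis using c e by simp
qed

lemma monic_irreducibleD:
  fixes P :: "'a::field poly"
  assumes "P \<in> monic_irreducibles"
  shows "irreducible P" "prime_elem P" "P \<noteq> 0" "degree P > 0" "degree (P\<^sup>2) = 2 * degree P"
proof -
  show i: "irreducible P" using assms by (simp add: monic_irreducibles_def)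
  then show "prime_elem P" by (rule field_poly_irreducible_imp_prime)
  show nz: "P \<noteq> 0" using i by auto
  have "\<not> P dvd 1" using i by (simp add: irreducible_def)
  then show "degree P > 0" using nz by (simp add: is_unit_iff_degree)
  show "degree (P\<^sup>2) = 2 * degree P" using nz by (simp add: degree_power_eq)
qed

lemma monic_irreducible_divisors:
  fixes R :: "'a::field poly"
  assumes "R \<noteq> 0"
  shows "finite {P \<in> monic_irreducibles. P dvd R}"
    and "(\<Sum>P | P \<in> monic_irreducibles \<and> P dvd R. degree P) \<le> degree R"
    and "card {P \<in> monic_irreducibles. P dvd R} \<le> degree R"
proof -
  let ?D = "{P \<in> monic_irreducibles. P dvd R}"
  have sum: "(\<Sum>P\<in>W. degree P) \<le> degree R" if W: "W \<subseteq> ?D" "finite W" for W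
  proof -
    have mem: "P \<in> monic_irreducibles" "P dvd R" if "P \<in> W" for P using W that by auto
    have "(\<Prod>P\<in>W. P) dvd R"
      using W(2) by (rule prod_prime_elem_dvd)
        (use mem monic_irreducibleD monic_irreducible_dvd_imp_eq in blast)+
    then have "degree (\<Prod>P\<in>W. P) \<le> degree R" using assms by (rule dvd_imp_degree_le)
    moreover have "degree (\<Prod>P\<in>W. P) = (\<Sum>P\<in>W. degree P)"
      using mem monic_irreducibleD by (intro degree_prod_eq_sum_degree) blast
    ultimately show ?thesis by simp
  qed
  have card: "card W \<le> (\<Sum>P\<in>W. degree P)" if "W \<subseteq> ?D" for W
  proof -
    have "(\<Sum>P\<in>W. 1) \<le> (\<Sum>P\<in>W. degree P)"
      using that monic_irreducibleD(4) by (intro sum_mono) (auto simp: Suc_le_eq)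
    then show ?thesis by simp
  qed
  have fin: "finite ?D \<and> card ?D \<le> degree R"
    by (rule finite_if_finite_subsets_card_bdd) (use sum card le_trans in blast)
  then show "finite ?D" "card ?D \<le> degree R" by auto
  then show "(\<Sum>P | P \<in> monic_irreducibles \<and> P dvd R. degree P) \<le> degree R"
    using sum[of ?D] by simp
qed

lemma exists_monic_irreducible_factor:
  fixes h :: "'a::field poly"
  assumes "degree h > 0"
  shows "\<exists>P\<in>monic_irreducibles. P dvd h"
proof -
  obtain P where P: "irreducible P" "P dvd h" using exists_irreducible_factor[OF assms] by blast
  define c where "c = inverse (lead_coeff P)"
  have "P \<noteq> 0" using P by auto
  then have "c \<noteq> 0" by (simp add: c_def)
  have eq: "smult c P dvd g \<longleftrightarrow> P dvd g" for g using \<open>c \<noteq> 0\<close> by (simp add: smult_dvd_iff)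
  have "irreducible (smult c P)"
  proof (rule irreducibleI)
    show "smult c P \<noteq> 0" using \<open>c \<noteq> 0\<close> \<open>P \<noteq> 0\<close> by simp
    show "\<not> smult c P dvd 1" using P eq by (simp add: irreducible_def)
    fix a b assume "smult c P = a * b"
    then have "smult (inverse c) (smult c P) = smult (inverse c) a * b" by simp
    then have "P = smult (inverse c) a * b" using \<open>c \<noteq> 0\<close> by simp
    then have "smult (inverse c) a dvd 1 \<or> b dvd 1" using P by (rule_tac irreducibleD)
    then show "a dvd 1 \<or> b dvd 1" using \<open>c \<noteq> 0\<close> by (simp add: smult_dvd_iff)
  qed
  then have "smult c P \<in> monic_irreducibles"
    using \<open>P \<noteq> 0\<close> by (simp add: monic_irreducibles_def c_def)
  then show ?thesis using eq P by blast
qed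

lemma squarefree_iff_monic_irreducibles:
  fixes g :: "'a::field poly"
  shows "squarefree g \<longleftrightarrow> (\<forall>P\<in>monic_irreducibles. \<not> P\<^sup>2 dvd g)"
proof
  assume "squarefree g"
  then show "\<forall>P\<in>monic_irreducibles. \<not> P\<^sup>2 dvd g"
    by (auto simp: squarefree_poly_iff monic_irreducibleD)
next
  assume *: "\<forall>P\<in>monic_irreducibles. \<not> P\<^sup>2 dvd g"
  \<comment> \<open>An irreducible polynomial has to exist in order to rule out
    \<open>g = 0\<close>, which every square divides; a factor of \<open>t\<close> serves.\<close>
  have "degree [:0, 1 :: 'a:] > 0" by simp
  then obtain P :: "'a poly" where "P \<in> monic_irreducibles"
    using exists_monic_irreducible_factor by blast
  then have "g \<noteq> 0" using * by auto
  moreover have "\<not> h\<^sup>2 dvd g" if "degree h > 0" for h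
    using exists_monic_irreducible_factor[OF that] * dvd_power_same dvd_trans by blast
  ultimately show "squarefree g" by (simp add: squarefree_poly_iff)
qed

text \<open>The kernel consists of the powers \<open>b ^ p\<close>, with \<open>p * degree b\<close>
  at most \<open>m - 1\<close> when \<open>b\<close> is nonzero; the final \<open>+ 1\<close> in the
  exponent counts the constant coefficient of \<open>b\<close>.\<close>

lemma card_pderiv_kernel:
  fixes m :: nat
  assumes "m > 0"
  shows "card {a \<in> polys_lt m. pderiv a = (0 :: 'a::{field,finite} poly)} =
    CARD('a) ^ ((m - 1) div CHAR('a) + 1)"
proof -
  define p where "p = CHAR('a)"
  have pr: "prime CHAR('a)" by (rule CHAR_finite_field_prime)
  then have p: "p > 0" by (simp add: p_def prime_gt_0_nat)
  define c where "c = (m - 1) div p + 1"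
  have lt: "d < c \<longleftrightarrow> p * d < m" for d
  proof -
    have "d < c \<longleftrightarrow> d \<le> (m - 1) div p" by (auto simp: c_def)
    also have "\<dots> \<longleftrightarrow> d * p \<le> m - 1" using p by (simp add: less_eq_div_iff_mult_less_eq)
    also have "\<dots> \<longleftrightarrow> p * d < m" using assms by (auto simp: mult.commute)
    finally show ?thesis .
  qed
  have inj: "inj_on (\<lambda>b::'a poly. b ^ p) (polys_lt c)"
  proof (rule inj_onI)
    fix x y :: "'a poly" assume "x ^ p = y ^ p"
    moreover have "((x - y) + y) ^ p = (x - y) ^ p + y ^ p"
      using pr by (intro freshmans_dream) (auto simp: p_def)
    ultimately have "(x - y) ^ p = 0" by simp
    then show "x = y" by simp
  qed
  have "{a \<in> polys_lt m. pderiv a = 0} = (\<lambda>b::'a poly. b ^ p) ` polys_lt c"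
  proof (intro set_eqI iffI)
    fix a :: "'a poly" assume a: "a \<in> {a \<in> polys_lt m. pderiv a = 0}"
    then obtain b where b: "a = b ^ p" using pderiv_eq_0_imp_power p_def by blast
    have "b \<in> polys_lt c"
    proof (cases "b = 0")
      case False
      have "a \<in> polys_lt m" using a by simp
      then have "degree a < m" using False b by (simp add: polys_lt_iff)
      then have "p * degree b < m" using False b by (simp add: degree_power_eq)
      then show ?thesis using lt by (simp add: polys_lt_iff)
    qed (simp add: polys_lt_iff)
    then show "a \<in> (\<lambda>b. b ^ p) ` polys_lt c" using b by blast
  next
    fix a :: "'a poly" assume "a \<in> (\<lambda>b. b ^ p) ` polys_lt c"
    then obtain b where b: "a = b ^ p" "b \<in> polys_lt c" by blast
    have "a \<in> polys_lt m"
    proof (cases "b = 0")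
      case False
      then have "degree b < c" using b(2) by (simp add: polys_lt_iff)
      then have "p * degree b < m" using lt by blast
      then show ?thesis using False b(1) by (simp add: polys_lt_iff degree_power_eq)
    qed (use b(1) p in \<open>simp add: polys_lt_iff\<close>)
    moreover have "pderiv a = smult (of_nat p) (b ^ (p - 1) * pderiv b)"
      using p b by (simp add: pderiv_power)
    then have "pderiv a = 0" by (simp add: p_def)
    ultimately show "a \<in> {a \<in> polys_lt m. pderiv a = 0}" by simp
  qed
  then have "card {a \<in> polys_lt m. pderiv a = (0 :: 'a poly)} = card (polys_lt c :: 'a poly set)"
    using inj by (simp add: card_image)
  then show ?thesis by (simp add: card_polys_lt c_def p_def)
qed

lemma card_pderiv_fibre:
  fixes m :: nat
  assumes "m > 0" "u \<in> pderiv ` (polys_lt m :: 'a::{field,finite} poly set)"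
  shows "card {a \<in> polys_lt m. pderiv a = u} = CARD('a) ^ ((m - 1) div CHAR('a) + 1)"
proof -
  obtain a0 where a0: "a0 \<in> polys_lt m" "pderiv a0 = u" using assms(2) by blast
  have "bij_betw (\<lambda>a. a - a0) {a \<in> polys_lt m. pderiv a = u} {a \<in> polys_lt m. pderiv a = 0}"
    by (rule bij_betwI[where g = "\<lambda>a. a + a0"])
      (use a0 polys_lt_add polys_lt_diff in \<open>auto simp: pderiv_diff pderiv_add\<close>)
  then have "card {a \<in> polys_lt m. pderiv a = u} = card {a \<in> polys_lt m. pderiv a = (0 :: 'a poly)}"
    by (rule bij_betw_same_card)
  then show ?thesis using card_pderiv_kernel[OF assms(1), where 'a='a] by simp
qed

text \<open>Within a fibre of the derivative, two polynomials of degree below \<open>m\<close> congruent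
  modulo \<open>P\<close> differ by a multiple of \<open>P\<^sup>2\<close>, hence coincide when \<open>2 deg P \<ge> m\<close>.\<close>

lemma card_large_square_divisor:
  fixes f :: "'a::{field,finite} poly poly" and m :: nat
  assumes sf: "squarefree f" and deg: "degree f \<le> k" and n: "tdeg_le f n" and m: "m > 0"
  defines "c \<equiv> (m - 1) div CHAR('a) + 1"
  shows "card {a \<in> polys_lt m. \<exists>P\<in>monic_irreducibles. m \<le> 2 * degree P \<and> P\<^sup>2 dvd poly f a} * CARD('a) ^ c
    \<le> k * CARD('a) ^ (2 * c) + k * (n + m) * 4 ^ k * CARD('a) ^ m"
proof -
  obtain U where U: "finite U" "card U \<le> k"
    "\<And>u. u \<notin> U \<Longrightarrow> \<exists>R. R \<noteq> 0 \<and> degree R \<le> (n + degree u) * 4 ^ k \<and>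
      (\<forall>P a. P dvd poly f a \<longrightarrow> P dvd poly (dt f) a + u * poly (pderiv f) a \<longrightarrow> P dvd R)"
    using exists_eliminant[OF sf deg n] by blast
  then obtain R where R: "\<And>u. u \<notin> U \<Longrightarrow> R u \<noteq> 0"
    "\<And>u. u \<notin> U \<Longrightarrow> degree (R u) \<le> (n + degree u) * 4 ^ k"
    "\<And>u P a. u \<notin> U \<Longrightarrow> P dvd poly f a \<Longrightarrow> P dvd poly (dt f) a + u * poly (pderiv f) a \<Longrightarrow> P dvd R u"
    by metis
  let ?A = "polys_lt m :: 'a poly set"
  define q where "q = CARD('a)"
  define I where "I = pderiv ` ?A"
  define X where "X = {a \<in> ?A. \<exists>P\<in>monic_irreducibles. m \<le> 2 * degree P \<and> P\<^sup>2 dvd poly f a}"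
  define F where "F u = {a \<in> ?A. pderiv a = u}" for u
  define D where "D u = {P \<in> monic_irreducibles. P dvd R u}" for u
  \<comment> \<open>The empty set for \<open>P\<close> of small degree makes \<open>k\<close> a
    bound for \<open>S u P\<close> at every \<open>P\<close> in \<open>D u\<close>.\<close>
  define S where "S u P = (if m \<le> 2 * degree P then {a \<in> F u. P\<^sup>2 dvd poly f a} else {})" for u P
  have finA: "finite ?A" by (rule card_polys_lt)
  then have finI: "finite I" by (simp add: I_def)
  have F: "card (F u) = q ^ c" if "u \<in> I" for u
    using card_pderiv_fibre[OF m] that by (simp add: F_def I_def c_def q_def)
  have finF: "finite (F u)" for u using finA by (simp add: F_def)
  have "q ^ m = card (\<Union>u\<in>I. F u)"
  proof -
    have "(\<Union>u\<in>I. F u) = ?A" by (auto simp: I_def F_def)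
    then show ?thesis by (simp add: card_polys_lt q_def)
  qed
  also have "\<dots> = (\<Sum>u\<in>I. card (F u))"
    by (rule card_UN_disjoint) (use finI finF in \<open>auto simp: F_def\<close>)
  also have "\<dots> = card I * q ^ c" using F by simp
  finally have cardI: "card I * q ^ c = q ^ m" ..
  \<comment> \<open>A bad \<open>u\<close> is charged its whole fibre, but there are at most
    \<open>k\<close> of them; a good \<open>u\<close> is charged only the few \<open>a\<close>
    belonging to each prime divisor of \<open>R u\<close>.\<close>
  have sub: "X \<subseteq> (\<Union>u\<in>U \<inter> I. F u) \<union> (\<Union>u\<in>I - U. \<Union>P\<in>D u. S u P)"
  proof
    fix a assume a: "a \<in> X"
    define u where "u = pderiv a"
    have aF: "a \<in> F u" and uI: "u \<in> I" using a by (auto simp: X_def F_def I_def u_def)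
    obtain P where P: "P \<in> monic_irreducibles" "m \<le> 2 * degree P" "P\<^sup>2 dvd poly f a"
      using a by (auto simp: X_def)
    show "a \<in> (\<Union>u\<in>U \<inter> I. F u) \<union> (\<Union>u\<in>I - U. \<Union>P\<in>D u. S u P)"
    proof (cases "u \<in> U")
      case False
      have "P dvd poly f a" using P(3) by (simp add: power2_eq_square dvd_mult_left)
      moreover have "P dvd poly (dt f) a + u * poly (pderiv f) a"
        using dvd_pderiv_if_square_dvd[OF P(3)] by (simp add: pderiv_poly u_def)
      ultimately have "P \<in> D u" using R(3) False P(1) by (auto simp: D_def)
      moreover have "a \<in> S u P" using aF P by (simp add: S_def)
      ultimately show ?thesis using False uI by blast
    qed (use aF uI in blast)
  qed
  have cardS: "card (S u P) \<le> k" if "P \<in> D u" for u P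
  proof (cases "m \<le> 2 * degree P")
    case True
    have P: "P \<in> monic_irreducibles" using that by (simp add: D_def)
    have "card (S u P) \<le> degree f"
    proof (rule card_roots_mod_square_le[OF sf monic_irreducibleD(1)[OF P]])
      show "finite (S u P)" using finF by (simp add: S_def)
      show "P\<^sup>2 dvd poly f s" if "s \<in> S u P" for s using that by (auto simp: S_def split: if_splits)
      fix s s' assume s: "s \<in> S u P" "s' \<in> S u P" "P dvd s - s'"
      then have mem: "s - s' \<in> polys_lt m" and "pderiv (s - s') = 0"
        by (auto simp: S_def F_def pderiv_diff intro: polys_lt_diff split: if_splits)
      then have "P\<^sup>2 dvd s - s'" using square_dvd_if_pderiv_eq_0 monic_irreducibleD(1)[OF P] s by blast
      moreover have "s - s' \<in> polys_lt (degree (P\<^sup>2))"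
        using mem True polys_lt_mono monic_irreducibleD(5)[OF P] by (metis subsetD)
      ultimately show "s = s'" using dvd_polys_lt_imp_0 by fastforce
    qed
    then show ?thesis using deg by simp
  qed (simp add: S_def)
  have cardD: "finite (D u)" "card (D u) \<le> (n + m) * 4 ^ k" if "u \<in> I - U" for u
  proof -
    have nz: "R u \<noteq> 0" using R that by blast
    show "finite (D u)" using monic_irreducible_divisors(1)[OF nz] by (simp add: D_def)
    obtain a where "a \<in> ?A" "u = pderiv a" using \<open>u \<in> I - U\<close> by (auto simp: I_def)
    then have "degree u \<le> m" using degree_pderiv_le[of a] m by (auto simp: polys_lt_iff)
    then have "(n + degree u) * 4 ^ k \<le> (n + m) * 4 ^ k" by simp
    moreover have "card (D u) \<le> degree (R u)"
      using monic_irreducible_divisors(3)[OF nz] by (simp add: D_def)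
    moreover have "degree (R u) \<le> (n + degree u) * 4 ^ k" using R that by blast
    ultimately show "card (D u) \<le> (n + m) * 4 ^ k" by linarith
  qed
  have finS: "finite (S u P)" for u P using finF by (simp add: S_def)
  have "card X \<le> card ((\<Union>u\<in>U \<inter> I. F u) \<union> (\<Union>u\<in>I - U. \<Union>P\<in>D u. S u P))"
    by (rule card_mono[OF _ sub]) (use finI finF cardD finS in auto)
  also have "\<dots> \<le> card (\<Union>u\<in>U \<inter> I. F u) + card (\<Union>u\<in>I - U. \<Union>P\<in>D u. S u P)" by (rule card_Un_le)
  also have "card (\<Union>u\<in>U \<inter> I. F u) \<le> (\<Sum>u\<in>U \<inter> I. card (F u))"
    using finI by (intro card_UN_le) simp
  also have "\<dots> = card (U \<inter> I) * q ^ c" using F by simp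
  also have "\<dots> \<le> k * q ^ c"
    using U(2) card_mono[OF U(1), of "U \<inter> I"] by (intro mult_right_mono) auto
  also have "card (\<Union>u\<in>I - U. \<Union>P\<in>D u. S u P) \<le> (\<Sum>u\<in>I - U. card (\<Union>P\<in>D u. S u P))"
    using finI by (intro card_UN_le) simp
  also have "\<dots> \<le> (\<Sum>u\<in>I - U. (n + m) * 4 ^ k * k)"
  proof (rule sum_mono)
    fix u assume u: "u \<in> I - U"
    have "card (\<Union>P\<in>D u. S u P) \<le> (\<Sum>P\<in>D u. card (S u P))" using cardD(1)[OF u] by (rule card_UN_le)
    also have "\<dots> \<le> (\<Sum>P\<in>D u. k)" using cardS by (intro sum_mono)
    also have "\<dots> \<le> (n + m) * 4 ^ k * k" using cardD(2)[OF u] by simp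
    finally show "card (\<Union>P\<in>D u. S u P) \<le> (n + m) * 4 ^ k * k" .
  qed
  also have "\<dots> \<le> card I * ((n + m) * 4 ^ k * k)"
    using card_mono[OF finI, of "I - U"] by simp
  finally have "card X \<le> k * q ^ c + card I * ((n + m) * 4 ^ k * k)" by simp
  then have "card X * q ^ c \<le> (k * q ^ c + card I * ((n + m) * 4 ^ k * k)) * q ^ c"
    by (rule mult_right_mono) simp
  also have "\<dots> = k * q ^ (2 * c) + k * (n + m) * 4 ^ k * (card I * q ^ c)"
    by (simp add: algebra_simps mult_2 power_add mult_2_right)
  finally show ?thesis unfolding cardI by (simp add: X_def q_def)
qed

section \<open>The sieve\<close>

lemma prime_square_mult_dvd:
  fixes Q :: "'b::idom"
  assumes "prime_elem Q" "\<not> Q dvd M" "Q\<^sup>2 dvd x" "M dvd x"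
  shows "Q\<^sup>2 * M dvd x"
proof -
  obtain v where v: "x = M * v" using assms(4) by (rule dvdE)
  have "Q dvd M * v" using assms(3) v by (metis dvd_mult_left power2_eq_square)
  then have "Q dvd v" using assms by (auto dest: prime_elem_dvd_multD)
  then obtain w where w: "v = Q * w" by (rule dvdE)
  have "Q * Q dvd Q * (M * w)" using assms(3) v w by (simp add: power2_eq_square mult_ac)
  then have "Q dvd M * w" using assms(1) by (auto simp: prime_elem_def)
  then have "Q dvd w" using assms by (auto dest: prime_elem_dvd_multD)
  then have "Q\<^sup>2 dvd v" unfolding w power2_eq_square by (rule mult_dvd_mono[OF dvd_refl])
  then show ?thesis unfolding v by (simp add: mult.commute[of "Q\<^sup>2"] mult_dvd_mono)
qed

text \<open>The Chinese remainder theorem, with coprimality in the form \<open>cop\<close>. The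
  residue map is injective by \<open>cop\<close>, and surjective because both sides have equally
  many elements.\<close>

lemma card_zeros_mod_mult:
  fixes D E :: "'a::{field,finite} poly"
  assumes nz: "D \<noteq> 0" "E \<noteq> 0" and cop: "\<And>x. D dvd x \<Longrightarrow> E dvd x \<Longrightarrow> D * E dvd x"
  shows "card (zeros_mod f (D * E)) = card (zeros_mod f D) * card (zeros_mod f E)"
proof -
  define \<phi> where "\<phi> r = (r mod D, r mod E)" for r
  let ?L = "polys_lt (degree (D * E)) :: 'a poly set"
  let ?R = "(polys_lt (degree D) \<times> polys_lt (degree E)) :: ('a poly \<times> 'a poly) set"
  have inj: "inj_on \<phi> ?L"
  proof (rule inj_onI)
    fix r s assume rs: "r \<in> ?L" "s \<in> ?L" "\<phi> r = \<phi> s"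
    then have "D dvd r - s" "E dvd r - s" by (auto simp: \<phi>_def mod_eq_dvd_iff)
    then have "D * E dvd r - s" by (rule cop)
    moreover have "r - s \<in> ?L" using rs by (intro polys_lt_diff)
    ultimately have "r - s = 0" by (rule dvd_polys_lt_imp_0)
    then show "r = s" by simp
  qed
  have sub: "\<phi> ` ?L \<subseteq> ?R" using nz by (auto simp: \<phi>_def mod_in_polys_lt)
  have "card (\<phi> ` ?L) = card ?R"
    using inj nz by (simp add: card_image card_polys_lt card_cartesian_product degree_mult_eq power_add)
  then have surj: "\<phi> ` ?L = ?R" using sub card_polys_lt(1) by (intro card_subset_eq) auto
  have "\<phi> ` zeros_mod f (D * E) = zeros_mod f D \<times> zeros_mod f E"
  proof (intro set_eqI iffI)
    fix z assume "z \<in> \<phi> ` zeros_mod f (D * E)"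
    then obtain r where r: "z = \<phi> r" "D * E dvd poly f r" by (auto simp: zeros_mod_def)
    then have "D dvd poly f r" "E dvd poly f r" by (auto dest: dvd_mult_left dvd_mult_right)
    then show "z \<in> zeros_mod f D \<times> zeros_mod f E"
      using nz r by (simp add: \<phi>_def mod_in_zeros_mod_iff)
  next
    fix z assume z: "z \<in> zeros_mod f D \<times> zeros_mod f E"
    then have "z \<in> ?R" by (auto simp: zeros_mod_def)
    then obtain r where r: "r \<in> ?L" "z = \<phi> r" using surj by blast
    then have "D dvd poly f r" "E dvd poly f r"
      using z nz by (auto simp: \<phi>_def mod_in_zeros_mod_iff)
    then have "r \<in> zeros_mod f (D * E)" using r cop by (simp add: zeros_mod_def)
    then show "z \<in> \<phi> ` zeros_mod f (D * E)" using r by blast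
  qed
  moreover have "inj_on \<phi> (zeros_mod f (D * E))"
    using inj by (rule inj_on_subset) (auto simp: zeros_mod_def)
  ultimately have "card (zeros_mod f (D * E)) = card (zeros_mod f D \<times> zeros_mod f E)"
    by (metis card_image)
  then show ?thesis by (simp add: card_cartesian_product)
qed

lemma prod_squares_monic_irreducibles:
  fixes T :: "'a::{field,finite} poly set"
  assumes "finite T" "T \<subseteq> monic_irreducibles"
  shows "(\<forall>P\<in>T. P\<^sup>2 dvd x) \<longleftrightarrow> (\<Prod>P\<in>T. P\<^sup>2) dvd x"
    and "card (zeros_mod f (\<Prod>P\<in>T. P\<^sup>2)) = (\<Prod>P\<in>T. rho f (P\<^sup>2))"
    and "(\<Prod>P\<in>T. P\<^sup>2) \<noteq> 0"
    and "degree (\<Prod>P\<in>T. P\<^sup>2) = (\<Sum>P\<in>T. 2 * degree P)"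
proof -
  have "(\<forall>x. (\<forall>P\<in>T. P\<^sup>2 dvd x) \<longleftrightarrow> (\<Prod>P\<in>T. P\<^sup>2) dvd x) \<and>
    card (zeros_mod f (\<Prod>P\<in>T. P\<^sup>2)) = (\<Prod>P\<in>T. rho f (P\<^sup>2)) \<and> (\<Prod>P\<in>T. P\<^sup>2) \<noteq> 0 \<and>
    degree (\<Prod>P\<in>T. P\<^sup>2) = (\<Sum>P\<in>T. 2 * degree P)"
    using assms
  proof (induction T rule: finite_induct)
    case empty
    have "zeros_mod f (1 :: 'a poly) = {0}" by (auto simp: zeros_mod_def polys_lt_iff)
    then show ?case by simp
  next
    case (insert Q T)
    let ?M = "\<Prod>P\<in>T. P\<^sup>2"
    have Q: "Q \<in> monic_irreducibles" and T: "T \<subseteq> monic_irreducibles" using insert by auto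
    note QD = monic_irreducibleD[OF Q]
    have "\<not> Q dvd ?M"
    proof
      assume "Q dvd ?M"
      then obtain P where P: "P \<in> T" "Q dvd P\<^sup>2"
        using prime_elem_dvd_prod[OF insert.hyps(1) QD(2)] by blast
      then have "Q dvd P" using QD(2) prime_elem_dvd_power by blast
      then have "Q = P" using Q T P monic_irreducible_dvd_imp_eq by blast
      then show False using P insert.hyps by simp
    qed
    then have cop: "Q\<^sup>2 * ?M dvd x" if "Q\<^sup>2 dvd x" "?M dvd x" for x
      using prime_square_mult_dvd QD(2) that by blast
    have IH: "(\<forall>P\<in>T. P\<^sup>2 dvd x) \<longleftrightarrow> ?M dvd x" "card (zeros_mod f ?M) = (\<Prod>P\<in>T. rho f (P\<^sup>2))"
        "?M \<noteq> 0" "degree ?M = (\<Sum>P\<in>T. 2 * degree P)" for x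
      using insert.IH[OF T] by blast+
    have Q2: "Q\<^sup>2 \<noteq> 0" using QD by simp
    have 1: "(\<forall>P\<in>insert Q T. P\<^sup>2 dvd x) \<longleftrightarrow> Q\<^sup>2 * ?M dvd x" for x
      using cop IH(1)[of x] by (auto dest: dvd_mult_left dvd_mult_right)
    have 2: "card (zeros_mod f (Q\<^sup>2 * ?M)) = rho f (Q\<^sup>2) * (\<Prod>P\<in>T. rho f (P\<^sup>2))"
      using card_zeros_mod_mult[OF Q2 IH(3) cop] IH(2) rho_eq_card_zeros_mod[OF Q2] by simp
    have 3: "degree (Q\<^sup>2 * ?M) = 2 * degree Q + (\<Sum>P\<in>T. 2 * degree P)"
      using Q2 IH QD by (simp add: degree_mult_eq)
    show ?case
      unfolding prod.insert[OF insert.hyps] sum.insert[OF insert.hyps] using 1 2 3 Q2 IH(3)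
      by (intro conjI) (simp_all only: mult_eq_0_iff simp_thms)
  qed
  then show "(\<forall>P\<in>T. P\<^sup>2 dvd x) \<longleftrightarrow> (\<Prod>P\<in>T. P\<^sup>2) dvd x"
    "card (zeros_mod f (\<Prod>P\<in>T. P\<^sup>2)) = (\<Prod>P\<in>T. rho f (P\<^sup>2))" "(\<Prod>P\<in>T. P\<^sup>2) \<noteq> 0"
    "degree (\<Prod>P\<in>T. P\<^sup>2) = (\<Sum>P\<in>T. 2 * degree P)" by blast+
qed

definition sq_density :: "'a::{field,finite} poly poly \<Rightarrow> 'a poly \<Rightarrow> real" where
  "sq_density f P = real (rho f (P\<^sup>2)) / (pnorm P)\<^sup>2"

text \<open>The hypothesis on \<open>m\<close> says that the product of the squares has degree at
  most \<open>m\<close>, so equidistribution modulo this product is exact and the densities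
  multiply.\<close>

lemma card_all_squares_dvd:
  fixes T :: "'a::{field,finite} poly set"
  assumes T: "finite T" "T \<subseteq> monic_irreducibles" and m: "(\<Sum>P\<in>T. 2 * degree P) \<le> m"
  shows "real (card {a \<in> polys_lt m. \<forall>P\<in>T. P\<^sup>2 dvd poly f a}) =
    real CARD('a) ^ m * (\<Prod>P\<in>T. sq_density f P)"
proof -
  let ?M = "\<Prod>P\<in>T. P\<^sup>2"
  note M = prod_squares_monic_irreducibles[OF T]
  define q where "q = real CARD('a)"
  have "q > 0" by (simp add: q_def)
  have "{a \<in> polys_lt m. \<forall>P\<in>T. P\<^sup>2 dvd poly f a} = {a \<in> polys_lt m. a mod ?M \<in> zeros_mod f ?M}"
    using M(1,3) by (simp add: mod_in_zeros_mod_iff)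
  then have "card {a \<in> polys_lt m. \<forall>P\<in>T. P\<^sup>2 dvd poly f a} =
      (\<Prod>P\<in>T. rho f (P\<^sup>2)) * CARD('a) ^ (m - degree ?M)"
    using card_mod_in[OF M(3), of m "zeros_mod f ?M"] m M(2,4) by (simp add: zeros_mod_def)
  then have "real (card {a \<in> polys_lt m. \<forall>P\<in>T. P\<^sup>2 dvd poly f a}) =
      (\<Prod>P\<in>T. real (rho f (P\<^sup>2))) * q ^ (m - degree ?M)" by (simp add: q_def)
  also have "q ^ (m - degree ?M) = q ^ m / q ^ degree ?M"
    using m M(4) \<open>q > 0\<close> by (simp add: power_diff)
  also have "q ^ degree ?M = (\<Prod>P\<in>T. (pnorm P)\<^sup>2)"
    unfolding M(4) power_sum by (simp add: pnorm_def q_def power_mult[symmetric] mult.commute)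
  finally show ?thesis by (simp add: sq_density_def prod_dividef q_def)
qed

section \<open>Truncated inclusion-exclusion\<close>

lemma sum_subsets_insert:
  assumes "finite A" "x \<notin> A"
  shows "(\<Sum>T | T \<subseteq> insert x A \<and> Q (card T). h T) =
    (\<Sum>T | T \<subseteq> A \<and> Q (card T). h T) + (\<Sum>T | T \<subseteq> A \<and> Q (Suc (card T)). h (insert x T) :: real)"
proof -
  have card: "card (insert x T) = Suc (card T)" if "T \<subseteq> A" for T
    using that assms finite_subset by (metis card_insert_disjoint subsetD)
  have eq: "{T. T \<subseteq> insert x A \<and> Q (card T)} =
      {T. T \<subseteq> A \<and> Q (card T)} \<union> insert x ` {T. T \<subseteq> A \<and> Q (Suc (card T))}"
  proof (intro set_eqI iffI)
    fix T assume T: "T \<in> {T. T \<subseteq> insert x A \<and> Q (card T)}"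
    show "T \<in> {T. T \<subseteq> A \<and> Q (card T)} \<union> insert x ` {T. T \<subseteq> A \<and> Q (Suc (card T))}"
    proof (cases "x \<in> T")
      case True
      then have "T = insert x (T - {x})" "T - {x} \<subseteq> A" using T by auto
      moreover from this have "Q (Suc (card (T - {x})))" using T card by (metis mem_Collect_eq)
      ultimately show ?thesis by blast
    qed (use T in auto)
  qed (use card in auto)
  have inj: "inj_on (insert x) {T. T \<subseteq> A \<and> Q (Suc (card T))}"
  proof (rule inj_onI)
    fix S T assume "S \<in> {T. T \<subseteq> A \<and> Q (Suc (card T))}" "T \<in> {T. T \<subseteq> A \<and> Q (Suc (card T))}"
      and eq: "insert x S = insert x T"
    then have "x \<notin> S" "x \<notin> T" using assms(2) by auto
    then show "S = T" using eq by (metis insert_ident)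
  qed
  show ?thesis
    unfolding eq using assms
    by (subst sum.union_disjoint) (auto simp: sum.reindex[OF inj])
qed

text \<open>Inserting \<open>y\<close> turns the truncated sum \<open>E r\<close> into
  \<open>E r - g y * E (r - 1)\<close> and the error \<open>e r\<close> into
  \<open>e r + g y * e (r - 1)\<close>, so the triangle inequality carries the induction. Weights in
  the unit interval, rather than indicators, let it serve both the single points \<open>a\<close>
  and the densities.\<close>

lemma bonferroni:
  fixes g :: "'b \<Rightarrow> real"
  assumes "finite A" "\<And>x. x \<in> A \<Longrightarrow> 0 \<le> g x \<and> g x \<le> 1"
  shows "\<bar>(\<Prod>x\<in>A. 1 - g x) - (\<Sum>T | T \<subseteq> A \<and> card T < r. (-1) ^ card T * (\<Prod>x\<in>T. g x))\<bar>
    \<le> (\<Sum>T | T \<subseteq> A \<and> card T = r. \<Prod>x\<in>T. g x)"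
  using assms
proof (induction A arbitrary: r rule: finite_induct)
  case empty
  have "{T :: 'b set. T \<subseteq> {} \<and> card T < r} = (if r = 0 then {} else {{}})"
    "{T :: 'b set. T \<subseteq> {} \<and> card T = r} = (if r = 0 then {{}} else {})" by auto
  then show ?case by (simp only:) simp
next
  case (insert y A)
  have y: "0 \<le> g y" "g y \<le> 1" using insert.prems by auto
  have g: "0 \<le> g x \<and> g x \<le> 1" if "x \<in> A" for x using insert.prems that by auto
  show ?case
  proof (cases r)
    case 0
    have "{T. T \<subseteq> insert y A \<and> card T = 0} = {{}}"
    proof (intro set_eqI iffI)
      fix T assume T: "T \<in> {T. T \<subseteq> insert y A \<and> card T = 0}"
      then have "finite T" using insert.hyps finite_subset by blast
      then show "T \<in> {{}}" using T by simp
    qed auto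
    moreover have "0 \<le> (\<Prod>x\<in>insert y A. 1 - g x)" using insert.prems by (intro prod_nonneg) auto
    moreover have "(\<Prod>x\<in>insert y A. 1 - g x) \<le> 1" using insert.prems by (intro prod_le_1) auto
    ultimately show ?thesis using 0 by simp
  next
    case (Suc s)
    define V0 where "V0 = (\<Prod>x\<in>A. 1 - g x)"
    define E where "E r = (\<Sum>T | T \<subseteq> A \<and> card T < r. (-1) ^ card T * (\<Prod>x\<in>T. g x))" for r
    define e where "e r = (\<Sum>T | T \<subseteq> A \<and> card T = r. \<Prod>x\<in>T. g x)" for r
    have fin: "finite T \<and> y \<notin> T" if "T \<subseteq> A" for T using that insert.hyps finite_subset by blast
    have 1: "(\<Sum>T | T \<subseteq> insert y A \<and> card T < r. (-1) ^ card T * (\<Prod>x\<in>T. g x)) = E r - g y * E s"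
    proof -
      have "(\<Sum>T | T \<subseteq> A \<and> Suc (card T) < r. (-1) ^ card (insert y T) * (\<Prod>x\<in>insert y T. g x)) =
          (\<Sum>T | T \<subseteq> A \<and> card T < s. - (g y * ((-1) ^ card T * (\<Prod>x\<in>T. g x))))"
        using Suc fin by (intro sum.cong) auto
      also have "\<dots> = - (g y * E s)" by (simp add: E_def sum_negf sum_distrib_left)
      finally show ?thesis
        using sum_subsets_insert[OF insert.hyps(1,2), where Q = "\<lambda>n. n < r"] by (simp add: E_def)
    qed
    have 2: "(\<Sum>T | T \<subseteq> insert y A \<and> card T = r. \<Prod>x\<in>T. g x) = e r + g y * e s"
    proof -
      have "(\<Sum>T | T \<subseteq> A \<and> Suc (card T) = r. (\<Prod>x\<in>insert y T. g x)) =
          (\<Sum>T | T \<subseteq> A \<and> card T = s. g y * (\<Prod>x\<in>T. g x))"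
        using Suc fin by (intro sum.cong) auto
      also have "\<dots> = g y * e s" by (simp add: e_def sum_distrib_left)
      finally show ?thesis
        using sum_subsets_insert[OF insert.hyps(1,2), where Q = "\<lambda>n. n = r"] by (simp add: e_def)
    qed
    have IH: "\<bar>V0 - E r\<bar> \<le> e r" for r unfolding V0_def E_def e_def using g by (intro insert.IH) auto
    have "(\<Prod>x\<in>insert y A. 1 - g x) - (E r - g y * E s) = (V0 - E r) - g y * (V0 - E s)"
      using insert.hyps by (simp add: V0_def algebra_simps)
    also have "\<bar>\<dots>\<bar> \<le> \<bar>V0 - E r\<bar> + \<bar>g y * (V0 - E s)\<bar>" by (rule abs_triangle_ineq4)
    also have "\<dots> = \<bar>V0 - E r\<bar> + g y * \<bar>V0 - E s\<bar>" using y by (simp add: abs_mult)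
    also have "\<dots> \<le> e r + g y * e s" using IH y by (intro add_mono mult_left_mono) auto
    finally show ?thesis unfolding 1 2 .
  qed
qed

text \<open>Rankin's trick: weighting each subset by \<open>z ^ card T\<close> with
  \<open>z = exp 1\<close> allows the sum to be extended to all subsets, where it factors. The 3 is
  an upper bound for \<open>exp 1\<close>.\<close>

lemma elementary_symmetric_le:
  fixes g :: "'b \<Rightarrow> real"
  assumes "finite A" "\<And>x. x \<in> A \<Longrightarrow> 0 \<le> g x"
  shows "(\<Sum>T | T \<subseteq> A \<and> card T = r. \<Prod>x\<in>T. g x) \<le> exp (3 * (\<Sum>x\<in>A. g x) - real r)"
proof -
  define z where "z = exp (1::real)"
  have z: "z > 0" "z \<le> 3" using exp_le by (auto simp: z_def)
  have "z ^ r * (\<Sum>T | T \<subseteq> A \<and> card T = r. \<Prod>x\<in>T. g x) = (\<Sum>T | T \<subseteq> A \<and> card T = r. \<Prod>x\<in>T. z * g x)"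
    unfolding sum_distrib_left by (intro sum.cong) (auto simp: prod.distrib)
  also have "\<dots> \<le> (\<Sum>T\<in>Pow A. \<Prod>x\<in>T. z * g x)"
    using assms z by (intro sum_mono2) (auto intro!: prod_nonneg)
  also have "\<dots> = (\<Prod>x\<in>A. z * g x + 1)" using prod_add[OF assms(1), of "\<lambda>x. z * g x" "\<lambda>_. 1"] by simp
  also have "\<dots> \<le> (\<Prod>x\<in>A. exp (3 * g x))"
  proof (rule prod_mono)
    fix x assume "x \<in> A"
    then have "z * g x + 1 \<le> 1 + 3 * g x" "0 \<le> z * g x" using assms z by (auto intro: mult_right_mono)
    then show "0 \<le> z * g x + 1 \<and> z * g x + 1 \<le> exp (3 * g x)"
      using exp_ge_add_one_self[of "3 * g x"] by linarith
  qed
  also have "\<dots> = exp (3 * (\<Sum>x\<in>A. g x))" using assms(1) by (simp add: exp_sum sum_distrib_left)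
  finally have "(\<Sum>T | T \<subseteq> A \<and> card T = r. \<Prod>x\<in>T. g x) \<le> exp (3 * (\<Sum>x\<in>A. g x)) / z ^ r"
    using z by (simp add: pos_le_divide_eq mult.commute)
  also have "z ^ r = exp (real r)" by (simp add: z_def exp_of_nat_mult[symmetric])
  finally show ?thesis by (simp add: exp_diff)
qed

lemma sq_density_bounds:
  assumes "P \<in> monic_irreducibles"
  shows "0 \<le> sq_density f P" "sq_density f P \<le> 1"
proof -
  have "P\<^sup>2 \<noteq> 0" using monic_irreducibleD(3)[OF assms] by simp
  moreover have "pnorm (P\<^sup>2) = (pnorm P)\<^sup>2"
    using monic_irreducibleD[OF assms] by (simp add: pnorm_def power_mult[symmetric] mult.commute)
  ultimately show "0 \<le> sq_density f P" "sq_density f P \<le> 1"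
    using rho_le[of "P\<^sup>2" f] by (auto simp: sq_density_def divide_le_eq_1 pnorm_def)
qed

text \<open>The truncated expansion is applied to the indicators at each \<open>a\<close> and to the
  densities. At most \<open>r\<close> squares of degree at most \<open>2 * y\<close> occur in a
  term, so the two main sums agree exactly after summation over \<open>a\<close>; the two tails
  account for the factor 2.\<close>

lemma brun_sieve:
  fixes A :: "'a::{field,finite} poly set"
  assumes A: "finite A" "A \<subseteq> monic_irreducibles" and y: "\<And>P. P \<in> A \<Longrightarrow> degree P \<le> y"
    and m: "2 * y * r \<le> m"
  shows "\<bar>real (card {a \<in> polys_lt m. \<forall>P\<in>A. \<not> P\<^sup>2 dvd poly f a})
      - real CARD('a) ^ m * (\<Prod>P\<in>A. 1 - sq_density f P)\<bar>
    \<le> 2 * real CARD('a) ^ m * exp (3 * (\<Sum>P\<in>A. sq_density f P) - real r)"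
proof -
  let ?X = "polys_lt m :: 'a poly set"
  define q where "q = real CARD('a)"
  define g where "g = sq_density f"
  define E where "E = (\<Sum>T | T \<subseteq> A \<and> card T < r. (-1) ^ card T * (\<Prod>P\<in>T. g P))"
  define e where "e = (\<Sum>T | T \<subseteq> A \<and> card T = r. \<Prod>P\<in>T. g P)"
  define ind where "ind a P = (of_bool (P\<^sup>2 dvd poly f a) :: real)" for a and P :: "'a poly"
  have finX: "finite ?X" by (rule card_polys_lt)
  have indp: "(\<Prod>P\<in>T. ind a P) = (of_bool (\<forall>P\<in>T. P\<^sup>2 dvd poly f a) :: real)" if "finite T" for T a
    using that by (induction T rule: finite_induct) (auto simp: ind_def)
  have indp': "(\<Prod>P\<in>T. 1 - ind a P) = (of_bool (\<forall>P\<in>T. \<not> P\<^sup>2 dvd poly f a) :: real)" if "finite T" for T a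
    using that by (induction T rule: finite_induct) (auto simp: ind_def)
  have sumT: "(\<Sum>a\<in>?X. \<Prod>P\<in>T. ind a P) = q ^ m * (\<Prod>P\<in>T. g P)" if T: "T \<subseteq> A" "card T \<le> r" for T
  proof -
    have fin: "finite T" using T A finite_subset by blast
    have "(\<Sum>P\<in>T. 2 * degree P) \<le> (\<Sum>P\<in>T. 2 * y)" using T y by (intro sum_mono) auto
    also have "\<dots> = card T * (2 * y)" by simp
    also have "\<dots> \<le> r * (2 * y)" using T by (intro mult_right_mono) auto
    finally have "(\<Sum>P\<in>T. 2 * degree P) \<le> m" using m by (simp add: mult_ac)
    then have "real (card {a \<in> ?X. \<forall>P\<in>T. P\<^sup>2 dvd poly f a}) = q ^ m * (\<Prod>P\<in>T. g P)"
      using card_all_squares_dvd[OF fin] T A by (simp add: q_def g_def)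
    moreover have "(\<Sum>a\<in>?X. \<Prod>P\<in>T. ind a P) = real (card {a \<in> ?X. \<forall>P\<in>T. P\<^sup>2 dvd poly f a})"
      using finX indp[OF fin] by (simp add: of_bool_def sum.If_cases Int_def)
    ultimately show ?thesis by simp
  qed
  define Ea where "Ea a = (\<Sum>T | T \<subseteq> A \<and> card T < r. (-1) ^ card T * (\<Prod>P\<in>T. ind a P))" for a
  define ea where "ea a = (\<Sum>T | T \<subseteq> A \<and> card T = r. \<Prod>P\<in>T. ind a P)" for a
  have "(\<Sum>a\<in>?X. Ea a) = (\<Sum>T | T \<subseteq> A \<and> card T < r. (-1) ^ card T * (\<Sum>a\<in>?X. \<Prod>P\<in>T. ind a P))"
    unfolding Ea_def by (subst sum.swap) (simp add: sum_distrib_left)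
  also have "\<dots> = (\<Sum>T | T \<subseteq> A \<and> card T < r. (-1) ^ card T * (q ^ m * (\<Prod>P\<in>T. g P)))"
    using sumT by (intro sum.cong) auto
  also have "\<dots> = q ^ m * E" by (simp add: E_def sum_distrib_left mult_ac)
  finally have sumE: "(\<Sum>a\<in>?X. Ea a) = q ^ m * E" .
  have "(\<Sum>a\<in>?X. ea a) = (\<Sum>T | T \<subseteq> A \<and> card T = r. (\<Sum>a\<in>?X. \<Prod>P\<in>T. ind a P))"
    unfolding ea_def by (subst sum.swap) simp
  also have "\<dots> = (\<Sum>T | T \<subseteq> A \<and> card T = r. (q ^ m * (\<Prod>P\<in>T. g P)))"
    using sumT by (intro sum.cong) auto
  also have "\<dots> = q ^ m * e" by (simp add: e_def sum_distrib_left)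
  finally have sume: "(\<Sum>a\<in>?X. ea a) = q ^ m * e" .
  have cardeq: "real (card {a \<in> ?X. \<forall>P\<in>A. \<not> P\<^sup>2 dvd poly f a}) = (\<Sum>a\<in>?X. \<Prod>P\<in>A. 1 - ind a P)"
    using finX indp'[OF A(1)] by (simp add: of_bool_def sum.If_cases Int_def)
  have "\<bar>(\<Sum>a\<in>?X. \<Prod>P\<in>A. 1 - ind a P) - (\<Sum>a\<in>?X. Ea a)\<bar> \<le> (\<Sum>a\<in>?X. \<bar>(\<Prod>P\<in>A. 1 - ind a P) - Ea a\<bar>)"
    unfolding sum_subtractf[symmetric] by (rule sum_abs)
  also have "\<dots> \<le> (\<Sum>a\<in>?X. ea a)"
    unfolding Ea_def ea_def by (intro sum_mono bonferroni A) (simp add: ind_def)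
  finally have 1: "\<bar>(\<Sum>a\<in>?X. \<Prod>P\<in>A. 1 - ind a P) - q ^ m * E\<bar> \<le> q ^ m * e" unfolding sumE sume .
  have g: "0 \<le> g P \<and> g P \<le> 1" if "P \<in> A" for P
    using sq_density_bounds[of P f] subsetD[OF A(2) that] by (simp add: g_def)
  have "\<bar>(\<Prod>P\<in>A. 1 - g P) - E\<bar> \<le> e" unfolding E_def e_def using A g by (intro bonferroni) auto
  then have "q ^ m * \<bar>(\<Prod>P\<in>A. 1 - g P) - E\<bar> \<le> q ^ m * e" by (intro mult_left_mono) (auto simp: q_def)
  moreover have "q ^ m * \<bar>(\<Prod>P\<in>A. 1 - g P) - E\<bar> = \<bar>q ^ m * (\<Prod>P\<in>A. 1 - g P) - q ^ m * E\<bar>"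
    by (simp add: right_diff_distrib[symmetric] abs_mult q_def)
  moreover have "q ^ m * e \<le> q ^ m * exp (3 * (\<Sum>P\<in>A. g P) - real r)"
    unfolding e_def using A g by (intro mult_left_mono elementary_symmetric_le) (auto simp: q_def)
  ultimately have "\<bar>(\<Sum>a\<in>?X. \<Prod>P\<in>A. 1 - ind a P) - q ^ m * (\<Prod>P\<in>A. 1 - g P)\<bar>
      \<le> 2 * q ^ m * exp (3 * (\<Sum>P\<in>A. g P) - real r)" using 1 by linarith
  then show ?thesis unfolding cardeq by (simp add: g_def q_def)
qed

section \<open>Sums over monic irreducible polynomials\<close>

definition irreds_le :: "nat \<Rightarrow> 'a::field poly set" where
  "irreds_le N = {P \<in> monic_irreducibles. degree P \<le> N}"

lemma finite_irreds_le: "finite (irreds_le N :: 'a::{field,finite} poly set)"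
proof (rule finite_subset)
  show "irreds_le N \<subseteq> (polys_lt (Suc N) :: 'a poly set)" by (auto simp: irreds_le_def polys_lt_iff)
qed (rule card_polys_lt)

text \<open>Count the pairs \<open>P dvd D\<close> with \<open>D\<close> monic of degree \<open>N\<close>, weighted by \<open>deg P\<close>.\<close>

lemma sum_degree_over_pnorm_le:
  "(\<Sum>P\<in>(irreds_le N :: 'a::{field,finite} poly set). real (degree P) / pnorm P) \<le> real N"
proof -
  let ?I = "irreds_le N :: 'a poly set" and ?X = "polys_lt N :: 'a poly set"
  define q where "q = real CARD('a)"
  have q: "q > 0" by (simp add: q_def)
  \<comment> \<open>Monic polynomials of degree \<open>N\<close> are parametrised by their lower
    part, so that counts over \<open>polys_lt\<close> apply.\<close>
  define D where "D a = monom 1 N + a" for a :: "'a poly"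
  have finX: "finite ?X" by (rule card_polys_lt)
  have cnt: "real (card {a \<in> ?X. P dvd D a}) = q ^ N / pnorm P" if "P \<in> ?I" for P
  proof -
    have P: "P \<in> monic_irreducibles" "degree P \<le> N" using that by (auto simp: irreds_le_def)
    note PD = monic_irreducibleD[OF P(1)]
    define s where "s = (- monom 1 N) mod P"
    have s: "{s} \<subseteq> polys_lt (degree P)" using mod_in_polys_lt[OF PD(3)] unfolding s_def by blast
    have "P dvd D a \<longleftrightarrow> a mod P \<in> {s}" for a
      using mod_eq_dvd_iff[of a P "- monom 1 N"]
      by (simp only: D_def s_def singleton_iff diff_minus_eq_add add.commute)
    then have "{a \<in> ?X. P dvd D a} = {a \<in> ?X. a mod P \<in> {s}}" by blast
    then have "card {a \<in> ?X. P dvd D a} = CARD('a) ^ (N - degree P)"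
      using card_mod_in[OF PD(3) P(2) s] by simp
    then have "real (card {a \<in> ?X. P dvd D a}) = q ^ (N - degree P)" by (simp add: q_def)
    then show ?thesis using P(2) q unfolding pnorm_def q_def[symmetric] by (simp add: power_diff)
  qed
  have le: "(\<Sum>P\<in>?I. of_bool (P dvd D a) * real (degree P)) \<le> real N" if "a \<in> ?X" for a
  proof -
    have "degree (D a) = N" "D a \<noteq> 0"
    proof -
      have "coeff (D a) N = 1" using that by (simp add: D_def polys_lt_def)
      then show "D a \<noteq> 0" by auto
      have "degree (D a) \<le> N"
        using that by (intro degree_le) (auto simp: D_def polys_lt_def)
      moreover have "N \<le> degree (D a)" using \<open>coeff (D a) N = 1\<close> by (intro le_degree) simp
      ultimately show "degree (D a) = N" by simp
    qed
    have "(\<Sum>P\<in>?I. of_bool (P dvd D a) * degree P) = (\<Sum>P | P \<in> ?I \<and> P dvd D a. degree P)"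
      unfolding sum.inter_filter[OF finite_irreds_le] by (intro sum.cong) auto
    also have "\<dots> \<le> (\<Sum>P | P \<in> monic_irreducibles \<and> P dvd D a. degree P)"
      using monic_irreducible_divisors(1)[OF \<open>D a \<noteq> 0\<close>]
      by (intro sum_mono2) (auto simp: irreds_le_def)
    also have "\<dots> \<le> N" using monic_irreducible_divisors(2)[OF \<open>D a \<noteq> 0\<close>] \<open>degree (D a) = N\<close> by simp
    finally have "real (\<Sum>P\<in>?I. of_bool (P dvd D a) * degree P) \<le> real N" by (rule of_nat_mono)
    then show ?thesis by simp
  qed
  have "q ^ N * (\<Sum>P\<in>?I. real (degree P) / pnorm P) = (\<Sum>P\<in>?I. real (degree P) * real (card {a \<in> ?X. P dvd D a}))"
    using cnt by (simp add: sum_distrib_left mult.commute)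
  also have "\<dots> = (\<Sum>P\<in>?I. \<Sum>a\<in>?X. of_bool (P dvd D a) * real (degree P))"
    using finX by (intro sum.cong refl)
      (simp add: of_bool_def sum.If_cases Int_def sum_distrib_right[symmetric])
  also have "\<dots> = (\<Sum>a\<in>?X. \<Sum>P\<in>?I. of_bool (P dvd D a) * real (degree P))" by (rule sum.swap)
  also have "\<dots> \<le> (\<Sum>a\<in>?X. real N)" using le by (intro sum_mono)
  also have "\<dots> = q ^ N * real N" by (simp add: card_polys_lt q_def)
  finally show ?thesis using q by simp
qed

text \<open>A weak Mertens estimate by dyadic blocks: where the degree exceeds \<open>2 ^ i\<close>,
  the weight \<open>degree P / 2 ^ i\<close> is at least one, so the block up to
  \<open>2 ^ Suc i\<close> contributes at most 2.\<close>

lemma sum_inverse_pnorm_le: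
  "(\<Sum>P\<in>(irreds_le (2 ^ i) :: 'a::{field,finite} poly set). 1 / pnorm P) \<le> 2 * real i + 1"
proof (induction i)
  case 0
  have "(\<Sum>P\<in>(irreds_le 1 :: 'a poly set). 1 / pnorm P) = (\<Sum>P\<in>(irreds_le 1 :: 'a poly set). real (degree P) / pnorm P)"
  proof (rule sum.cong)
    fix P :: "'a poly" assume "P \<in> irreds_le 1"
    then have "degree P = 1" using monic_irreducibleD(4)[of P] by (simp add: irreds_le_def)
    then show "1 / pnorm P = real (degree P) / pnorm P" by simp
  qed simp
  then show ?case using sum_degree_over_pnorm_le[of 1, where 'a='a] by simp
next
  case (Suc i)
  let ?A = "irreds_le (2 ^ i) :: 'a poly set" and ?B = "irreds_le (2 ^ Suc i) :: 'a poly set"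
  have pos: "pnorm P > 0" for P :: "'a poly" by (simp add: pnorm_def)
  have sub: "?A \<subseteq> ?B" by (auto simp: irreds_le_def)
  have "(\<Sum>P\<in>?B - ?A. 1 / pnorm P) \<le> (\<Sum>P\<in>?B - ?A. real (degree P) / pnorm P / 2 ^ i)"
  proof (rule sum_mono)
    fix P assume "P \<in> ?B - ?A"
    then have "2 ^ i \<le> degree P" by (auto simp: irreds_le_def)
    then have "real (2 ^ i) \<le> real (degree P)" by (rule of_nat_mono)
    then show "1 / pnorm P \<le> real (degree P) / pnorm P / 2 ^ i" using pos[of P] by (simp add: field_simps)
  qed
  also have "\<dots> \<le> (\<Sum>P\<in>?B. real (degree P) / pnorm P / 2 ^ i)"
    using finite_irreds_le pos by (intro sum_mono2) (auto simp: less_imp_le)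
  also have "\<dots> = (\<Sum>P\<in>?B. real (degree P) / pnorm P) / 2 ^ i" by (simp add: sum_divide_distrib)
  also have "\<dots> \<le> real (2 ^ Suc i) / 2 ^ i"
    using sum_degree_over_pnorm_le[of "2 ^ Suc i", where 'a='a] by (intro divide_right_mono) auto
  also have "\<dots> = 2" by simp
  finally have "(\<Sum>P\<in>?B - ?A. 1 / pnorm P) \<le> 2" .
  moreover have "(\<Sum>P\<in>?B. 1 / pnorm P) = (\<Sum>P\<in>?B - ?A. 1 / pnorm P) + (\<Sum>P\<in>?A. 1 / pnorm P)"
    using sub finite_irreds_le by (rule sum.subset_diff)
  ultimately show ?case using Suc.IH by simp
qed

section \<open>Local densities\<close>

lemma prod_one_minus_ge:
  fixes g :: "'b \<Rightarrow> real"
  assumes "finite A" "\<And>x. x \<in> A \<Longrightarrow> 0 \<le> g x \<and> g x \<le> 1"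
  shows "1 - (\<Sum>x\<in>A. g x) \<le> (\<Prod>x\<in>A. 1 - g x)"
  using assms
proof (induction A rule: finite_induct)
  case (insert y A)
  have "(\<Prod>x\<in>A. 1 - g x) \<le> 1" using insert.prems by (intro prod_le_1) auto
  then have "g y * (\<Prod>x\<in>A. 1 - g x) \<le> g y" using insert.prems by (simp add: mult_left_le)
  then show ?case using insert by (simp add: algebra_simps)
qed simp

lemma CARD_field_ge_2: "2 \<le> CARD('a::{field,finite})"
proof -
  have "card {0, 1 :: 'a} \<le> CARD('a)" by (intro card_mono) auto
  then show ?thesis by simp
qed

lemma pnorm_ge: "1 \<le> pnorm P" "2 ^ degree P \<le> pnorm P" for P :: "'a::{field,finite} poly"
proof -
  show "2 ^ degree P \<le> pnorm P"
    using CARD_field_ge_2[where 'a='a] unfolding pnorm_def by (intro power_mono) auto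
  then show "1 \<le> pnorm P" using one_le_power[of "2::real" "degree P"] by linarith
qed

lemma sq_density_le:
  fixes f :: "'a::{field,finite} poly poly"
  assumes "squarefree f" "degree f \<le> k" "P \<in> monic_irreducibles"
  shows "sq_density f P \<le> k / pnorm P"
proof -
  have "rho f (P\<^sup>2) \<le> degree f * CARD('a) ^ degree P"
    using assms monic_irreducibleD(1) by (intro rho_square_le) auto
  also have "\<dots> \<le> k * CARD('a) ^ degree P" using assms by simp
  finally have "real (rho f (P\<^sup>2)) \<le> real (k * CARD('a) ^ degree P)" by (rule of_nat_mono)
  then have "real (rho f (P\<^sup>2)) \<le> k * pnorm P" by (simp add: pnorm_def)
  then have "sq_density f P \<le> k * pnorm P / (pnorm P)\<^sup>2"
    unfolding sq_density_def by (intro divide_right_mono) auto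
  then show ?thesis using pnorm_ge(1)[of P] by (simp add: power2_eq_square)
qed

text \<open>The numerator \<open>rho\<close> is an integer, so a density below one misses it by at
  least one unit of the denominator.\<close>

lemma sq_density_gap:
  fixes f :: "'a::{field,finite} poly poly"
  assumes "P \<in> monic_irreducibles" "sq_density f P \<noteq> 1"
  shows "sq_density f P \<le> 1 - 1 / (pnorm P)\<^sup>2"
proof -
  define N where "N = CARD('a) ^ (2 * degree P)"
  have N: "(pnorm P)\<^sup>2 = real N" by (simp add: pnorm_def N_def power_mult[symmetric] mult.commute)
  have "N > 0" by (simp add: N_def)
  have "real (rho f (P\<^sup>2)) / real N \<le> 1" "real (rho f (P\<^sup>2)) / real N \<noteq> 1"
    using sq_density_bounds(2)[OF assms(1), of f] assms(2) by (auto simp: sq_density_def N)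
  then have "rho f (P\<^sup>2) \<le> N" "rho f (P\<^sup>2) \<noteq> N" using \<open>N > 0\<close> by (auto simp: divide_le_eq_1)
  then have "real (rho f (P\<^sup>2)) \<le> real N - 1" by linarith
  then show ?thesis using \<open>N > 0\<close> by (simp add: sq_density_def N field_simps)
qed

lemma sum_inverse_pnorm_square_le:
  fixes F :: "'a::{field,finite} poly set"
  assumes "finite F" "F \<subseteq> monic_irreducibles" "\<And>P. P \<in> F \<Longrightarrow> y < degree P"
  shows "(\<Sum>P\<in>F. 1 / (pnorm P)\<^sup>2) \<le> 1 / real CARD('a) ^ y"
proof -
  define q where "q = real CARD('a)"
  have q: "q \<ge> 2" using CARD_field_ge_2[where 'a='a] by (simp add: q_def)
  \<comment> \<open>The subtracted term makes the geometric series inductive: degree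
    \<open>d\<close> contributes at most \<open>1 / q ^ d\<close>, by the trivial count of monic
    polynomials, and \<open>q\<close> being at least 2 lets the bound telescope.\<close>
  have "(\<Sum>P\<in>F. 1 / (pnorm P)\<^sup>2) \<le> 1 / q ^ y - 1 / q ^ (y + j)"
    if "finite F" "F \<subseteq> monic_irreducibles" "\<And>P. P \<in> F \<Longrightarrow> y < degree P \<and> degree P \<le> y + j" for F :: "'a poly set" and j
    using that
  proof (induction j arbitrary: F)
    case 0
    then have "F = {}" by fastforce
    then show ?case by simp
  next
    case (Suc j)
    define d where "d = y + Suc j"
    define G where "G = {P \<in> F. degree P = d}"
    have G: "finite G" "G \<subseteq> F" using Suc.prems by (auto simp: G_def)
    have "card G \<le> card (polys_lt d :: 'a poly set)"
    proof (rule card_inj_on_le[where f = "\<lambda>P. P - monom 1 d"])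
      show "(\<lambda>P. P - monom 1 d) ` G \<subseteq> polys_lt d"
      proof clarify
        fix P assume P: "P \<in> G"
        then have "coeff P d = 1" "degree P = d"
          using Suc.prems(2) by (auto simp: G_def monic_irreducibles_def)
        then show "P - monom 1 d \<in> polys_lt d"
          by (auto simp: polys_lt_def coeff_eq_0 le_less)
      qed
    qed (auto simp: card_polys_lt inj_on_def)
    then have cardG: "real (card G) \<le> q ^ d" unfolding card_polys_lt q_def using of_nat_mono by fastforce
    have "(\<Sum>P\<in>G. 1 / (pnorm P)\<^sup>2) = real (card G) * (1 / (q ^ d)\<^sup>2)"
      by (simp add: G_def pnorm_def q_def)
    also have "\<dots> \<le> q ^ d * (1 / (q ^ d)\<^sup>2)" using cardG by (intro mult_right_mono) auto
    also have "\<dots> = 1 / q ^ d" using q by (simp add: power2_eq_square)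
    finally have 1: "(\<Sum>P\<in>G. 1 / (pnorm P)\<^sup>2) \<le> 1 / q ^ d" .
    have 2: "(\<Sum>P\<in>F - G. 1 / (pnorm P)\<^sup>2) \<le> 1 / q ^ y - 1 / q ^ (y + j)"
    proof (rule Suc.IH)
      show "y < degree P \<and> degree P \<le> y + j" if "P \<in> F - G" for P
        using that Suc.prems(3)[of P] by (auto simp: G_def d_def)
    qed (use Suc.prems in auto)
    have "2 / q ^ d \<le> q / q ^ d" using q by (intro divide_right_mono) auto
    also have "\<dots> = 1 / q ^ (y + j)" using q by (simp add: d_def)
    finally have "2 / q ^ d \<le> 1 / q ^ (y + j)" .
    then have "1 / q ^ d + 1 / q ^ d \<le> 1 / q ^ (y + j)" by simp
    moreover have "(\<Sum>P\<in>F. 1 / (pnorm P)\<^sup>2) = (\<Sum>P\<in>F - G. 1 / (pnorm P)\<^sup>2) + (\<Sum>P\<in>G. 1 / (pnorm P)\<^sup>2)"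
      using G Suc.prems by (intro sum.subset_diff) auto
    ultimately show ?case using 1 2 unfolding d_def by linarith
  qed
  note * = this
  define N where "N = Max (insert 0 (degree ` F))"
  have "degree P \<le> N" if "P \<in> F" for P unfolding N_def using assms that by (intro Max_ge) auto
  then have "degree P \<le> y + N" if "P \<in> F" for P using that trans_le_add2 by blast
  then have "(\<Sum>P\<in>F. 1 / (pnorm P)\<^sup>2) \<le> 1 / q ^ y - 1 / q ^ (y + N)"
    using assms by (intro *) auto
  then show ?thesis using q unfolding q_def[symmetric] by (smt (verit) divide_nonneg_nonneg zero_le_power)
qed

text \<open>Outside the divisors of one eliminant the density is \<open>O(1/|P|\<^sup>2)\<close>.\<close>

lemma sum_sq_density_tail_le:
  fixes f :: "'a::{field,finite} poly poly"
  assumes f: "squarefree f" "degree f \<le> k" "tdeg_le f n"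
    and F: "finite F" "F \<subseteq> monic_irreducibles" "\<And>P. P \<in> F \<Longrightarrow> y < degree P"
  shows "(\<Sum>P\<in>F. sq_density f P) \<le> k * (1 + (real n + k) * 4 ^ k) / real CARD('a) ^ y"
proof -
  define q where "q = real CARD('a)"
  have q: "q \<ge> 2" using CARD_field_ge_2[where 'a='a] by (simp add: q_def)
  obtain U where U: "finite U" "card U \<le> k"
    "\<And>u. u \<notin> U \<Longrightarrow> \<exists>R. R \<noteq> 0 \<and> degree R \<le> (n + degree u) * 4 ^ k \<and>
      (\<forall>P a. P dvd poly f a \<longrightarrow> P dvd poly (dt f) a + u * poly (pderiv f) a \<longrightarrow> P dvd R)"
    using exists_eliminant[OF f] by blast
  \<comment> \<open>Among \<open>k + 1\<close> distinct monomials one avoids the at most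
    \<open>k\<close> bad values; its degree is at most \<open>k\<close>, which keeps the degree of
    the eliminant linear in \<open>n\<close>.\<close>
  have "\<not> (\<lambda>i. monom (1::'a) i) ` {..k} \<subseteq> U"
  proof
    assume "(\<lambda>i. monom (1::'a) i) ` {..k} \<subseteq> U"
    then have "card ((\<lambda>i. monom (1::'a) i) ` {..k}) \<le> card U" using U(1) by (intro card_mono)
    moreover have "inj_on (\<lambda>i. monom (1::'a) i) {..k}"
      by (rule inj_onI) (metis degree_monom_eq one_neq_zero)
    ultimately show False using U(2) by (simp add: card_image)
  qed
  then obtain i where i: "i \<le> k" "monom (1::'a) i \<notin> U" by blast
  define u where "u = monom (1::'a) i"
  have u: "u \<notin> U" "degree u \<le> k" using i by (auto simp: u_def degree_monom_eq)
  obtain R where R: "R \<noteq> 0" "degree R \<le> (n + degree u) * 4 ^ k"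
      "\<And>P a. P dvd poly f a \<Longrightarrow> P dvd poly (dt f) a + u * poly (pderiv f) a \<Longrightarrow> P dvd R"
    using U(3)[OF u(1)] by blast
  have degR: "degree R \<le> (n + k) * 4 ^ k" using R(2) u(2) by (meson add_le_mono1 le_trans mult_le_mono1 nat_add_left_cancel_le)
  define B where "B = {P \<in> F. P dvd R}"
  have B: "finite B" "B \<subseteq> F" using F by (auto simp: B_def)
  have "card B \<le> card {P \<in> monic_irreducibles. P dvd R}"
    using F monic_irreducible_divisors(1)[OF R(1)] by (intro card_mono) (auto simp: B_def)
  also have "\<dots> \<le> (n + k) * 4 ^ k"
    using monic_irreducible_divisors(3)[OF R(1)] degR by linarith
  finally have "real (card B) \<le> real ((n + k) * 4 ^ k)" by (rule of_nat_mono)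
  then have cardB: "real (card B) \<le> (real n + k) * 4 ^ k" by simp
  \<comment> \<open>For divisors of \<open>R\<close> only the weaker bound
    \<open>k / pnorm P\<close> is available, but there are at most \<open>degree R\<close> of
    them.\<close>
  have "(\<Sum>P\<in>B. sq_density f P) \<le> (\<Sum>P\<in>B. k / q ^ y)"
  proof (rule sum_mono)
    fix P assume "P \<in> B"
    then have P: "P \<in> monic_irreducibles" "y < degree P" using F B by auto
    have "sq_density f P \<le> k / pnorm P" using f P by (intro sq_density_le)
    also have "\<dots> \<le> k / q ^ y"
      using P q unfolding pnorm_def q_def[symmetric] by (intro divide_left_mono power_increasing) auto
    finally show "sq_density f P \<le> k / q ^ y" .
  qed
  also have "\<dots> \<le> (real n + k) * 4 ^ k * (k / q ^ y)"
    using cardB q by (simp only: sum_constant) (intro mult_right_mono, auto)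
  finally have 1: "(\<Sum>P\<in>B. sq_density f P) \<le> (real n + k) * 4 ^ k * (k / q ^ y)" .
  have "(\<Sum>P\<in>F - B. sq_density f P) \<le> (\<Sum>P\<in>F - B. k * (1 / (pnorm P)\<^sup>2))"
  proof (rule sum_mono)
    fix P assume "P \<in> F - B"
    then have P: "P \<in> monic_irreducibles" "\<not> P dvd R" using F by (auto simp: B_def)
    then have "rho f (P\<^sup>2) \<le> degree f"
      using R(3) f monic_irreducibleD(1) by (intro rho_square_le_good[of f P R u]) auto
    then have "real (rho f (P\<^sup>2)) \<le> real k" using f(2) by simp
    then show "sq_density f P \<le> k * (1 / (pnorm P)\<^sup>2)"
      unfolding sq_density_def by (simp add: divide_right_mono)
  qed
  also have "\<dots> = k * (\<Sum>P\<in>F - B. 1 / (pnorm P)\<^sup>2)" by (simp add: sum_distrib_left)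
  also have "\<dots> \<le> k * (1 / q ^ y)"
    using F unfolding q_def by (intro mult_left_mono sum_inverse_pnorm_square_le) auto
  finally have 2: "(\<Sum>P\<in>F - B. sq_density f P) \<le> k * (1 / q ^ y)" .
  have "(\<Sum>P\<in>F. sq_density f P) = (\<Sum>P\<in>F - B. sq_density f P) + (\<Sum>P\<in>B. sq_density f P)"
    using B F by (intro sum.subset_diff) auto
  also have "\<dots> \<le> k * (1 / q ^ y) + (real n + k) * 4 ^ k * (k / q ^ y)" using 1 2 by linarith
  also have "\<dots> = k * (1 + (real n + k) * 4 ^ k) / q ^ y"
    by (simp add: add_divide_distrib[symmetric] algebra_simps)
  finally show ?thesis unfolding q_def .
qed

section \<open>Lower bounds for products of local factors\<close>

lemma exp_minus_double_le:
  fixes x :: real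
  assumes "0 \<le> x" "x \<le> 1 / 2"
  shows "exp (- 2 * x) \<le> 1 - x"
proof -
  have "x * x \<le> x * (1 / 2)" using assms by (intro mult_left_mono) auto
  moreover have "- x - 2 * x\<^sup>2 \<le> ln (1 - x)" using assms by (intro ln_one_minus_pos_lower_bound)
  ultimately have "- 2 * x \<le> ln (1 - x)" by (simp add: power2_eq_square)
  then show ?thesis using assms by (subst (asm) ln_ge_iff) auto
qed

text \<open>Once \<open>degree P\<close> is at least \<open>2 * k\<close> the density is at most one
  half, where \<open>1 - x\<close> dominates \<open>exp (- 2 * x)\<close>. Fewer than
  \<open>2 * k\<close> leaves at most \<open>q ^ (2 * k)\<close> irreducibles, whose factors are at
  least \<open>1 / q ^ (4 * k)\<close> by the gap; so the constant depends on \<open>q\<close> and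
  \<open>k\<close> only.\<close>

lemma prod_sq_density_ge:
  fixes f :: "'a::{field,finite} poly poly" and k :: nat
  assumes f: "squarefree f" "degree f \<le> k" and A: "finite A" "A \<subseteq> monic_irreducibles"
    and ne: "\<And>P. P \<in> A \<Longrightarrow> sq_density f P \<noteq> 1"
  defines "q \<equiv> real CARD('a)"
  shows "(1 / q ^ (4 * k)) ^ (CARD('a) ^ (2 * k)) * exp (- 2 * (\<Sum>P\<in>A. sq_density f P))
    \<le> (\<Prod>P\<in>A. 1 - sq_density f P)"
proof -
  have q: "q \<ge> 2" using CARD_field_ge_2[where 'a='a] by (simp add: q_def)
  define c where "c = 1 / q ^ (4 * k)"
  have c: "0 < c" "c \<le> 1" using q by (auto simp: c_def one_le_power divide_le_eq_1)
  define B where "B = {P \<in> A. degree P < 2 * k}"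
  have "card B \<le> card (polys_lt (2 * k) :: 'a poly set)"
    by (intro card_mono card_polys_lt) (auto simp: B_def polys_lt_iff)
  then have B: "card B \<le> CARD('a) ^ (2 * k)" by (simp add: card_polys_lt)
  have term_ge: "(if P \<in> B then c else 1) * exp (- 2 * sq_density f P) \<le> 1 - sq_density f P" if "P \<in> A" for P
  proof (cases "P \<in> B")
    case True
    have P: "P \<in> monic_irreducibles" using that A by auto
    have "(pnorm P)\<^sup>2 = q ^ (2 * degree P)" by (simp add: pnorm_def q_def power_mult[symmetric] mult.commute)
    also have "\<dots> \<le> q ^ (4 * k)" using True q by (intro power_increasing) (auto simp: B_def)
    finally have "c \<le> 1 / (pnorm P)\<^sup>2" using pnorm_ge(1)[of P] q unfolding c_def
      by (intro divide_left_mono) auto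
    also have "\<dots> \<le> 1 - sq_density f P" using sq_density_gap[OF P ne[OF that]] by simp
    finally have "c \<le> 1 - sq_density f P" .
    moreover have "c * exp (- 2 * sq_density f P) \<le> c * 1"
      using c sq_density_bounds(1)[OF P, of f] by (intro mult_left_mono) auto
    ultimately show ?thesis using True by simp
  next
    case False
    have P: "P \<in> monic_irreducibles" using that A by auto
    have "2 * k \<le> degree P" using False that by (simp add: B_def)
    have "real (2 * k) \<le> 2 ^ (2 * k)" using of_nat_less_two_power[of "2 * k"] less_imp_le by blast
    also have "\<dots> \<le> 2 ^ degree P" using \<open>2 * k \<le> degree P\<close> by (intro power_increasing) auto
    also have "\<dots> \<le> pnorm P" by (rule pnorm_ge)
    finally have "k / pnorm P \<le> 1 / 2" using pnorm_ge(1)[of P] by (simp add: divide_le_eq)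
    then have "sq_density f P \<le> 1 / 2" using sq_density_le[OF f P] by linarith
    then show ?thesis using False exp_minus_double_le[of "sq_density f P"] sq_density_bounds(1)[OF P, of f] by simp
  qed
  have "c ^ (CARD('a) ^ (2 * k)) \<le> c ^ card B" using B c by (intro power_decreasing) auto
  also have "\<dots> = (\<Prod>P\<in>A. if P \<in> B then c else 1)"
    using A(1) by (simp add: prod.If_cases B_def Int_def conj_ac)
  finally have "c ^ (CARD('a) ^ (2 * k)) \<le> (\<Prod>P\<in>A. if P \<in> B then c else 1)" .
  then have "c ^ (CARD('a) ^ (2 * k)) * exp (- 2 * (\<Sum>P\<in>A. sq_density f P)) \<le>
      (\<Prod>P\<in>A. if P \<in> B then c else 1) * (\<Prod>P\<in>A. exp (- 2 * sq_density f P))"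
    unfolding sum_distrib_left exp_sum[OF A(1)] by (intro mult_right_mono prod_nonneg) auto
  also have "\<dots> = (\<Prod>P\<in>A. (if P \<in> B then c else 1) * exp (- 2 * sq_density f P))" by (simp add: prod.distrib)
  also have "\<dots> \<le> (\<Prod>P\<in>A. 1 - sq_density f P)"
    using term_ge c by (intro prod_mono) auto
  finally show ?thesis by (simp add: c_def)
qed

lemma c_const_bounds:
  fixes f :: "'a::{field,finite} poly poly" and k n y :: nat
  assumes f: "squarefree f" "degree f \<le> k" "tdeg_le f n"
  defines "V \<equiv> (\<Prod>P\<in>irreds_le y. 1 - sq_density f P)"
    and "\<tau> \<equiv> k * (1 + (real n + k) * 4 ^ k) / real CARD('a) ^ y"
  shows "V * (1 - \<tau>) \<le> c_const f" "c_const f \<le> V"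
proof -
  let ?A = "irreds_le y :: 'a poly set" and ?F = "finite_subsets_at_top (monic_irreducibles :: 'a poly set)"
  have Asub: "?A \<subseteq> monic_irreducibles" by (auto simp: irreds_le_def)
  have g: "0 \<le> sq_density f P \<and> sq_density f P \<le> 1" if "P \<in> monic_irreducibles" for P
    using sq_density_bounds[OF that] by blast
  have lim: "((\<lambda>F. \<Prod>P\<in>F. 1 - sq_density f P) \<longlongrightarrow> c_const f) ?F"
    using c_const_tendsto[of f] by (simp add: sq_density_def)
  have V0: "V \<ge> 0" unfolding V_def using g Asub by (intro prod_nonneg) auto
  have bounds: "V * (1 - \<tau>) \<le> (\<Prod>P\<in>F. 1 - sq_density f P) \<and> (\<Prod>P\<in>F. 1 - sq_density f P) \<le> V"
    if F: "finite F" "?A \<subseteq> F" "F \<subseteq> monic_irreducibles" for F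
  proof -
    let ?W = "\<Prod>P\<in>F - ?A. 1 - sq_density f P"
    have eq: "(\<Prod>P\<in>F. 1 - sq_density f P) = ?W * V"
      unfolding V_def using F by (intro prod.subset_diff)
    have gF: "0 \<le> sq_density f P \<and> sq_density f P \<le> 1" if "P \<in> F - ?A" for P using g F that by blast
    have "(\<Sum>P\<in>F - ?A. sq_density f P) \<le> \<tau>"
      unfolding \<tau>_def using f F by (intro sum_sq_density_tail_le) (auto simp: irreds_le_def)
    moreover have "1 - (\<Sum>P\<in>F - ?A. sq_density f P) \<le> ?W"
      using F gF by (intro prod_one_minus_ge) auto
    ultimately have "1 - \<tau> \<le> ?W" by linarith
    moreover have "?W \<le> 1" using gF by (intro prod_le_1) auto
    ultimately show ?thesis unfolding eq
      using mult_right_mono[of "1 - \<tau>" ?W V] mult_right_mono[of ?W 1 V] V0 by (simp add: mult.commute)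
  qed
  have ev: "eventually (\<lambda>F. finite F \<and> ?A \<subseteq> F \<and> F \<subseteq> monic_irreducibles) ?F"
    unfolding eventually_finite_subsets_at_top using finite_irreds_le Asub by (intro exI[of _ ?A]) auto
  show "V * (1 - \<tau>) \<le> c_const f"
    by (rule tendsto_lowerbound[OF lim]) (use ev bounds in \<open>auto elim!: eventually_mono\<close>)
  show "c_const f \<le> V"
    by (rule tendsto_upperbound[OF lim]) (use ev bounds in \<open>auto elim!: eventually_mono\<close>)
qed

text \<open>This settles the degenerate case: when a local factor of \<open>c_const f\<close>
  vanishes, a relative error bound demands that the count be exactly zero.\<close>

lemma no_squarefree_value_if_sq_density_eq_1:
  fixes f :: "'a::{field,finite} poly poly"
  assumes P: "P \<in> monic_irreducibles" and 1: "sq_density f P = 1"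
  shows "\<not> squarefree (poly f a)"
proof -
  note PD = monic_irreducibleD[OF P]
  have nz: "P\<^sup>2 \<noteq> 0" using PD by simp
  have "real (rho f (P\<^sup>2)) = (pnorm P)\<^sup>2" using 1 pnorm_ge(1)[of P] by (simp add: sq_density_def)
  also have "\<dots> = real (CARD('a) ^ degree (P\<^sup>2))"
    unfolding PD by (simp add: pnorm_def power_mult[symmetric] mult.commute)
  finally have "rho f (P\<^sup>2) = CARD('a) ^ degree (P\<^sup>2)" by (simp only: of_nat_eq_iff)
  then have "card (zeros_mod f (P\<^sup>2)) = card (polys_lt (degree (P\<^sup>2)) :: 'a poly set)"
    using rho_eq_card_zeros_mod[OF nz, of f] by (simp only: card_polys_lt)
  then have "zeros_mod f (P\<^sup>2) = polys_lt (degree (P\<^sup>2))"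
    by (intro card_subset_eq card_polys_lt) (auto simp: zeros_mod_def)
  then have "P\<^sup>2 dvd poly f a" using mod_in_polys_lt[OF nz] mod_in_zeros_mod_iff[OF nz] by blast
  then show ?thesis using squarefree_iff_monic_irreducibles P by blast
qed

lemma card_squarefree_values:
  fixes f :: "'a::{field,finite} poly poly" and m n k y r :: nat
  assumes f: "squarefree f" "degree f \<le> k" "tdeg_le f n" and m: "2 * y * r \<le> m"
  defines "q \<equiv> real CARD('a)" and "A \<equiv> irreds_le y :: 'a poly set"
    and "L \<equiv> card {a \<in> polys_lt m. \<exists>P\<in>monic_irreducibles. m \<le> 2 * degree P \<and> P\<^sup>2 dvd poly f a}"
  shows "\<bar>real (card {a \<in> polys_lt m. squarefree (poly f a)}) - q ^ m * (\<Prod>P\<in>A. 1 - sq_density f P)\<bar>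
    \<le> q ^ m * (2 * exp (3 * (\<Sum>P\<in>A. sq_density f P) - real r) +
         k * (1 + (real n + k) * 4 ^ k) / q ^ y) + real L"
proof -
  let ?X = "polys_lt m :: 'a poly set"
  have finX: "finite ?X" by (rule card_polys_lt)
  define N0 where "N0 = {a \<in> ?X. \<forall>P\<in>A. \<not> P\<^sup>2 dvd poly f a}"
  define N where "N = {a \<in> ?X. squarefree (poly f a)}"
  define M where "M = {P \<in> monic_irreducibles :: 'a poly set. y < degree P \<and> 2 * degree P < m}"
  define LX where "LX = {a \<in> ?X. \<exists>P\<in>monic_irreducibles. m \<le> 2 * degree P \<and> P\<^sup>2 dvd poly f a}"
  have "M \<subseteq> irreds_le m" by (auto simp: M_def irreds_le_def)
  then have finM: "finite M" using finite_irreds_le finite_subset by blast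
  have Asub: "A \<subseteq> monic_irreducibles" "finite A" using finite_irreds_le by (auto simp: A_def irreds_le_def)
  have sieve: "\<bar>real (card N0) - q ^ m * (\<Prod>P\<in>A. 1 - sq_density f P)\<bar>
      \<le> 2 * q ^ m * exp (3 * (\<Sum>P\<in>A. sq_density f P) - real r)"
    unfolding N0_def q_def using Asub m
    by (intro brun_sieve) (auto simp: A_def irreds_le_def)
  have "N \<subseteq> N0" using Asub by (auto simp: N_def N0_def squarefree_iff_monic_irreducibles)
  have "N0 - N \<subseteq> (\<Union>P\<in>M. {a \<in> ?X. P\<^sup>2 dvd poly f a}) \<union> LX"
  proof
    fix a assume a: "a \<in> N0 - N"
    then obtain P where P: "P \<in> monic_irreducibles" "P\<^sup>2 dvd poly f a"
      by (auto simp: N0_def N_def squarefree_iff_monic_irreducibles)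
    have "P \<notin> A" using a P by (auto simp: N0_def)
    then have "y < degree P" using P by (auto simp: A_def irreds_le_def)
    then show "a \<in> (\<Union>P\<in>M. {a \<in> ?X. P\<^sup>2 dvd poly f a}) \<union> LX"
      using a P by (cases "2 * degree P < m") (auto simp: M_def LX_def N0_def)
  qed
  then have "card (N0 - N) \<le> card ((\<Union>P\<in>M. {a \<in> ?X. P\<^sup>2 dvd poly f a}) \<union> LX)"
    by (rule card_mono[rotated]) (use finX finM in \<open>auto simp: LX_def\<close>)
  also have "\<dots> \<le> card (\<Union>P\<in>M. {a \<in> ?X. P\<^sup>2 dvd poly f a}) + card LX" by (rule card_Un_le)
  also have "card (\<Union>P\<in>M. {a \<in> ?X. P\<^sup>2 dvd poly f a}) \<le> (\<Sum>P\<in>M. card {a \<in> ?X. P\<^sup>2 dvd poly f a})"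
    using finM by (rule card_UN_le)
  finally have "real (card (N0 - N)) \<le> real ((\<Sum>P\<in>M. card {a \<in> ?X. P\<^sup>2 dvd poly f a}) + card LX)"
    by (intro of_nat_mono) simp
  also have "\<dots> = (\<Sum>P\<in>M. real (card {a \<in> ?X. P\<^sup>2 dvd poly f a})) + real (card LX)" by simp
  \<comment> \<open>Each square has degree below \<open>m\<close>, so a single divisibility
    condition is still counted exactly.\<close>
  also have "(\<Sum>P\<in>M. real (card {a \<in> ?X. P\<^sup>2 dvd poly f a})) = (\<Sum>P\<in>M. q ^ m * sq_density f P)"
  proof (rule sum.cong)
    fix P assume "P \<in> M"
    then show "real (card {a \<in> ?X. P\<^sup>2 dvd poly f a}) = q ^ m * sq_density f P"
      using card_all_squares_dvd[of "{P}" m f] by (simp add: M_def q_def)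
  qed simp
  also have "\<dots> = q ^ m * (\<Sum>P\<in>M. sq_density f P)" by (simp add: sum_distrib_left)
  also have "\<dots> \<le> q ^ m * (k * (1 + (real n + k) * 4 ^ k) / q ^ y)"
    unfolding q_def using f finM
    by (intro mult_left_mono sum_sq_density_tail_le) (auto simp: M_def)
  finally have diff: "real (card (N0 - N)) \<le> q ^ m * (k * (1 + (real n + k) * 4 ^ k) / q ^ y) + real L"
    by (simp add: LX_def L_def)
  have "finite N0" using finX by (simp add: N0_def)
  then have "real (card N0) = real (card N) + real (card (N0 - N))"
    using \<open>N \<subseteq> N0\<close> by (simp add: card_Diff_subset finite_subset card_mono of_nat_diff)
  then have "\<bar>real (card N) - q ^ m * (\<Prod>P\<in>A. 1 - sq_density f P)\<bar>
    \<le> 2 * q ^ m * exp (3 * (\<Sum>P\<in>A. sq_density f P) - real r) +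
      (q ^ m * (k * (1 + (real n + k) * 4 ^ k) / q ^ y) + real L)"
    using sieve diff by linarith
  then show ?thesis by (simp add: N_def algebra_simps)
qed

section \<open>Uniform asymptotics\<close>

lemma double_le_power2: "2 * d \<le> 2 ^ d" if "d > 0" for d :: nat
proof -
  obtain e where "d = Suc e" using \<open>d > 0\<close> by (cases d) auto
  moreover have "Suc e \<le> 2 ^ e" by (rule Suc_leI[OF less_exp])
  ultimately show ?thesis by simp
qed

text \<open>The exponent \<open>c\<close> is about \<open>m / p\<close>. Once \<open>p\<close> is at
  most \<open>i\<close>, the factor \<open>i + 1\<close> in the lower bound for \<open>m\<close>
  absorbs the division by \<open>p\<close>, so \<open>c\<close> remains well above
  \<open>2 ^ i\<close>, the scale of \<open>log n\<close>.\<close>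

lemma kernel_exponent_bounds:
  fixes m p i :: nat
  assumes "2 \<le> p" "p \<le> i" "2 ^ (i + 2) * (i + 1) \<le> m"
  defines "c \<equiv> (m - 1) div p + 1"
  shows "c + 2 ^ i \<le> m" "4 * 2 ^ i \<le> c" "m \<le> p * c"
proof -
  have "2 ^ (i + 2) * 1 \<le> 2 ^ (i + 2) * (i + 1)" by (intro mult_left_mono) auto
  then have m4: "4 * 2 ^ i \<le> m" using assms(3) by simp
  have "(1::nat) \<le> 2 ^ i" by simp
  have "m - 1 = p * ((m - 1) div p) + (m - 1) mod p" by simp
  moreover have "(m - 1) mod p < p" using assms(1) by simp
  ultimately have "m - 1 < p * c" unfolding c_def by (metis add_less_cancel_left distrib_left mult.right_neutral)
  then show le: "m \<le> p * c" by simp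
  have "p * (4 * 2 ^ i) \<le> (i + 1) * (4 * 2 ^ i)" using assms(2) by (intro mult_right_mono) auto
  also have "\<dots> \<le> p * c" using assms(3) le by (simp add: mult_ac)
  finally show "4 * 2 ^ i \<le> c" using assms(1) by simp
  have "c \<le> (m - 1) div 2 + 1" unfolding c_def using assms(1) by (simp add: div_le_mono2)
  then show "c + 2 ^ i \<le> m" using m4 \<open>1 \<le> 2 ^ i\<close> by linarith
qed

lemma large_square_divisors_negligible:
  fixes f :: "'a::{field,finite} poly poly" and m n k i :: nat
  assumes f: "squarefree f" "degree f \<le> k" "tdeg_le f n"
    and n: "n \<le> CARD('a) ^ (2 ^ i)" and p: "CHAR('a) \<le> i" and m: "2 ^ (i + 2) * (i + 1) \<le> m"
  defines "L \<equiv> card {a \<in> polys_lt m. \<exists>P\<in>monic_irreducibles. m \<le> 2 * degree P \<and> P\<^sup>2 dvd poly f a}"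
    and "q \<equiv> real CARD('a)"
  shows "real L \<le> q ^ m * ((k + k * 4 ^ k * (1 + real CHAR('a))) / q ^ (2 ^ i))"
proof -
  have q: "q \<ge> 2" using CARD_field_ge_2[where 'a='a] by (simp add: q_def)
  define c where "c = (m - 1) div CHAR('a) + 1"
  have p2: "2 \<le> CHAR('a)" using CHAR_finite_field_prime by (rule prime_ge_2_nat)
  note c = kernel_exponent_bounds[OF p2 p m, folded c_def]
  have "m > 0" using m by (cases m) auto
  \<comment> \<open>The exponent \<open>c\<close> is split: \<open>2 ^ i\<close> is kept as the
    saving, and \<open>d\<close> must absorb the factors \<open>n\<close> and \<open>m\<close>,
    using that \<open>n\<close> is at most \<open>q ^ (2 ^ i)\<close> and \<open>m\<close> at most
    \<open>p * 2 ^ d\<close>.\<close>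
  define d where "d = c - 2 ^ i"
  have d: "c = 2 ^ i + d" "2 ^ i \<le> d" "0 < d" "c \<le> 2 * d"
  proof -
    have "(1::nat) \<le> 2 ^ i" by simp
    then show "c = 2 ^ i + d" "2 ^ i \<le> d" "0 < d" "c \<le> 2 * d" using c(2) unfolding d_def by linarith+
  qed
  have "real L * q ^ c = real (L * CARD('a) ^ c)" by (simp add: q_def)
  also have "\<dots> \<le> real (k * CARD('a) ^ (2 * c) + k * (n + m) * 4 ^ k * CARD('a) ^ m)"
    using card_large_square_divisor[OF f \<open>m > 0\<close>] unfolding L_def c_def by (intro of_nat_mono)
  also have "\<dots> = k * (q ^ c * q ^ c) + k * (real n + m) * 4 ^ k * q ^ m"
    by (simp add: q_def mult_2 power_add)
  also have "\<dots> = (k * q ^ c + k * 4 ^ k * ((real n + m) * (q ^ m / q ^ c))) * q ^ c"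
  proof -
    have "q ^ c \<noteq> 0" using q by simp
    then show ?thesis by (simp add: field_simps)
  qed
  finally have "real L \<le> k * q ^ c + k * 4 ^ k * ((real n + m) * (q ^ m / q ^ c))"
    using q by (simp only: mult_le_cancel_right) auto
  also have "\<dots> = q ^ m * (k * (q ^ c / q ^ m) + k * 4 ^ k * (real n / q ^ c + real m / q ^ c))"
    using q by (simp add: field_simps)
  also have "\<dots> \<le> q ^ m * (k * (1 / q ^ (2 ^ i)) + k * 4 ^ k * (1 / q ^ (2 ^ i) + CHAR('a) / q ^ (2 ^ i)))"
  proof -
    have 1: "q ^ c / q ^ m \<le> 1 / q ^ (2 ^ i)"
    proof -
      have "q ^ c * q ^ (2 ^ i) \<le> q ^ m" unfolding power_add[symmetric] using c q by (intro power_increasing) auto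
      then show ?thesis using q by (simp add: field_simps)
    qed
    have 2: "real n / q ^ c \<le> 1 / q ^ (2 ^ i)"
    proof -
      have "real n \<le> q ^ (2 ^ i)" using of_nat_mono[OF n, where 'a=real] by (simp add: q_def)
      then have "real n * q ^ (2 ^ i) \<le> q ^ (2 ^ i) * q ^ d" using d q by (intro mult_mono power_increasing) auto
      then show ?thesis using q unfolding d(1) power_add by (simp add: field_simps)
    qed
    have 3: "real m / q ^ c \<le> CHAR('a) / q ^ (2 ^ i)"
    proof -
      have "c \<le> 2 ^ d" using d double_le_power2[of d] by linarith
      then have "m \<le> CHAR('a) * 2 ^ d" using c(3) by (meson le_trans mult_le_mono2)
      then have "real m \<le> real (CHAR('a) * 2 ^ d)" by (rule of_nat_mono)
      also have "\<dots> = real CHAR('a) * 2 ^ d" by simp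
      also have "\<dots> \<le> CHAR('a) * q ^ d" using q by (intro mult_left_mono power_mono) auto
      finally have "real m * q ^ (2 ^ i) \<le> CHAR('a) * q ^ d * q ^ (2 ^ i)" using q by (intro mult_right_mono) auto
      then show ?thesis using q unfolding d(1) power_add by (simp add: field_simps)
    qed
    show ?thesis using 1 2 3 q by (intro mult_left_mono add_mono) auto
  qed
  also have "\<dots> = q ^ m * ((k + k * 4 ^ k * (1 + real CHAR('a))) / q ^ (2 ^ i))"
    using q by (simp add: field_simps)
  finally show ?thesis .
qed

lemma error_term_tendsto_0:
  fixes c K A :: real
  shows "((\<lambda>i. (2 * exp (- (real i + 1)) + K * exp (A * (2 * real i + 3)) / 2 ^ (2 ^ i)) / c) \<longlongrightarrow> 0) sequentially"
proof -
  have 1: "((\<lambda>i. 2 * exp (- (real i + 1))) \<longlongrightarrow> 0) sequentially" by real_asymp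
  have lim: "((\<lambda>i. exp ((2 * real i + 3)\<^sup>2 - ln 2 * 2 ^ i)) \<longlongrightarrow> 0) sequentially" by real_asymp
  \<comment> \<open>Once \<open>i\<close> exceeds the absolute value of \<open>A\<close>, the linear
    exponent is below \<open>(2 * real i + 3)\<close> squared, a comparison free of the parameter
    \<open>A\<close>.\<close>
  have "eventually (\<lambda>i. real i \<ge> \<bar>A\<bar>) sequentially" by real_asymp
  then have "eventually (\<lambda>i. norm (exp (A * (2 * real i + 3)) / 2 ^ (2 ^ i)) \<le> exp ((2 * real i + 3)\<^sup>2 - ln 2 * 2 ^ i)) sequentially"
  proof (rule eventually_mono)
    fix i :: nat assume "\<bar>A\<bar> \<le> real i"
    then have "A * (2 * real i + 3) \<le> (2 * real i + 3) * (2 * real i + 3)"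
      by (intro mult_right_mono) auto
    moreover have "(2::real) ^ (2 ^ i) = exp (ln 2 * 2 ^ i)"
      by (metis exp_ln exp_of_nat2_mult of_nat_numeral of_nat_power zero_less_numeral)
    ultimately show "norm (exp (A * (2 * real i + 3)) / 2 ^ (2 ^ i)) \<le> exp ((2 * real i + 3)\<^sup>2 - ln 2 * 2 ^ i)"
      by (simp add: exp_diff[symmetric] power2_eq_square)
  qed
  then have 2: "((\<lambda>i. exp (A * (2 * real i + 3)) / 2 ^ (2 ^ i)) \<longlongrightarrow> 0) sequentially"
    by (rule Lim_null_comparison[OF _ lim])
  have "((\<lambda>i. (2 * exp (- (real i + 1)) + K * (exp (A * (2 * real i + 3)) / 2 ^ (2 ^ i))) / c) \<longlongrightarrow> (0 + K * 0) / c) sequentially"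
    unfolding divide_inverse[of _ c] by (intro tendsto_intros 1 2)
  then show ?thesis by simp
qed

lemma sum_sq_density_le:
  fixes f :: "'a::{field,finite} poly poly"
  assumes "squarefree f" "degree f \<le> k"
  shows "(\<Sum>P\<in>irreds_le (2 ^ i). sq_density f P) \<le> k * (2 * real i + 1)"
proof -
  have "(\<Sum>P\<in>irreds_le (2 ^ i). sq_density f P) \<le> (\<Sum>P\<in>(irreds_le (2 ^ i) :: 'a poly set). k * (1 / pnorm P))"
    using sq_density_le[OF assms] by (intro sum_mono) (auto simp: irreds_le_def)
  also have "\<dots> = k * (\<Sum>P\<in>(irreds_le (2 ^ i) :: 'a poly set). 1 / pnorm P)" by (simp add: sum_distrib_left)
  also have "\<dots> \<le> k * (2 * real i + 1)" using sum_inverse_pnorm_le by (intro mult_left_mono) auto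
  finally show ?thesis .
qed

text \<open>This is \<open>2 * y * r\<close> for the sieve range \<open>y = 2 ^ (i + 1)\<close> and
  the truncation \<open>r = (15 * k + 1) * (i + 1)\<close>.\<close>

definition sieve_threshold :: "nat \<Rightarrow> nat \<Rightarrow> nat" where
  "sieve_threshold k i = 2 ^ (i + 2) * ((15 * k + 1) * (i + 1))"

lemma squarefree_count_uniform:
  fixes k :: nat and \<epsilon> :: real
  assumes \<epsilon>: "\<epsilon> > 0"
  shows "\<exists>i0. \<forall>i\<ge>i0. \<forall>m n. \<forall>f :: 'a::{field,finite} poly poly.
    sieve_threshold k i \<le> m \<longrightarrow> n \<le> CARD('a) ^ (2 ^ i) \<longrightarrow> squarefree f \<longrightarrow> degree f \<le> k \<longrightarrow> tdeg_le f n \<longrightarrow>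
    \<bar>real (card {a \<in> polys_lt m. squarefree (poly f a)}) - c_const f * real CARD('a) ^ m\<bar>
      \<le> \<epsilon> * (c_const f * real CARD('a) ^ m)"
proof -
  define q where "q = real CARD('a)"
  have q: "q \<ge> 2" using CARD_field_ge_2[where 'a='a] by (simp add: q_def)
  define c where "c = (1 / q ^ (4 * k)) ^ (CARD('a) ^ (2 * k))"
  have c: "c > 0" using q by (simp add: c_def)
  define K1 where "K1 = real k * (1 + (1 + real k) * 4 ^ k)"
  define K2 where "K2 = real k + k * 4 ^ k * (1 + real CHAR('a))"
  have K: "K1 \<ge> 0" "K2 \<ge> 0" by (auto simp: K1_def K2_def)
  \<comment> \<open>The errors divided by the lower bound for \<open>V\<close>: dividing by
    \<open>c * exp (- 2 * S)\<close>, with \<open>S\<close> at most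
    \<open>k * (2 * real i + 3)\<close>, produces the exponential and the final \<open>/ c\<close>.
    In the first term the truncation has already absorbed the exponential.\<close>
  define \<eta> where "\<eta> i = (2 * exp (- (real i + 1)) + (K1 + K2) * exp (2 * k * (2 * real i + 3)) / 2 ^ (2 ^ i)) / c" for i
  have "(\<eta> \<longlongrightarrow> 0) sequentially" unfolding \<eta>_def by (rule error_term_tendsto_0)
  \<comment> \<open>The bound \<open>1 / 2\<close> gives \<open>V\<close> at most
    \<open>2 * c_const f\<close>. The errors of \<open>N\<close> against \<open>V\<close> and of
    \<open>V\<close> against \<open>c_const f\<close> are each at most \<open>\<eta> i * V\<close>
    after scaling, so twice two times a quarter yields \<open>\<epsilon>\<close>.\<close>
  moreover have "min (1 / 2) (\<epsilon> / 4) > 0" using \<epsilon> by simp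
  ultimately have "eventually (\<lambda>i. \<eta> i < min (1 / 2) (\<epsilon> / 4)) sequentially" by (rule order_tendstoD)
  then obtain i1 where i1: "\<And>i. i \<ge> i1 \<Longrightarrow> \<eta> i < min (1 / 2) (\<epsilon> / 4)" by (auto simp: eventually_sequentially)
  show ?thesis
  \<comment> \<open>The level must also reach the characteristic, for the estimate on fibres of the
    derivative.\<close>
  proof (intro exI[of _ "max i1 CHAR('a)"] allI impI)
    fix i m n :: nat and f :: "'a poly poly"
    assume i: "max i1 CHAR('a) \<le> i" and m: "sieve_threshold k i \<le> m" and n: "n \<le> CARD('a) ^ (2 ^ i)"
      and f: "squarefree f" "degree f \<le> k" "tdeg_le f n"
    define N where "N = card {a \<in> polys_lt m. squarefree (poly f a)}"
    \<comment> \<open>Twice \<open>2 ^ i\<close>: then \<open>q ^ y\<close> is the square of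
      \<open>q ^ (2 ^ i)\<close>, one factor absorbing \<open>n\<close> and the other remaining as
      the saving.\<close>
    define y where "y = (2::nat) ^ (i + 1)"
    define r where "r = (15 * k + 1) * (i + 1)"
    define A where "A = (irreds_le y :: 'a poly set)"
    define V where "V = (\<Prod>P\<in>A. 1 - sq_density f P)"
    define S where "S = (\<Sum>P\<in>A. sq_density f P)"
    define \<tau> where "\<tau> = k * (1 + (real n + k) * 4 ^ k) / q ^ y"
    define L where "L = card {a \<in> polys_lt m. \<exists>P\<in>monic_irreducibles. m \<le> 2 * degree P \<and> P\<^sup>2 dvd poly f a}"
    have Asub: "A \<subseteq> monic_irreducibles" "finite A"
      using finite_irreds_le by (auto simp: A_def irreds_le_def)
    have dens: "0 \<le> sq_density f P \<and> sq_density f P \<le> 1" if "P \<in> monic_irreducibles" for P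
      using sq_density_bounds[OF that] by blast
    have goal: "\<bar>real N - c_const f * q ^ m\<bar> \<le> \<epsilon> * (c_const f * q ^ m)"
    proof (cases "\<exists>P\<in>monic_irreducibles. sq_density f P = 1")
      case True
      then obtain P where P: "P \<in> monic_irreducibles" "sq_density f P = 1" by blast
      have "\<not> squarefree (poly f a)" for a using no_squarefree_value_if_sq_density_eq_1[OF P] .
      then have "N = 0" by (simp add: N_def)
      have "P \<in> irreds_le (degree P)" using P by (simp add: irreds_le_def)
      then have "(\<Prod>P\<in>irreds_le (degree P). 1 - sq_density f P) = 0"
        using P(2) finite_irreds_le by (intro prod_zero) auto
      then have "c_const f = 0" using c_const_bounds[OF f, of "degree P"] by simp
      then show ?thesis using \<open>N = 0\<close> by simp
    next
      case False
      have qL: "q ^ (2 ^ i) \<ge> 1" "2 ^ (2 ^ i) \<le> q ^ (2 ^ i)" "q ^ (2 ^ i) > 0"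
        using q by (auto intro: one_le_power power_mono)
      have nq: "real n \<le> q ^ (2 ^ i)" using of_nat_mono[OF n, where 'a=real] by (simp add: q_def)
      have qy: "q ^ y = q ^ (2 ^ i) * q ^ (2 ^ i)" by (simp add: y_def power_add[symmetric] mult_2)
      have \<tau>: "\<tau> \<le> K1 / q ^ (2 ^ i)"
      proof -
        have "1 + (real n + k) * 4 ^ k \<le> q ^ (2 ^ i) * (1 + (1 + real k) * 4 ^ k)"
        proof -
          have "real k * 1 \<le> real k * q ^ (2 ^ i)" using qL by (intro mult_left_mono) auto
          then have "real n + k \<le> q ^ (2 ^ i) * (1 + real k)" using nq by (simp add: algebra_simps)
          then have "(real n + k) * 4 ^ k \<le> q ^ (2 ^ i) * (1 + real k) * 4 ^ k" by (intro mult_right_mono) auto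
          then show ?thesis using qL by (simp add: algebra_simps)
        qed
        then have "k * (1 + (real n + k) * 4 ^ k) \<le> k * (q ^ (2 ^ i) * (1 + (1 + real k) * 4 ^ k))"
          by (intro mult_left_mono) auto
        then have "\<tau> \<le> k * (q ^ (2 ^ i) * (1 + (1 + real k) * 4 ^ k)) / q ^ y"
          unfolding \<tau>_def using q by (intro divide_right_mono) auto
        also have "\<dots> = K1 / q ^ (2 ^ i)" using qL by (simp add: qy K1_def)
        finally show ?thesis .
      qed
      have L: "real L \<le> q ^ m * (K2 / q ^ (2 ^ i))"
      proof -
        have "2 ^ (i + 2) * (i + 1) \<le> sieve_threshold k i"
          unfolding sieve_threshold_def by (intro mult_left_mono) auto
        then show ?thesis unfolding L_def K2_def q_def
          using i m n f by (intro large_square_divisors_negligible) auto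
      qed
      have S: "S \<le> k * (2 * real i + 3)" "0 \<le> S"
      proof -
        show "S \<le> k * (2 * real i + 3)"
          using sum_sq_density_le[OF f(1,2), of "i + 1"] by (simp add: S_def A_def y_def algebra_simps)
        show "0 \<le> S" unfolding S_def using dens Asub by (intro sum_nonneg) auto
      qed
      have V: "c * exp (- 2 * S) \<le> V"
        unfolding c_def V_def S_def q_def using Asub False f by (intro prod_sq_density_ge) auto
      then have Vpos: "V > 0" using c by (smt (verit) exp_gt_zero mult_pos_pos)
      have V1: "V \<le> 1" unfolding V_def using dens Asub by (intro prod_le_1) auto
      have one: "1 \<le> exp (2 * S) / c * V"
      proof -
        have "exp (2 * S) / c * (c * exp (- 2 * S)) \<le> exp (2 * S) / c * V"
          using V c by (intro mult_left_mono) auto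
        moreover have "exp (2 * S) / c * (c * exp (- 2 * S)) = 1"
          using c by (simp add: exp_minus field_simps)
        ultimately show ?thesis by simp
      qed
      have e1: "2 * exp (3 * S - real r) \<le> 2 * exp (- (real i + 1)) / c * V"
      proof -
        have "2 * exp (3 * S - real r) * 1 \<le> 2 * exp (3 * S - real r) * (exp (2 * S) / c * V)"
          using one by (intro mult_left_mono) auto
        also have "\<dots> = 2 * exp (5 * S - real r) / c * V"
        proof -
          have "exp (3 * S - real r) * exp (2 * S) = exp (5 * S - real r)" by (simp add: exp_add[symmetric])
          then show ?thesis by simp
        qed
        also have "\<dots> \<le> 2 * exp (- (real i + 1)) / c * V"
        proof -
          \<comment> \<open>Of the \<open>5 * S\<close>, three come from the sieve tail and two from
            dividing by \<open>V\<close>. As \<open>2 * i + 3\<close> is at most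
            \<open>3 * (i + 1)\<close>, the constant 15 in \<open>r\<close> covers them and its
            \<open>+ 1\<close> leaves the decay.\<close>
          have "5 * S \<le> 5 * (k * (2 * real i + 3))" using S by simp
          also have "\<dots> \<le> real r - (real i + 1)"
            by (simp add: r_def algebra_simps mult_left_mono)
          finally have "5 * S - real r \<le> - (real i + 1)" by simp
          then show ?thesis using c Vpos by (intro mult_right_mono divide_right_mono) auto
        qed
        finally show ?thesis by simp
      qed
      have e2: "(K1 + K2) / q ^ (2 ^ i) \<le> (K1 + K2) * exp (2 * k * (2 * real i + 3)) / 2 ^ (2 ^ i) / c * V"
      proof -
        have "(K1 + K2) / q ^ (2 ^ i) \<le> (K1 + K2) / 2 ^ (2 ^ i)"
          using qL K by (intro divide_left_mono) auto
        also have "\<dots> = (K1 + K2) / 2 ^ (2 ^ i) * 1" by simp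
        also have "\<dots> \<le> (K1 + K2) / 2 ^ (2 ^ i) * (exp (2 * S) / c * V)"
          using K by (intro mult_left_mono[OF one]) auto
        also have "\<dots> \<le> (K1 + K2) / 2 ^ (2 ^ i) * (exp (2 * k * (2 * real i + 3)) / c * V)"
          using K S c Vpos by (intro mult_left_mono mult_right_mono divide_right_mono) (auto simp: mult.assoc)
        finally show ?thesis by (simp add: mult_ac)
      qed
      have e12: "2 * exp (3 * S - real r) + (K1 + K2) / q ^ (2 ^ i) \<le> \<eta> i * V"
        using e1 e2 unfolding \<eta>_def by (simp add: add_divide_distrib algebra_simps)
      have \<eta>: "\<eta> i \<le> 1 / 2" "\<eta> i \<le> \<epsilon> / 4" using i1[of i] i by auto
      have \<eta>0: "0 \<le> \<eta> i" unfolding \<eta>_def using c K by auto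
      have "\<tau> \<le> \<eta> i"
      proof -
        have "K1 / q ^ (2 ^ i) \<le> (K1 + K2) / q ^ (2 ^ i)" using K qL by (intro divide_right_mono) auto
        then have "\<tau> \<le> \<eta> i * V" using \<tau> e12 exp_gt_zero[of "3 * S - real r"] by linarith
        also have "\<dots> \<le> \<eta> i * 1" using \<eta>0 V1 by (intro mult_left_mono)
        finally show ?thesis by simp
      qed
      have m2: "2 * y * r \<le> m" using m by (simp add: sieve_threshold_def y_def r_def)
      have "\<bar>real N - q ^ m * V\<bar> \<le> q ^ m * (2 * exp (3 * S - real r) + \<tau>) + real L"
        using card_squarefree_values[OF f m2] unfolding N_def V_def S_def A_def \<tau>_def L_def q_def .
      also have "\<dots> \<le> q ^ m * (2 * exp (3 * S - real r) + K1 / q ^ (2 ^ i)) + q ^ m * (K2 / q ^ (2 ^ i))"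
        using L \<tau> q by (intro add_mono mult_left_mono) auto
      also have "\<dots> = q ^ m * (2 * exp (3 * S - real r) + (K1 + K2) / q ^ (2 ^ i))"
        by (simp add: add_divide_distrib algebra_simps)
      also have "\<dots> \<le> q ^ m * (\<eta> i * V)" using e12 q by (intro mult_left_mono) auto
      finally have N: "\<bar>real N - q ^ m * V\<bar> \<le> q ^ m * (\<eta> i * V)" .
      have cb: "V * (1 - \<tau>) \<le> c_const f" "c_const f \<le> V"
        using c_const_bounds[OF f, of y] unfolding V_def A_def \<tau>_def q_def by auto
      have "V * \<tau> \<le> V * \<eta> i" using \<open>\<tau> \<le> \<eta> i\<close> Vpos by (intro mult_left_mono) auto
      then have Vc: "V - c_const f \<le> \<eta> i * V" using cb by (simp add: algebra_simps)
      then have "\<bar>q ^ m * V - c_const f * q ^ m\<bar> \<le> q ^ m * (\<eta> i * V)"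
      proof -
        have "\<bar>q ^ m * V - c_const f * q ^ m\<bar> = q ^ m * (V - c_const f)"
          using cb(2) q by (simp add: algebra_simps)
        also have "\<dots> \<le> q ^ m * (\<eta> i * V)" using Vc q by (intro mult_left_mono) auto
        finally show ?thesis .
      qed
      with N have "\<bar>real N - c_const f * q ^ m\<bar> \<le> 2 * (q ^ m * (\<eta> i * V))" by linarith
      also have "\<dots> \<le> 2 * (q ^ m * (\<epsilon> / 4 * (2 * c_const f)))"
      proof -
        have "\<eta> i * V \<le> 1 / 2 * V" using \<eta> Vpos by (intro mult_right_mono) auto
        then have "V \<le> 2 * c_const f" using Vc by linarith
        then show ?thesis using \<eta> \<eta>0 Vpos q \<epsilon> by (intro mult_left_mono mult_mono) auto
      qed
      also have "\<dots> = \<epsilon> * (c_const f * q ^ m)" by simp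
      finally show ?thesis .
    qed
    then show "\<bar>real (card {a \<in> polys_lt m. squarefree (poly f a)}) - c_const f * real CARD('a) ^ m\<bar>
      \<le> \<epsilon> * (c_const f * real CARD('a) ^ m)"
      by (simp add: N_def q_def)
  qed
qed

text \<open>The largest admissible level is taken: the upper bound on \<open>m\<close> is what
  converts the growth hypothesis into a bound on \<open>n\<close>.\<close>

lemma exists_sieve_level:
  assumes "sieve_threshold k i0 \<le> m"
  obtains i where "i0 \<le> i" "sieve_threshold k i \<le> m" "m < sieve_threshold k (Suc i)"
proof -
  have bound: "i \<le> m" if "sieve_threshold k i \<le> m" for i
  proof -
    have "i < 2 ^ i" by (rule less_exp)
    also have "(2::nat) ^ i \<le> 2 ^ (i + 2)" by (intro power_increasing) auto
    also have "\<dots> \<le> sieve_threshold k i" by (simp add: sieve_threshold_def)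
    finally show ?thesis using that by simp
  qed
  define i where "i = (GREATEST i. sieve_threshold k i \<le> m)"
  have "sieve_threshold k i \<le> m" unfolding i_def by (rule GreatestI_nat[of _ i0 m]) (use assms bound in auto)
  moreover have "i0 \<le> i" unfolding i_def by (rule Greatest_le_nat[of _ i0 m]) (use assms bound in auto)
  moreover have "\<not> sieve_threshold k (Suc i) \<le> m"
  proof
    assume "sieve_threshold k (Suc i) \<le> m"
    then have "Suc i \<le> i" unfolding i_def by (rule Greatest_le_nat[of _ _ m]) (use bound in auto)
    then show False by simp
  qed
  ultimately show ?thesis using that by (meson not_le)
qed

theorem theorem2p2:
  fixes p e q k :: nat
  assumes "prime p" and "e > 0" and "q = p ^ e" and "CARD('a::{field,finite}) = q" and "k > 0"
  shows "\<exists>C::real. C > 0 \<and>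
    (\<forall>(m :: nat \<Rightarrow> nat) (n :: nat \<Rightarrow> nat) (f :: nat \<Rightarrow> 'a poly poly).
       (\<forall>j\<ge>1. m j > 0 \<and> n j > 0 \<and> n j \<ge> q) \<longrightarrow>
       filterlim m at_top sequentially \<longrightarrow>
       (\<forall>j\<ge>1. real (m j) \<ge> C * log q (n j) * log q (log q (n j))) \<longrightarrow>
       (\<forall>j\<ge>1. squarefree (f j) \<and> degree (f j) \<le> k \<and> deg_t (f j) \<le> n j) \<longrightarrow>
       (\<lambda>j. real (card {a :: 'a poly. degree a < m j \<and> squarefree (poly (f j) a)})
              - c_const (f j) * real q ^ m j)
         \<in> o(\<lambda>j. c_const (f j) * real q ^ m j))"
proof -
  have q2: "q \<ge> 2" using CARD_field_ge_2[where 'a='a] assms by simp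
  then have lq: "log q 2 > 0" by simp
  \<comment> \<open>For \<open>i\<close> at least 1, \<open>sieve_threshold k (Suc i)\<close> is
    \<open>8 * (15 * k + 1) * 2 ^ i * (i + 2)\<close>, at most
    \<open>24 * (15 * k + 1) * 2 ^ i * i\<close>. If \<open>log q n\<close> exceeds
    \<open>2 ^ i\<close>, its iterated logarithm is at least \<open>i * log q 2\<close>; the
    denominator of \<open>C\<close> cancels \<open>log q 2\<close>.\<close>
  define C where "C = 24 * real (15 * k + 1) / log q 2"
  have C: "C > 0" using lq by (simp add: C_def)
  have level: "n \<le> q ^ (2 ^ i)"
    if n: "q \<le> n" and m: "real m \<ge> C * log q n * log q (log q n)"
      and i: "1 \<le> i" "m < sieve_threshold k (Suc i)" for m n i :: nat
  proof (rule ccontr)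
    assume "\<not> n \<le> q ^ (2 ^ i)"
    then have "real (q ^ (2 ^ i)) < real n" by (simp only: of_nat_less_iff not_le)
    then have "log q (real q ^ (2 ^ i)) < log q n" using q2 by (intro log_less) auto
    then have 1: "2 ^ i < log q n" using q2 by (simp add: log_nat_power)
    then have "log q (2 ^ i) \<le> log q (log q n)" using q2 by (intro log_mono) auto
    then have 2: "i * log q 2 \<le> log q (log q n)" by (simp add: log_nat_power)
    have "C * 2 ^ i * (i * log q 2) \<le> C * log q n * log q (log q n)"
    proof (rule mult_mono)
      have "0 < log q n" using 1 by (rule less_trans[rotated]) simp
      then show "0 \<le> C * log q n" using C by simp
    qed (use 1 2 C lq in auto)
    also have "\<dots> \<le> real m" by (rule m)
    finally have "24 * real (15 * k + 1) * 2 ^ i * i \<le> real m" using lq by (simp add: C_def)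
    then have "real (24 * (15 * k + 1) * 2 ^ i * i) \<le> real m" by simp
    then have "24 * (15 * k + 1) * 2 ^ i * i \<le> m" by (simp only: of_nat_le_iff)
    moreover have "sieve_threshold k (Suc i) \<le> 24 * (15 * k + 1) * 2 ^ i * i"
    proof -
      have "sieve_threshold k (Suc i) = 8 * (15 * k + 1) * 2 ^ i * (i + 2)"
        by (simp add: sieve_threshold_def algebra_simps)
      also have "\<dots> \<le> 8 * (15 * k + 1) * 2 ^ i * (3 * i)" using i by (intro mult_left_mono) auto
      also have "\<dots> = 24 * (15 * k + 1) * 2 ^ i * i" by (simp add: algebra_simps)
      finally show ?thesis .
    qed
    ultimately show False using i by linarith
  qed
  show ?thesis
  proof (intro exI[of _ C] conjI C allI impI)
    fix m n :: "nat \<Rightarrow> nat" and f :: "nat \<Rightarrow> 'a poly poly"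
    assume mn: "\<forall>j\<ge>1. m j > 0 \<and> n j > 0 \<and> n j \<ge> q" and lim: "filterlim m at_top sequentially"
      and mC: "\<forall>j\<ge>1. real (m j) \<ge> C * log q (n j) * log q (log q (n j))"
      and f: "\<forall>j\<ge>1. squarefree (f j) \<and> degree (f j) \<le> k \<and> deg_t (f j) \<le> n j"
    show "(\<lambda>j. real (card {a :: 'a poly. degree a < m j \<and> squarefree (poly (f j) a)})
              - c_const (f j) * real q ^ m j) \<in> o(\<lambda>j. c_const (f j) * real q ^ m j)"
    proof (rule landau_o.smallI)
      fix \<epsilon> :: real assume "\<epsilon> > 0"
      then obtain i0 where i0: "\<And>i m n (f :: 'a poly poly). i \<ge> i0 \<Longrightarrow> sieve_threshold k i \<le> m \<Longrightarrow>
          n \<le> CARD('a) ^ (2 ^ i) \<Longrightarrow> squarefree f \<Longrightarrow> degree f \<le> k \<Longrightarrow> tdeg_le f n \<Longrightarrow>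
          \<bar>real (card {a \<in> polys_lt m. squarefree (poly f a)}) - c_const f * real CARD('a) ^ m\<bar>
            \<le> \<epsilon> * (c_const f * real CARD('a) ^ m)"
        using squarefree_count_uniform[of \<epsilon> k, where 'a='a] by blast
      \<comment> \<open>Level 0 is excluded because \<open>i + 2\<close> is bounded by
        \<open>3 * i\<close> only from 1 on.\<close>
      have "eventually (\<lambda>j. sieve_threshold k (max 1 i0) \<le> m j) sequentially"
        using lim by (simp add: filterlim_at_top)
      then show "eventually (\<lambda>j. norm (real (card {a :: 'a poly. degree a < m j \<and> squarefree (poly (f j) a)})
              - c_const (f j) * real q ^ m j) \<le> \<epsilon> * norm (c_const (f j) * real q ^ m j)) sequentially"
        using eventually_ge_at_top[of 1]
      proof eventually_elim
        case (elim j)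
        obtain i where i: "max 1 i0 \<le> i" "sieve_threshold k i \<le> m j" "m j < sieve_threshold k (Suc i)"
          using exists_sieve_level[OF elim(1)] by blast
        have "n j \<le> CARD('a) ^ (2 ^ i)"
          using level[of "n j" "m j" i] mn mC i elim(2) assms(4) by auto
        then have "\<bar>real (card {a \<in> polys_lt (m j). squarefree (poly (f j) a)}) - c_const (f j) * real q ^ m j\<bar>
            \<le> \<epsilon> * (c_const (f j) * real q ^ m j)"
          using i0[of i "m j" "n j" "f j"] i f elim(2) assms(4) tdeg_le_deg_t by auto
        moreover have "{a \<in> polys_lt (m j). squarefree (poly (f j) a)} =
            {a. degree a < m j \<and> squarefree (poly (f j) a)}"
          using mn elim(2) by (auto simp: polys_lt_eq)
        moreover have "\<epsilon> * (c_const (f j) * real q ^ m j) \<le> \<epsilon> * norm (c_const (f j) * real q ^ m j)"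
          using \<open>\<epsilon> > 0\<close> by (intro mult_left_mono) auto
        ultimately show ?case by simp
      qed
    qed
  qed
qed

end
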